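(* Let $1<p\le2<q<\infty$ and let $x_0\in\mathbb{R}^2$. For any $\varepsilon\in(0,1)$, there exist a constant $C=C(p,q,\varepsilon)$ and a sufficiently small $R_0>0$ such that for any $u\in C_0^\infty(B_{R_0}(x_0)\setminus\{x_0\})$ and any $\tau>1$, $$\tau^{1+\beta_1}\|(\log r)^{-1}e^{-\tau\phi(r)}u\|_{L^2(r^{-2}dx)}+\tau^{\beta_0}\|(\log r)^{-1}e^{-\tau\phi(r)}u\|_{L^q(r^{-2(1-\varepsilon)}dx)}+\tau^{\beta_1}\|(\log r)^{-1}e^{-\tau\phi(r)}r\nabla u\|_{L^2(r^{-2}dx)}$$ $$\le C\|(\log r)e^{-\tau\phi(r)}r^2\Delta u\|_{L^p(r^{-2}dx)},$$ where $\beta_0=\frac2q(1-\varepsilon)+1-\frac1p$ and $\beta_1=1-\frac1p$.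
   Context: Here $r=|x-x_0|$ for $x\in\mathbb{R}^2$, $B_{R_0}(x_0)$ is the ball of radius $R_0$ about $x_0$ in $\mathbb{R}^2$, and the weight function is $\phi(r)=\log r+\log\big((\log r)^2\big)$. For an exponent $a$ and a weight $w$, $\|f\|_{L^a(w\,dx)}=\left(\int|f(x)|^a\,w(x)\,dx\right)^{1/a}$, so e.g. $\|f\|_{L^p(r^{-2}dx)}=\left(\int|f|^pr^{-2}dx\right)^{1/p}$. Functions are complex-valued. *)

theory Defs
  imports "HOL-Analysis.Analysis"
begin

definition partial_deriv :: "'n::finite \<Rightarrow> (real ^ 'n \<Rightarrow> 'b::real_normed_vector) \<Rightarrow> real ^ 'n \<Rightarrow> 'b" where
  "partial_deriv i f x = vector_derivative (\<lambda>t. f (x + t *\<^sub>R axis i 1)) (at 0)"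

definition gradient :: "(real ^ 'n::finite \<Rightarrow> complex) \<Rightarrow> real ^ 'n \<Rightarrow> complex ^ 'n" where
  "gradient u x = (\<chi> i. partial_deriv i u x)"

definition laplacian :: "(real ^ 'n::finite \<Rightarrow> 'b::real_normed_vector) \<Rightarrow> real ^ 'n \<Rightarrow> 'b" where
  "laplacian u x = (\<Sum>i\<in>UNIV. partial_deriv i (partial_deriv i u) x)"

primrec C_k :: "nat \<Rightarrow> (real ^ 'n::finite \<Rightarrow> 'b::real_normed_vector) \<Rightarrow> bool" where
  "C_k 0 f \<longleftrightarrow> continuous_on UNIV f"
| "C_k (Suc k) f \<longleftrightarrow> f differentiable_on UNIV \<and> (\<forall>i. C_k k (partial_deriv i f))"

text \<open>Elements of \<open>C\<^sub>0\<^sup>\<infinity>(\<Omega>)\<close> are represented by their extensions by zero to the whole space.\<close>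

definition test_functions :: "(real ^ 'n::finite) set \<Rightarrow> (real ^ 'n \<Rightarrow> 'b::real_normed_vector) set" where
  "test_functions \<Omega> =
     {u. (\<forall>k. C_k k u) \<and> compact (closure {x. u x \<noteq> 0}) \<and> closure {x. u x \<noteq> 0} \<subseteq> \<Omega>}"

text \<open>The norm of \<open>L\<^sup>a(w dx)\<close>. The value is meaningful when the integrand is integrable, since
  otherwise the Bochner integral is \<open>0\<close>. For \<open>a > 0\<close> the integrand is integrable, for example, if \<open>f\<close> is continuous
  with compact support and \<open>w\<close> is continuous on a neighbourhood of that support.\<close>

definition weighted_norm ::
    "real \<Rightarrow> ('a::euclidean_space \<Rightarrow> real) \<Rightarrow> ('a \<Rightarrow> 'b::real_normed_vector) \<Rightarrow> real" where
  "weighted_norm a w f = (LINT x|lborel. norm (f x) powr a * w x) powr (1 / a)"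

definition phi :: "real \<Rightarrow> real" where
  "phi r = ln r + ln ((ln r)\<^sup>2)"

end

theory Submission
  imports Defs
begin

text \<open>
  In the logarithmic coordinate \<open>t = ln r\<close> the operator \<open>r\<^sup>2 \<Delta>\<close> factors: with \<open>U = z (u\<^sub>x - \<i> u\<^sub>y)\<close> one has
  \<open>dbar U = z \<Delta> u\<close>, where \<open>dbar\<close> is twice the Cauchy--Riemann operator. So a single first-order estimate
  \<open>\<tau>\<^bsup>1 - 1/p\<^esup> \<parallel>t\<^sup>-\<^sup>1 exp (- \<tau> \<phi>) U\<parallel> \<le> C \<parallel>t exp (- \<tau> \<phi>) r dbar U\<parallel>\<close> from \<open>L\<^sup>p\<close> to \<open>L\<^sup>2\<close>, applied to \<open>u\<close> and to its
  complex conjugate, gives the gradient term.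

  For \<open>p = 2\<close> the first-order estimate is an energy identity. For \<open>p < 2\<close> one represents \<open>U\<close> by the Cauchy kernel twisted by
  \<open>(z / \<zeta>)\<^sup>m\<close>, where the integer \<open>m\<close> is chosen next to \<open>\<tau> \<phi>'(t)\<close>: since \<open>\<phi>\<close> is concave in \<open>t\<close>, the weights then become
  Gaussian in \<open>ln |z| - ln |\<zeta>|\<close>, and Young's inequality with exponent \<open>1/\<sigma> = 3/2 - 1/p\<close> gives the power of \<open>\<tau>\<close>.

  The zero-order term follows from the gradient term by integrating a radial derivative, and the \<open>L\<^sup>q\<close> term
  from both by a Gagliardo--Nirenberg inequality.
\<close>

text \<open>As a function t + ln (t^2) of t = ln r, \<open>phi\<close> has second derivative - 2 /
  t^2, so the concavity behind the first-order estimate fades as r tends to 0. The factors (ln r)^-1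
  on the left and ln r on the right pay for this loss. It shows up in the kernel as |t - s| <= |t|
  |s| |s/t - 1| / max 1 (s/t), and in the energy identity as the factor t^-2.

  The representation formula is used only in absolute value, which is why m may vary with z.
  Rounding m up to an integer costs a factor that the numerator of \<open>kern\<close> absorbs.

  The power of \<tau> is the L^\<sigma> size of the kernel for the scale-invariant measure r^-2 dx,
  namely the power - (1/\<sigma> - 1/2) = - (1 - 1/p). For p = 2 one would have \<sigma> = 1, where
  the model integrals behind this bound diverge.

  The Gagliardo-Nirenberg step yields the power 2/q with weight r^-2. Since r < 1 < \<tau>, this
  implies the form with 1 - \<epsilon>.\<close>

subsection \<open>Partial derivatives\<close>

text \<open>\<open>partial_deriv\<close> is total through a choice operator and says nothing about
  existence. The relational form records existence, so that rules of calculus can be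
  chained.\<close>

definition has_pd :: "'n::finite \<Rightarrow> (real ^ 'n \<Rightarrow> 'b::real_normed_vector) \<Rightarrow> 'b \<Rightarrow> real ^ 'n \<Rightarrow> bool" where
  "has_pd i f D x \<longleftrightarrow> ((\<lambda>t. f (x + t *\<^sub>R axis i 1)) has_vector_derivative D) (at 0)"

lemma partial_deriv_eqI: "has_pd i f D x \<Longrightarrow> partial_deriv i f x = D"
  unfolding has_pd_def partial_deriv_def by (rule vector_derivative_at)

lemma has_pd_unique: "has_pd i f D x \<Longrightarrow> has_pd i f D' x \<Longrightarrow> D = D'"
  using partial_deriv_eqI by metis

lemma has_derivative_imp_has_pd:
  assumes "(f has_derivative F) (at x)"
  shows "has_pd i f (F (axis i 1)) x"
proof -
  have "((\<lambda>t::real. x + t *\<^sub>R axis i 1) has_derivative (\<lambda>t. t *\<^sub>R axis i 1)) (at 0)"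
    by (auto intro!: derivative_eq_intros)
  moreover have "(f has_derivative F) (at (x + 0 *\<^sub>R axis i 1))" using assms by simp
  ultimately have "((\<lambda>t. f (x + t *\<^sub>R axis i 1)) has_derivative (\<lambda>t. F (t *\<^sub>R axis i 1))) (at 0)"
    by (rule has_derivative_compose)
  then show ?thesis
    using bounded_linear.linear[OF has_derivative_bounded_linear[OF assms]]
    by (simp add: has_pd_def has_vector_derivative_def linear_scale)
qed

lemma differentiable_imp_has_pd:
  assumes "f differentiable (at x)"
  shows "has_pd i f (partial_deriv i f x) x"
proof -
  obtain F where "(f has_derivative F) (at x)" using assms unfolding differentiable_def by blast
  then have "has_pd i f (F (axis i 1)) x" by (rule has_derivative_imp_has_pd)
  then show ?thesis using partial_deriv_eqI by metis
qed

lemma has_pd_cong_open: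
  assumes "has_pd i f D x" "open S" "x \<in> S" "\<And>y. y \<in> S \<Longrightarrow> f y = g y"
  shows "has_pd i g D x"
proof -
  have "isCont (\<lambda>t::real. x + t *\<^sub>R axis i 1) 0" by (intro continuous_intros)
  then have "((\<lambda>t::real. x + t *\<^sub>R axis i 1) \<longlongrightarrow> x) (nhds 0)"
    by (simp add: isCont_def tendsto_nhds_iff)
  then have "\<forall>\<^sub>F t::real in nhds 0. x + t *\<^sub>R axis i 1 \<in> S"
    using assms(2,3) by (simp add: topological_tendstoD)
  then obtain A where A: "open A" "0 \<in> A" "\<And>t::real. t \<in> A \<Longrightarrow> x + t *\<^sub>R axis i 1 \<in> S"
    unfolding eventually_nhds by blast
  show ?thesis
    using assms(1) unfolding has_pd_def
    by (rule has_vector_derivative_transform_within_open[OF _ A(1,2)]) (use assms(4) A(3) in auto)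
qed

lemma has_pd_zero_outside:
  assumes "x \<notin> closure {x. f x \<noteq> 0}"
  shows "has_pd i f 0 x"
proof (rule has_pd_cong_open[of i "\<lambda>_. 0" 0 x "- closure {x. f x \<noteq> 0}"])
  show "has_pd i (\<lambda>_. 0) 0 x" by (simp add: has_pd_def)
  show "\<And>y. y \<in> - closure {x. f x \<noteq> 0} \<Longrightarrow> 0 = f y" using closure_subset[of "{x. f x \<noteq> 0}"] by auto
qed (use assms in auto)

named_theorems pd_intros

lemma has_pd_const [pd_intros]: "has_pd i (\<lambda>_. c) 0 x"
  by (simp add: has_pd_def)

lemma has_pd_add [pd_intros]: "has_pd i f D x \<Longrightarrow> has_pd i g D' x \<Longrightarrow> has_pd i (\<lambda>x. f x + g x) (D + D') x"
  unfolding has_pd_def by (rule has_vector_derivative_add)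

lemma has_pd_diff [pd_intros]: "has_pd i f D x \<Longrightarrow> has_pd i g D' x \<Longrightarrow> has_pd i (\<lambda>x. f x - g x) (D - D') x"
  unfolding has_pd_def by (rule has_vector_derivative_diff)

lemma has_pd_mult [pd_intros]:
  fixes f g :: "real ^ 'n::finite \<Rightarrow> 'b::real_normed_algebra"
  shows "has_pd i f D x \<Longrightarrow> has_pd i g D' x \<Longrightarrow> has_pd i (\<lambda>x. f x * g x) (f x * D' + D * g x) x"
  unfolding has_pd_def using has_vector_derivative_mult by fastforce

lemma has_pd_bounded_linear:
  "bounded_linear h \<Longrightarrow> has_pd i f D x \<Longrightarrow> has_pd i (\<lambda>x. h (f x)) (h D) x"
  unfolding has_pd_def by (rule bounded_linear.has_vector_derivative)

lemmas has_pd_Re [pd_intros] = has_pd_bounded_linear[OF bounded_linear_Re]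
lemmas has_pd_Im [pd_intros] = has_pd_bounded_linear[OF bounded_linear_Im]
lemmas has_pd_cnj [pd_intros] = has_pd_bounded_linear[OF bounded_linear_cnj]

lemma has_pd_of_real [pd_intros]:
  "has_pd i f D x \<Longrightarrow> has_pd i (\<lambda>x. complex_of_real (f x)) (of_real D) x"
  by (rule has_pd_bounded_linear[OF bounded_linear_of_real])

lemma has_pd_component [pd_intros]: "has_pd i (\<lambda>x. x $ j) (if i = j then 1 else 0) x"
  unfolding has_pd_def by (auto intro!: derivative_eq_intros simp: axis_def)

lemma has_pd_chain:
  assumes "(g has_real_derivative d) (at (f x))" "has_pd i f D x"
  shows "has_pd i (\<lambda>x. g (f x)) (d * D) x"
proof -
  have "((\<lambda>t. f (x + t *\<^sub>R axis i 1)) has_real_derivative D) (at 0)"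
    using assms(2) by (simp add: has_pd_def has_real_derivative_iff_has_vector_derivative)
  moreover have "(g has_real_derivative d) (at (f (x + 0 *\<^sub>R axis i 1)))" using assms(1) by simp
  ultimately have "((\<lambda>t. g (f (x + t *\<^sub>R axis i 1))) has_real_derivative d * D) (at 0)"
    by (intro DERIV_chain2)
  then show ?thesis by (simp add: has_pd_def has_real_derivative_iff_has_vector_derivative)
qed

lemma has_pd_field_chain:
  fixes f :: "real ^ 'n::finite \<Rightarrow> complex"
  assumes "(g has_field_derivative d) (at (f x))" "has_pd i f D x"
  shows "has_pd i (\<lambda>x. g (f x)) (D * d) x"
proof -
  have "(g has_field_derivative d) (at (f (x + 0 *\<^sub>R axis i 1)))" using assms(1) by simp
  with assms(2) show ?thesis unfolding has_pd_def
    using field_vector_diff_chain_at[of "\<lambda>t. f (x + t *\<^sub>R axis i 1)" D 0 g d] by (simp add: o_def)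
qed

lemma has_pd_norm: "x \<noteq> 0 \<Longrightarrow> has_pd i norm (x $ i / norm x) x"
  using has_derivative_imp_has_pd[OF has_derivative_norm, of x i]
  by (simp add: inner_axis' sgn_div_norm divide_inverse mult.commute)

lemma has_pd_ln_norm:
  assumes "x \<noteq> 0" shows "has_pd i (\<lambda>x. ln (norm x)) (x $ i / (norm x)\<^sup>2) x"
  using has_pd_chain[OF DERIV_ln has_pd_norm[OF assms, of i]] assms
  by (simp add: power2_eq_square divide_inverse mult_ac)

subsection \<open>Smooth functions\<close>

lemma C_k_continuous: "C_k k f \<Longrightarrow> continuous_on UNIV f"
  by (cases k) (auto simp: differentiable_imp_continuous_on)

lemma C_k_Suc_has_pd:
  assumes "C_k (Suc k) f" shows "has_pd i f (partial_deriv i f x) x"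
  using assms by (auto intro!: differentiable_imp_has_pd simp: differentiable_on_def)

lemma C_k_Suc_imp: "C_k (Suc k) f \<Longrightarrow> C_k k f"
  by (induction k arbitrary: f) (auto simp: differentiable_imp_continuous_on)

lemma C_k_const: "C_k k (\<lambda>_ :: real ^ 'n::finite. c)"
proof (induction k arbitrary: c)
  case (Suc k)
  have "partial_deriv i (\<lambda>_. c) = (\<lambda>_. 0)" for i :: 'n by (intro ext partial_deriv_eqI has_pd_const)
  with Suc show ?case by auto
qed simp

lemma C_k_add:
  "C_k k f \<Longrightarrow> C_k k g \<Longrightarrow> C_k k (\<lambda>x. f x + g x)"
proof (induction k arbitrary: f g)
  case (Suc k)
  have "partial_deriv i (\<lambda>x. f x + g x) = (\<lambda>x. partial_deriv i f x + partial_deriv i g x)" for i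
    by (intro ext partial_deriv_eqI has_pd_add C_k_Suc_has_pd[where k = k] Suc.prems)
  with Suc show ?case by auto
qed (auto intro: continuous_on_add)

lemma C_k_mult:
  fixes f g :: "real ^ 'n::finite \<Rightarrow> 'b::real_normed_algebra"
  shows "C_k k f \<Longrightarrow> C_k k g \<Longrightarrow> C_k k (\<lambda>x. f x * g x)"
proof (induction k arbitrary: f g)
  case (Suc k)
  have "partial_deriv i (\<lambda>x. f x * g x) = (\<lambda>x. f x * partial_deriv i g x + partial_deriv i f x * g x)" for i
    by (intro ext partial_deriv_eqI has_pd_mult C_k_Suc_has_pd[where k = k] Suc.prems)
  moreover have "C_k k f" "C_k k g" using Suc.prems C_k_Suc_imp by blast+
  ultimately show ?case using Suc by (auto intro!: C_k_add)
qed (auto intro: continuous_on_mult)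

lemma C_k_bounded_linear_comp:
  assumes h: "bounded_linear h"
  shows "C_k k f \<Longrightarrow> C_k k (\<lambda>x. h (f x))"
proof (induction k arbitrary: f)
  case (Suc k)
  have "partial_deriv i (\<lambda>x. h (f x)) = (\<lambda>x. h (partial_deriv i f x))" for i
    by (rule ext, rule partial_deriv_eqI, rule has_pd_bounded_linear[OF h C_k_Suc_has_pd[OF Suc.prems]])
  moreover have "(\<lambda>x. h (f x)) differentiable_on UNIV"
  proof -
    have "(\<lambda>x. h (f x)) differentiable (at x)" for x
    proof -
      have "f differentiable (at x)" using Suc.prems by (simp add: differentiable_on_def)
      then obtain F where "(f has_derivative F) (at x)" unfolding differentiable_def by blast
      from bounded_linear.has_derivative[OF h this] show ?thesis unfolding differentiable_def by blast
    qed
    then show ?thesis by (simp add: differentiable_on_def)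
  qed
  ultimately show ?case using Suc by auto
qed (auto intro: bounded_linear.continuous_on h)

lemma C_k_bounded_linear:
  assumes "bounded_linear h" shows "C_k k h"
proof (cases k)
  case 0 then show ?thesis using assms by (simp add: linear_continuous_on)
next
  case (Suc m)
  have "partial_deriv i h = (\<lambda>_. h (axis i 1))" for i
    by (rule ext, rule partial_deriv_eqI, rule has_derivative_imp_has_pd[OF bounded_linear_imp_has_derivative[OF assms]])
  with Suc assms show ?thesis
    by (auto simp: C_k_const differentiable_on_def bounded_linear_imp_differentiable)
qed

lemma has_pd_shift: "has_pd i (\<lambda>x. f (x + a)) D x \<longleftrightarrow> has_pd i f D (x + a)"
  by (simp add: has_pd_def algebra_simps)

lemma partial_deriv_shift: "partial_deriv i (\<lambda>x. f (x + a)) = (\<lambda>x. partial_deriv i f (x + a))"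
  by (simp add: partial_deriv_def fun_eq_iff algebra_simps)

lemma C_k_shift: "C_k k f \<Longrightarrow> C_k k (\<lambda>x. f (x + a))"
proof (induction k arbitrary: f)
  case 0
  then have "continuous_on UNIV f" by simp
  then have "continuous_on UNIV (\<lambda>x. f (x + a))"
    by (rule continuous_on_compose2) (auto intro!: continuous_intros)
  then show ?case by simp
next
  case (Suc k)
  have "(\<lambda>x. f (x + a)) differentiable (at x)" for x
  proof -
    have "f differentiable (at (x + a))" using Suc.prems by (simp add: differentiable_on_def)
    then obtain F where "(f has_derivative F) (at (x + a))" unfolding differentiable_def by blast
    moreover have "((\<lambda>x. x + a) has_derivative (\<lambda>x. x)) (at x)" by (auto intro!: derivative_eq_intros)
    ultimately have "((\<lambda>x. f (x + a)) has_derivative (\<lambda>x. F x)) (at x)"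
      using has_derivative_compose by blast
    then show ?thesis unfolding differentiable_def by blast
  qed
  with Suc show ?case by (auto simp: differentiable_on_def partial_deriv_shift)
qed

section \<open>Symmetry of second partial derivatives\<close>

lemma second_mixed_difference:
  fixes f :: "real ^ 'n::finite \<Rightarrow> real"
  assumes 1: "\<And>x. has_pd i f (fi x) x" and 2: "\<And>x. has_pd j fi (fij x) x" and "h > 0"
  shows "\<exists>s\<in>{0<..<h}. \<exists>t\<in>{0<..<h}. f (x + h *\<^sub>R axis i 1 + h *\<^sub>R axis j 1) - f (x + h *\<^sub>R axis i 1)
    - f (x + h *\<^sub>R axis j 1) + f x = h\<^sup>2 * fij (x + s *\<^sub>R axis i 1 + t *\<^sub>R axis j 1)"
proof -
  define e1 :: "real ^ 'n" where "e1 = axis i 1"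
  define e2 :: "real ^ 'n" where "e2 = axis j 1"
  have d1: "((\<lambda>s. f (y + s *\<^sub>R e1)) has_real_derivative fi (y + s *\<^sub>R e1)) (at s)" for y s
    using 1[of "y + s *\<^sub>R e1"] DERIV_shift[of "\<lambda>s. f (y + s *\<^sub>R e1)" "fi (y + s *\<^sub>R e1)" 0 s]
    by (simp add: has_pd_def has_real_derivative_iff_has_vector_derivative e1_def algebra_simps)
  have d2: "((\<lambda>s. fi (y + s *\<^sub>R e2)) has_real_derivative fij (y + s *\<^sub>R e2)) (at s)" for y s
    using 2[of "y + s *\<^sub>R e2"] DERIV_shift[of "\<lambda>s. fi (y + s *\<^sub>R e2)" "fij (y + s *\<^sub>R e2)" 0 s]
    by (simp add: has_pd_def has_real_derivative_iff_has_vector_derivative e2_def algebra_simps)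
  define g where "g = (\<lambda>s. f ((x + h *\<^sub>R e2) + s *\<^sub>R e1) - f (x + s *\<^sub>R e1))"
  have "\<exists>s. 0 < s \<and> s < h \<and> g h - g 0 = (h - 0) * (fi ((x + h *\<^sub>R e2) + s *\<^sub>R e1) - fi (x + s *\<^sub>R e1))"
    unfolding g_def by (intro MVT2 \<open>h > 0\<close> DERIV_diff d1)
  then obtain s where s: "0 < s" "s < h" "g h - g 0 = h * (fi ((x + h *\<^sub>R e2) + s *\<^sub>R e1) - fi (x + s *\<^sub>R e1))"
    by auto
  have "\<exists>t. 0 < t \<and> t < h \<and> fi ((x + s *\<^sub>R e1) + h *\<^sub>R e2) - fi ((x + s *\<^sub>R e1) + 0 *\<^sub>R e2)
      = (h - 0) * fij ((x + s *\<^sub>R e1) + t *\<^sub>R e2)"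
    by (intro MVT2 \<open>h > 0\<close> d2)
  then obtain t where t: "0 < t" "t < h" "fi ((x + s *\<^sub>R e1) + h *\<^sub>R e2) - fi (x + s *\<^sub>R e1)
      = h * fij ((x + s *\<^sub>R e1) + t *\<^sub>R e2)" by auto
  have "g h - g 0 = h * (h * fij ((x + s *\<^sub>R e1) + t *\<^sub>R e2))"
    using s(3) t(3) by (simp add: algebra_simps)
  then have "f (x + h *\<^sub>R e1 + h *\<^sub>R e2) - f (x + h *\<^sub>R e1) - f (x + h *\<^sub>R e2) + f x
      = h\<^sup>2 * fij (x + s *\<^sub>R e1 + t *\<^sub>R e2)"
    by (simp add: g_def power2_eq_square algebra_simps)
  then show ?thesis unfolding e1_def e2_def using s t by (intro bexI[of _ s] bexI[of _ t]) auto
qed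

text \<open>The second difference of f over a small square does not depend on the order of the two
  directions. Hence \<open>fij\<close> and \<open>fji\<close> take a common value at points close to
  x, and continuity does the rest.\<close>

lemma mixed_partials_eq_real:
  fixes f :: "real ^ 'n::finite \<Rightarrow> real"
  assumes 1: "\<And>x. has_pd i f (fi x) x" and 2: "\<And>x. has_pd j fi (fij x) x"
    and 3: "\<And>x. has_pd j f (fj x) x" and 4: "\<And>x. has_pd i fj (fji x) x"
    and c: "continuous_on UNIV fij" "continuous_on UNIV fji"
  shows "fij x = fji x"
proof (rule ccontr)
  assume ne: "fij x \<noteq> fji x"
  define e where "e = \<bar>fij x - fji x\<bar> / 2"
  have "e > 0" using ne by (simp add: e_def)
  obtain d1 where d1: "d1 > 0" "\<And>y. dist y x < d1 \<Longrightarrow> dist (fij y) (fij x) < e"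
    using c(1) \<open>e > 0\<close> unfolding continuous_on_iff by (metis UNIV_I)
  obtain d2 where d2: "d2 > 0" "\<And>y. dist y x < d2 \<Longrightarrow> dist (fji y) (fji x) < e"
    using c(2) \<open>e > 0\<close> unfolding continuous_on_iff by (metis UNIV_I)
  \<comment> \<open>The intermediate points are displaced by less than 2 h, so they stay within both
    \<open>d1\<close> and \<open>d2\<close>.\<close>
  define h where "h = min d1 d2 / 2"
  have h: "h > 0" using d1 d2 by (simp add: h_def)
  obtain s t where st: "0 < s" "s < h" "0 < t" "t < h"
    "f (x + h *\<^sub>R axis i 1 + h *\<^sub>R axis j 1) - f (x + h *\<^sub>R axis i 1)
    - f (x + h *\<^sub>R axis j 1) + f x = h\<^sup>2 * fij (x + s *\<^sub>R axis i 1 + t *\<^sub>R axis j 1)"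
    using second_mixed_difference[OF 1 2 h, of x] by auto
  obtain s' t' where st': "0 < s'" "s' < h" "0 < t'" "t' < h"
    "f (x + h *\<^sub>R axis j 1 + h *\<^sub>R axis i 1) - f (x + h *\<^sub>R axis j 1)
    - f (x + h *\<^sub>R axis i 1) + f x = h\<^sup>2 * fji (x + s' *\<^sub>R axis j 1 + t' *\<^sub>R axis i 1)"
    using second_mixed_difference[OF 3 4 h, of x] by auto
  have eq: "fij (x + s *\<^sub>R axis i 1 + t *\<^sub>R axis j 1) = fji (x + s' *\<^sub>R axis j 1 + t' *\<^sub>R axis i 1)"
    using st(5) st'(5) h by (simp add: algebra_simps)
  have near: "dist (x + a *\<^sub>R axis k 1 + b *\<^sub>R axis l 1) x < min d1 d2"
    if "0 < a" "a < h" "0 < b" "b < h" for a b and k l :: 'n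
  proof -
    have "norm (a *\<^sub>R (axis k 1 :: real ^ 'n) + b *\<^sub>R axis l 1) \<le> a + b"
      using norm_triangle_ineq[of "a *\<^sub>R (axis k 1 :: real ^ 'n)" "b *\<^sub>R axis l 1"] that by simp
    then show ?thesis using that by (simp add: dist_norm h_def add.assoc)
  qed
  have "dist (fij (x + s *\<^sub>R axis i 1 + t *\<^sub>R axis j 1)) (fij x) < e"
    using near[OF st(1-4), of i j] by (intro d1(2)) simp
  moreover have "dist (fji (x + s' *\<^sub>R axis j 1 + t' *\<^sub>R axis i 1)) (fji x) < e"
    using near[OF st'(1-4), of j i] by (intro d2(2)) simp
  ultimately have "\<bar>fij x - fji x\<bar> < e + e"
    using eq by (simp add: dist_real_def)
  then show False by (simp add: e_def)
qed

text \<open>The mean value theorem is a real statement, hence the passage through \<open>Re\<close>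
  and \<open>Im\<close>.\<close>

lemma mixed_partials_eq:
  fixes f :: "real ^ 'n::finite \<Rightarrow> complex"
  assumes f: "C_k 2 f"
  shows "partial_deriv i (partial_deriv j f) x = partial_deriv j (partial_deriv i f) x"
proof -
  have 1: "C_k (Suc (Suc 0)) f" using f by (simp add: numeral_2_eq_2)
  then have 2: "C_k (Suc 0) (partial_deriv i f)" for i by simp
  have 3: "continuous_on UNIV (partial_deriv j (partial_deriv i f))" for i j using 2 by simp
  have *: "h (partial_deriv i (partial_deriv j f) x) = h (partial_deriv j (partial_deriv i f) x)"
    if h: "bounded_linear h" for h :: "complex \<Rightarrow> real"
  proof -
    have "has_pd j (\<lambda>x. h (f x)) (h (partial_deriv j f x)) x" for x j
      by (rule has_pd_bounded_linear[OF h C_k_Suc_has_pd[OF 1]])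
    moreover have "has_pd i (\<lambda>x. h (partial_deriv j f x)) (h (partial_deriv i (partial_deriv j f) x)) x" for x i j
      by (rule has_pd_bounded_linear[OF h C_k_Suc_has_pd[OF 2]])
    moreover have "continuous_on UNIV (\<lambda>x. h (partial_deriv i (partial_deriv j f) x))" for i j
      by (rule bounded_linear.continuous_on[OF h 3])
    ultimately show ?thesis
      by (intro mixed_partials_eq_real[where f = "\<lambda>x. h (f x)" and fi = "\<lambda>x. h (partial_deriv j f x)"
        and fj = "\<lambda>x. h (partial_deriv i f x)" and i = j and j = i and fij = "\<lambda>x. h (partial_deriv i (partial_deriv j f) x)"
        and fji = "\<lambda>x. h (partial_deriv j (partial_deriv i f) x)"]) blast+
  qed
  show ?thesis using *[OF bounded_linear_Re] *[OF bounded_linear_Im] by (simp add: complex_eq_iff)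
qed

subsection \<open>Test functions\<close>

lemma test_fun_C_k: "u \<in> test_functions \<Omega> \<Longrightarrow> C_k k u"
  by (simp add: test_functions_def)

lemma test_fun_has_pd: "u \<in> test_functions \<Omega> \<Longrightarrow> has_pd i u (partial_deriv i u x) x"
  using test_fun_C_k C_k_Suc_has_pd by blast

lemma test_functionsI:
  assumes u: "u \<in> test_functions \<Omega>" and v: "\<And>k. C_k k v" and z: "\<And>x. x \<notin> closure {x. u x \<noteq> 0} \<Longrightarrow> v x = 0"
  shows "v \<in> test_functions \<Omega>"
proof -
  have "closure {x. v x \<noteq> 0} \<subseteq> closure {x. u x \<noteq> 0}"
    using z by (intro closure_minimal) auto
  moreover have "compact (closure {x. u x \<noteq> 0})" "closure {x. u x \<noteq> 0} \<subseteq> \<Omega>"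
    using u by (auto simp: test_functions_def)
  ultimately show ?thesis
    using v compact_Int_closed[of "closure {x. u x \<noteq> 0}" "closure {x. v x \<noteq> 0}"] unfolding test_functions_def
    by (auto simp: Int_absorb1)
qed

lemma test_fun_zero_outside: "x \<notin> closure {x. u x \<noteq> 0} \<Longrightarrow> u x = 0"
  using closure_subset[of "{x. u x \<noteq> 0}"] by auto

lemma test_fun_partial_deriv:
  assumes u: "u \<in> test_functions \<Omega>" shows "partial_deriv i u \<in> test_functions \<Omega>"
  using test_fun_C_k[OF u, of "Suc _"] by (intro test_functionsI[OF u]) (auto intro!: partial_deriv_eqI has_pd_zero_outside)

lemma test_fun_bounded_linear:
  assumes u: "u \<in> test_functions \<Omega>" and h: "bounded_linear h" shows "(\<lambda>x. h (u x)) \<in> test_functions \<Omega>"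
  by (rule test_functionsI[OF u C_k_bounded_linear_comp[OF h test_fun_C_k[OF u]]])
    (drule test_fun_zero_outside, simp add: linear_0 bounded_linear.linear[OF h])

text \<open>A class larger than \<open>test_functions\<close>: asking only for continuity makes it
  stable under weights singular at the origin, under norms and under positive powers, and it still
  gives integrability. Any K enclosing the support will do, so that K can be passed on to
  products.\<close>

definition compact_supp :: "(real ^ 'n::finite) set \<Rightarrow> (real ^ 'n \<Rightarrow> 'b::real_normed_vector) \<Rightarrow> bool" where
  "compact_supp \<Omega> f \<longleftrightarrow> continuous_on UNIV f \<and> (\<exists>K. compact K \<and> K \<subseteq> \<Omega> \<and> (\<forall>x. x \<notin> K \<longrightarrow> f x = 0))"

lemma compact_supp_TF:
  assumes "u \<in> test_functions \<Omega>" shows "compact_supp \<Omega> u"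
  unfolding compact_supp_def
proof (intro conjI exI[of _ "closure {x. u x \<noteq> 0}"] allI impI)
  show "continuous_on UNIV u" using assms test_fun_C_k C_k_continuous by blast
  show "u x = 0" if "x \<notin> closure {x. u x \<noteq> 0}" for x using that by (rule test_fun_zero_outside)
qed (use assms in \<open>simp_all add: test_functions_def\<close>)

text \<open>\<Omega> and the complement of K are open and cover the space, and g is continuous on
  each. Thus g may contain weights that are discontinuous outside \<Omega>.\<close>

lemma ccI:
  assumes K: "compact K" "K \<subseteq> \<Omega>" "\<And>x. x \<notin> K \<Longrightarrow> g x = 0" and \<Omega>: "open \<Omega>" and g: "continuous_on \<Omega> g"
  shows "compact_supp \<Omega> g"
proof -
  have "continuous_on (\<Omega> \<union> - K) g"
  proof (rule continuous_on_open_Un)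
    have "continuous_on (- K) (\<lambda>_. 0 :: 'b)" by simp
    then show "continuous_on (- K) g"
      by (rule continuous_on_cong[THEN iffD1, rotated -1]) (use K in auto)
  qed (use \<Omega> K g in \<open>auto simp: compact_imp_closed open_Compl\<close>)
  moreover have "\<Omega> \<union> - K = UNIV" using K(2) by auto
  ultimately show ?thesis using K unfolding compact_supp_def by auto
qed

lemma compact_supp_weight:
  assumes f: "compact_supp \<Omega> f" and \<Omega>: "open \<Omega>" and g: "continuous_on \<Omega> g" and z: "\<And>x. f x = 0 \<Longrightarrow> g x = 0"
  shows "compact_supp \<Omega> g"
proof -
  obtain K where "compact K" "K \<subseteq> \<Omega>" "\<And>x. x \<notin> K \<Longrightarrow> f x = 0" using f unfolding compact_supp_def by metis
  then show ?thesis using z by (intro ccI[of K] \<Omega> g) auto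
qed

lemma compact_supp_mono: "compact_supp \<Omega> f \<Longrightarrow> \<Omega> \<subseteq> \<Omega>' \<Longrightarrow> compact_supp \<Omega>' f"
  unfolding compact_supp_def by blast

lemma compact_supp_continuous: "compact_supp \<Omega> f \<Longrightarrow> continuous_on S f"
  using continuous_on_subset unfolding compact_supp_def by blast

lemma compact_supp_measurable: "compact_supp \<Omega> f \<Longrightarrow> f \<in> borel_measurable borel"
  by (intro borel_measurable_continuous_onI compact_supp_continuous)

lemma compact_supp_integrable:
  fixes f :: "real ^ 'n::finite \<Rightarrow> 'b::{banach, second_countable_topology}"
  assumes "compact_supp \<Omega> f" shows "integrable lborel f"
proof -
  obtain K where K: "compact K" "\<And>x. x \<notin> K \<Longrightarrow> f x = 0" using assms by (auto simp: compact_supp_def)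
  have "integrable lborel (\<lambda>x. indicator K x *\<^sub>R f x)"
    by (intro borel_integrable_compact K compact_supp_continuous[OF assms])
  moreover have "(\<lambda>x. indicator K x *\<^sub>R f x) = f" using K(2) by (auto simp: indicator_def)
  ultimately show ?thesis by simp
qed

lemma compact_supp_outside_ball:
  assumes "compact_supp \<Omega> f" obtains R where "0 < R" "\<And>x. norm x > R \<Longrightarrow> f x = 0"
proof -
  obtain K where K: "compact K" "\<And>x. x \<notin> K \<Longrightarrow> f x = 0" using assms by (auto simp: compact_supp_def)
  obtain R where "0 < R" "\<forall>x\<in>K. norm x \<le> R" using K(1) compact_imp_bounded bounded_pos by metis
  then show ?thesis using K(2) by (intro that[of R]) force+
qed

lemma compact_supp_bounded:
  fixes f :: "real ^ 'n::finite \<Rightarrow> 'b::real_normed_vector"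
  assumes "compact_supp \<Omega> f" obtains B where "0 \<le> B" "\<And>x. norm (f x) \<le> B"
proof -
  obtain K where K: "compact K" "\<And>x. x \<notin> K \<Longrightarrow> f x = 0" using assms by (auto simp: compact_supp_def)
  have "bounded (f ` K)" using K(1) compact_supp_continuous[OF assms] compact_continuous_image compact_imp_bounded by blast
  then obtain B where B: "0 < B" "\<forall>y\<in>f ` K. norm y \<le> B" using bounded_pos by metis
  have "norm (f x) \<le> B" for x using B K(2)[of x] by (cases "x \<in> K") auto
  with B show ?thesis by (intro that[of B]) auto
qed

lemma has_pd_has_real_derivative:
  assumes "has_pd i f D (x + s *\<^sub>R axis i 1)"
  shows "((\<lambda>s. f (x + s *\<^sub>R axis i 1)) has_real_derivative D) (at s)"
  using assms DERIV_shift[of "\<lambda>s. f (x + s *\<^sub>R axis i 1)" D 0 s]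
  by (simp add: has_pd_def has_real_derivative_iff_has_vector_derivative algebra_simps)

section \<open>Translation invariance and integrals of partial derivatives\<close>

lemma lborel_integrable_translate:
  fixes f :: "'a::euclidean_space \<Rightarrow> 'b::{banach, second_countable_topology}"
  assumes "integrable lborel f" shows "integrable lborel (\<lambda>x. f (x + a))"
proof -
  have "integrable (distr lborel borel ((+) a)) f" by (simp add: lborel_distr_plus assms)
  then have "integrable lborel (\<lambda>x. f (a + x))"
    by (subst (asm) integrable_distr_eq) (use assms in auto)
  then show ?thesis by (simp add: add.commute)
qed

lemma lborel_integral_translate:
  fixes f :: "'a::euclidean_space \<Rightarrow> 'b::{banach, second_countable_topology}"
  shows "(\<integral>x. f (x + a) \<partial>lborel) = (\<integral>x. f x \<partial>lborel)"
proof (cases "integrable lborel f")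
    case True
    then have "(\<integral>x. f x \<partial>distr lborel borel ((+) a)) = (\<integral>x. f (a + x) \<partial>lborel)"
      by (intro integral_distr) auto
    then show ?thesis by (simp add: lborel_distr_plus add.commute)
  next
    case False
    then have "\<not> integrable lborel (\<lambda>x. f (x + a))" using lborel_integrable_translate[of "\<lambda>x. f (x + a)" "- a"] by auto
    with False show ?thesis by (simp add: not_integrable_integral_eq)
qed

text \<open>Difference quotients have integral 0 by translation invariance, and they converge
  dominatedly to the derivative. This needs no iterated integrals and works in any
  dimension.\<close>

lemma integral_partial_deriv_eq_0:
  fixes f :: "real ^ 'n::finite \<Rightarrow> real"
  assumes f: "compact_supp \<Omega> f" and f': "compact_supp \<Omega> f'" and pd: "\<And>x. has_pd i f (f' x) x"
  shows "(\<integral>x. f' x \<partial>lborel) = 0"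
proof -
  obtain R where R: "0 < R" "\<And>x. norm x > R \<Longrightarrow> f x = 0" by (rule compact_supp_outside_ball[OF f]) blast
  obtain B where B: "0 \<le> B" "\<And>x. norm (f' x) \<le> B" by (rule compact_supp_bounded[OF f']) blast
  define e :: "real ^ 'n" where "e = axis i 1"
  define h where "h n = inverse (real (Suc n))" for n
  have h: "0 < h n" "h n \<le> 1" for n by (auto simp: h_def field_simps)
  define s where "s n x = (f (x + h n *\<^sub>R e) - f x) / h n" for n x
  have [measurable]: "f \<in> borel_measurable borel" "f' \<in> borel_measurable borel"
    using compact_supp_measurable f f' by auto
  have i: "integrable lborel f" by (rule compact_supp_integrable[OF f])
  have s0: "(\<integral>x. s n x \<partial>lborel) = 0" for n
    unfolding s_def using i lborel_integrable_translate[OF i] lborel_integral_translate[of f "h n *\<^sub>R e"] by simp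
  have "(\<lambda>n. \<integral>x. s n x \<partial>lborel) \<longlonglongrightarrow> (\<integral>x. f' x \<partial>lborel)"
  \<comment> \<open>The increments \<open>h n\<close> are at most 1, so all difference quotients
    vanish off the ball of radius R + 1; the mean value theorem bounds them by B.\<close>
  proof (rule integral_dominated_convergence[where w = "\<lambda>x. B * indicator (cball 0 (R + 1)) x"])
    show "integrable lborel (\<lambda>x::real ^ 'n. B * indicator (cball 0 (R + 1)) x)"
      by (intro integrable_mult_right integrable_real_indicator) (use emeasure_lborel_cball_finite in auto)
    show "AE x in lborel. (\<lambda>n. s n x) \<longlonglongrightarrow> f' x"
    proof (rule AE_I2)
      fix x
      have "((\<lambda>s. f (x + s *\<^sub>R e)) has_real_derivative f' x) (at 0)"
        using pd[of x] by (simp add: has_pd_def has_real_derivative_iff_has_vector_derivative e_def)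
      then have "((\<lambda>t. (f (x + t *\<^sub>R e) - f x) / t) \<longlongrightarrow> f' x) (at 0)"
        by (simp add: DERIV_def)
      moreover have "filterlim h (at 0) sequentially"
        using h LIMSEQ_inverse_real_of_nat by (auto simp: filterlim_at h_def[abs_def])
      ultimately show "(\<lambda>n. s n x) \<longlonglongrightarrow> f' x"
        unfolding s_def by (rule filterlim_compose)
    qed
    show "AE x in lborel. norm (s n x) \<le> B * indicator (cball 0 (R + 1)) x" for n
    proof (rule AE_I2)
      fix x
      have "\<exists>z. 0 < z \<and> z < h n \<and> f (x + h n *\<^sub>R e) - f (x + 0 *\<^sub>R e) = (h n - 0) * f' (x + z *\<^sub>R e)"
        unfolding e_def using h by (intro MVT2 has_pd_has_real_derivative pd) auto
      then obtain z where "f (x + h n *\<^sub>R e) - f x = h n * f' (x + z *\<^sub>R e)" by auto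
      then have "s n x = f' (x + z *\<^sub>R e)" using h(1)[of n] by (simp add: s_def)
      then have "norm (s n x) \<le> B" using B(2) by metis
      moreover have "s n x = 0" if "norm x > R + 1"
      proof -
        have "norm x \<le> norm (x + h n *\<^sub>R e) + norm (h n *\<^sub>R e)" by (metis add_diff_cancel norm_triangle_ineq4)
        also have "norm (h n *\<^sub>R e) \<le> 1" using h[of n] by (simp add: e_def)
        finally have "norm (x + h n *\<^sub>R e) > R" using that by linarith
        then show ?thesis using R that by (simp add: s_def)
      qed
      ultimately show "norm (s n x) \<le> B * indicator (cball 0 (R + 1)) x"
        by (auto simp: indicator_def not_le)
    qed
  qed (auto simp: s_def)
  then show ?thesis by (simp add: s0 LIMSEQ_const_iff)
qed

subsection \<open>The plane as a product\<close>

definition mkv :: "real \<times> real \<Rightarrow> real ^ 2" where "mkv p = vector [fst p, snd p]"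

lemma mkv_nth [simp]: "mkv (a, b) $ 1 = a" "mkv (a, b) $ 2 = b"
  by (simp_all add: mkv_def)

lemma mkv_eq: "mkv p = fst p *\<^sub>R axis 1 1 + snd p *\<^sub>R axis 2 1"
  by (cases p) (simp add: vec_eq_iff forall_2 axis_def)

lemma mkv_measurable [measurable]: "mkv \<in> borel_measurable borel"
  unfolding mkv_eq[abs_def] by (intro borel_measurable_continuous_onI continuous_intros)

lemma Basis_2: "(Basis :: (real ^ 2) set) = {axis 1 1, axis 2 1}"
  by (auto simp: Basis_vec_def UNIV_2)

text \<open>Lebesgue measure is determined by its values on boxes. This carries Tonelli's theorem
  for pairs over to \<open>real ^ 2\<close>.\<close>

lemma lborel_mkv: "distr (lborel :: (real \<times> real) measure) borel mkv = lborel"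
proof (rule lborel_eqI[symmetric])
  fix l u :: "real ^ 2" assume le: "\<And>b. b \<in> Basis \<Longrightarrow> l \<bullet> b \<le> u \<bullet> b"
  have ne: "(axis 1 1 :: real ^ 2) \<noteq> axis 2 1" by (simp add: axis_eq_axis)
  have "mkv -` box l u = box (l $ 1) (u $ 1) \<times> box (l $ 2) (u $ 2)"
    by (auto simp: mem_box Basis_2 inner_axis mkv_def)
  then have "emeasure (distr lborel borel mkv) (box l u) = emeasure (lborel \<Otimes>\<^sub>M lborel) (box (l $ 1) (u $ 1) \<times> box (l $ 2) (u $ 2))"
    by (simp add: emeasure_distr lborel_prod)
  also have "\<dots> = emeasure lborel (box (l $ 1) (u $ 1)) * emeasure lborel (box (l $ 2) (u $ 2))"
    by (intro lborel.emeasure_pair_measure_Times) auto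
  also have "\<dots> = ennreal (\<Prod>b\<in>Basis. (u - l) \<bullet> b)"
    using le[of "axis 1 1"] le[of "axis 2 1"] ne by (simp add: Basis_2 inner_axis ennreal_mult' box_real)
  finally show "emeasure (distr lborel borel mkv) (box l u) = ennreal (\<Prod>b\<in>Basis. (u - l) \<bullet> b)" .
qed simp

lemma nn_integral_real2:
  assumes [measurable]: "f \<in> borel_measurable borel"
  shows "(\<integral>\<^sup>+x. f x \<partial>(lborel :: (real ^ 2) measure)) = (\<integral>\<^sup>+a. \<integral>\<^sup>+b. f (mkv (a, b)) \<partial>lborel \<partial>lborel)"
proof -
  have "(\<integral>\<^sup>+x. f x \<partial>lborel) = (\<integral>\<^sup>+x. f x \<partial>distr lborel borel mkv)" by (simp add: lborel_mkv)
  also have "\<dots> = (\<integral>\<^sup>+p. f (mkv p) \<partial>lborel)" by (rule nn_integral_distr) auto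
  also have "\<dots> = (\<integral>\<^sup>+p. f (mkv p) \<partial>(lborel \<Otimes>\<^sub>M lborel))" by (simp add: lborel_prod)
  also have "\<dots> = (\<integral>\<^sup>+a. \<integral>\<^sup>+b. f (mkv (a, b)) \<partial>lborel \<partial>lborel)"
    by (rule lborel.nn_integral_fst[symmetric]) (simp add: lborel_prod)
  finally show ?thesis .
qed

lemma nn_integral_real2_swap:
  assumes [measurable]: "f \<in> borel_measurable borel"
  shows "(\<integral>\<^sup>+x. f x \<partial>(lborel :: (real ^ 2) measure)) = (\<integral>\<^sup>+b. \<integral>\<^sup>+a. f (mkv (a, b)) \<partial>lborel \<partial>lborel)"
  unfolding nn_integral_real2[OF assms]
proof -
  have [measurable]: "mkv \<in> borel_measurable (borel \<Otimes>\<^sub>M borel)"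
    using mkv_measurable by (simp add: borel_prod)
  have "(\<lambda>(a, b). f (mkv (a, b))) \<in> borel_measurable (lborel \<Otimes>\<^sub>M lborel)" by measurable
  from lborel_pair.Fubini'[OF this] show "(\<integral>\<^sup>+ a. \<integral>\<^sup>+ b. f (mkv (a, b)) \<partial>lborel \<partial>lborel) = (\<integral>\<^sup>+ b. \<integral>\<^sup>+ a. f (mkv (a, b)) \<partial>lborel \<partial>lborel)"
    by simp
qed

subsection \<open>One-dimensional integrals and polar coordinates\<close>

lemma nn_integral_abs_le:
  fixes f :: "real \<Rightarrow> ennreal"
  assumes [measurable]: "f \<in> borel_measurable borel"
  shows "(\<integral>\<^sup>+y. f \<bar>y\<bar> \<partial>lborel) \<le> 2 * (\<integral>\<^sup>+y. indicator {0..} y * f y \<partial>lborel)"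
proof -
  have "(\<integral>\<^sup>+y. f \<bar>y\<bar> \<partial>lborel) \<le> (\<integral>\<^sup>+y. indicator {0..} y * f y + indicator {0..} (- y) * f (- y) \<partial>lborel)"
    by (intro nn_integral_mono) (auto simp: indicator_def abs_if)
  also have "\<dots> = (\<integral>\<^sup>+y. indicator {0..} y * f y \<partial>lborel) + (\<integral>\<^sup>+y. indicator {0..} (- y) * f (- y) \<partial>lborel)"
    by (rule nn_integral_add) auto
  also have "(\<integral>\<^sup>+y. indicator {0..} (- y) * f (- y) \<partial>lborel) = (\<integral>\<^sup>+y. indicator {0..} y * f y \<partial>lborel)"
    using nn_integral_real_affine[of "\<lambda>y. indicator {0..} y * f y" "-1" 0] by simp
  finally show ?thesis by (simp add: mult_2)
qed

text \<open>The model of the angular integral of the kernel: a stands for the relative distance of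
  two radii, and a^(1 - \<sigma>) is the singularity left after the angle is integrated out. The
  factor \<sigma> / (\<sigma> - 1) adds 1 from the part below a to 1 / (\<sigma> - 1) from the tail;
  2 counts both sides of c.\<close>

lemma nn_integral_max_powr_le:
  fixes a \<sigma> :: real
  assumes "a > 0" "\<sigma> > 1"
  shows "(\<integral>\<^sup>+y. ennreal (max a \<bar>y - c\<bar> powr (- \<sigma>)) \<partial>lborel) \<le> ennreal (2 * (\<sigma> / (\<sigma> - 1)) * a powr (1 - \<sigma>))"
proof -
  have 1: "(\<integral>\<^sup>+y. indicator {a..} y * ennreal (y powr (- \<sigma>)) \<partial>lborel) = ennreal (a powr (1 - \<sigma>) / (\<sigma> - 1))"
  proof -
    have "((\<lambda>y. y powr (- \<sigma>)) has_integral a powr (1 - \<sigma>) / (\<sigma> - 1)) {a..}"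
      using has_integral_powr_to_inf[of "- \<sigma>" a] assms by (simp add: minus_divide_right)
    from nn_integral_has_integral_lebesgue[OF _ this]
    have "(\<integral>\<^sup>+y. ennreal (indicator {a..} y * y powr (- \<sigma>)) \<partial>lborel) = ennreal (a powr (1 - \<sigma>) / (\<sigma> - 1))" by simp
    moreover have "indicator {a..} y * ennreal (y powr (- \<sigma>)) = ennreal (indicator {a..} y * y powr (- \<sigma>))" for y
      by (auto simp: indicator_def)
    ultimately show ?thesis by simp
  qed
  have 2: "(\<integral>\<^sup>+y. indicator {0..a} y * ennreal (a powr (- \<sigma>)) \<partial>lborel) = ennreal (a powr (1 - \<sigma>))"
    using assms by (simp add: nn_integral_multc ennreal_mult'[symmetric] powr_diff powr_minus divide_inverse)
  have "(\<integral>\<^sup>+y. ennreal (max a \<bar>y - c\<bar> powr (- \<sigma>)) \<partial>lborel) = (\<integral>\<^sup>+y. ennreal (max a \<bar>y\<bar> powr (- \<sigma>)) \<partial>lborel)"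
    using nn_integral_real_affine[of "\<lambda>y. ennreal (max a \<bar>y - c\<bar> powr (- \<sigma>))" 1 c] by simp
  also have "\<dots> \<le> 2 * (\<integral>\<^sup>+y. indicator {0..} y * ennreal (max a y powr (- \<sigma>)) \<partial>lborel)"
    using nn_integral_abs_le[of "\<lambda>y. ennreal (max a y powr (- \<sigma>))"] by simp
  also have "(\<integral>\<^sup>+y. indicator {0..} y * ennreal (max a y powr (- \<sigma>)) \<partial>lborel)
    \<le> (\<integral>\<^sup>+y. indicator {0..a} y * ennreal (a powr (- \<sigma>)) + indicator {a..} y * ennreal (y powr (- \<sigma>)) \<partial>lborel)"
    by (intro nn_integral_mono) (auto simp: indicator_def max_def)
  also have "\<dots> = ennreal (a powr (1 - \<sigma>)) + ennreal (a powr (1 - \<sigma>) / (\<sigma> - 1))"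
    by (subst nn_integral_add) (auto simp: 1 2)
  also have "\<dots> = ennreal (\<sigma> / (\<sigma> - 1) * a powr (1 - \<sigma>))"
    using assms by (subst ennreal_plus[symmetric]) (auto simp: field_simps)
  also have "2 * \<dots> = ennreal (2 * (\<sigma> / (\<sigma> - 1)) * a powr (1 - \<sigma>))"
    using assms by (simp add: ennreal_mult'[symmetric] ennreal_numeral[symmetric] mult.assoc del: ennreal_numeral)
  finally show ?thesis by (simp add: mult_left_mono)
qed

lemma nn_integral_inverse_1_plus_square_le:
  "(\<integral>\<^sup>+y. ennreal (1 / (1 + y\<^sup>2)) \<partial>lborel) \<le> 4"
proof -
  have "1 / (1 + y\<^sup>2) \<le> max 1 \<bar>y - 0\<bar> powr (- 2)" for y :: real
  proof -
    have "(max 1 \<bar>y\<bar>)\<^sup>2 \<le> 1 + y\<^sup>2" by (auto simp: max_def)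
    moreover have "max 1 \<bar>y\<bar> powr (- 2) = 1 / (max 1 \<bar>y\<bar>)\<^sup>2"
      by (simp add: powr_minus_divide max_def)
    moreover have "1 / (1 + y\<^sup>2) \<le> 1 / (max 1 \<bar>y\<bar>)\<^sup>2"
      by (intro divide_left_mono calculation(1) mult_pos_pos add_pos_nonneg) auto
    ultimately show ?thesis by simp
  qed
  then have "(\<integral>\<^sup>+y. ennreal (1 / (1 + y\<^sup>2)) \<partial>lborel) \<le> (\<integral>\<^sup>+y. ennreal (max 1 \<bar>y - 0\<bar> powr (- 2)) \<partial>lborel)"
    by (intro nn_integral_mono ennreal_leI)
  also have "\<dots> \<le> ennreal (2 * (2 / (2 - 1)) * 1 powr (1 - 2))"
    by (rule nn_integral_max_powr_le) auto
  finally show ?thesis by simp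
qed

text \<open>The substitution \<rho> = exp x on compact intervals, which exhaust the half-line by
  monotone convergence. At \<rho> = 0 the integrand is 0 by division by zero.\<close>

lemma nn_integral_ln_le:
  fixes g :: "real \<Rightarrow> real"
  assumes [measurable]: "g \<in> borel_measurable borel" and nn: "\<And>x. 0 \<le> g x"
  shows "(\<integral>\<^sup>+\<rho>. indicator {0..} \<rho> * ennreal (g (ln \<rho>) / \<rho>) \<partial>lborel) \<le> (\<integral>\<^sup>+x. ennreal (g x) \<partial>lborel)"
proof -
  define A where "A n = {exp (- real n)..exp (real n)}" for n
  define f where "f n \<rho> = indicator (A n) \<rho> * ennreal (g (ln \<rho>) / \<rho>)" for n and \<rho> :: real
  have "incseq f"
  proof (intro incseq_SucI le_funI)
    fix n \<rho>
    have "A n \<subseteq> A (Suc n)" by (auto simp: A_def intro: order_trans[rotated] order_trans)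
    then show "f n \<rho> \<le> f (Suc n) \<rho>" by (auto simp: f_def indicator_def)
  qed
  have [measurable]: "f n \<in> borel_measurable borel" for n
    unfolding f_def A_def by measurable
  have "(\<integral>\<^sup>+\<rho>. indicator {0..} \<rho> * ennreal (g (ln \<rho>) / \<rho>) \<partial>lborel) \<le> (\<integral>\<^sup>+\<rho>. (SUP n. f n \<rho>) \<partial>lborel)"
  proof (intro nn_integral_mono)
    fix \<rho> :: real
    show "indicator {0..} \<rho> * ennreal (g (ln \<rho>) / \<rho>) \<le> (SUP n. f n \<rho>)"
    proof (cases "\<rho> > 0")
      case True
      obtain n where n: "\<bar>ln \<rho>\<bar> \<le> real n" using real_arch_simple by blast
      have "exp (- real n) \<le> exp (ln \<rho>)" "exp (ln \<rho>) \<le> exp (real n)" using n by (auto simp del: exp_ln)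
      then have "\<rho> \<in> A n" using True by (simp add: A_def)
      then have "indicator {0..} \<rho> * ennreal (g (ln \<rho>) / \<rho>) \<le> f n \<rho>" using True by (simp add: f_def)
      also have "\<dots> \<le> (SUP n. f n \<rho>)" by (rule SUP_upper) simp
      finally show ?thesis .
    qed (cases "\<rho> = 0", auto)
  qed
  also have "\<dots> = (SUP n. \<integral>\<^sup>+\<rho>. f n \<rho> \<partial>lborel)"
    by (rule nn_integral_monotone_convergence_SUP[OF \<open>incseq f\<close>]) simp
  also have "\<dots> \<le> (\<integral>\<^sup>+x. ennreal (g x) \<partial>lborel)"
  proof (rule SUP_least)
    fix n
    have "(\<integral>\<^sup>+\<rho>. f n \<rho> \<partial>lborel) = (\<integral>\<^sup>+\<rho>. ennreal (g (ln \<rho>) / \<rho> * indicator {exp (- real n)..exp (real n)} \<rho>) \<partial>lborel)"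
      by (intro nn_integral_cong) (auto simp: f_def A_def indicator_def)
    also have "\<dots> = (\<integral>\<^sup>+x. ennreal (g (ln (exp x)) / exp x * exp x * indicator {- real n..real n} x) \<partial>lborel)"
      by (rule nn_integral_substitution)
        (auto simp: set_borel_measurable_def intro!: derivative_eq_intros continuous_intros)
    also have "\<dots> \<le> (\<integral>\<^sup>+x. ennreal (g x) \<partial>lborel)"
      by (intro nn_integral_mono) (auto simp: indicator_def nn)
    finally show "(\<integral>\<^sup>+\<rho>. f n \<rho> \<partial>lborel) \<le> (\<integral>\<^sup>+x. ennreal (g x) \<partial>lborel)" .
  qed
  finally show ?thesis .
qed

text \<open>The substitutions \<open>y = x v\<close> and \<open>x = \<rho> / sqrt (1 + v\<^sup>2)\<close> give polar coordinates, with the slope \<open>v\<close>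
  as angle and a signed radius \<open>\<rho>\<close>, using affine changes of variables on the line only.\<close>

definition slope_dir :: "real \<Rightarrow> real ^ 2" where
  "slope_dir v = mkv (1 / sqrt (1 + v\<^sup>2), v / sqrt (1 + v\<^sup>2))"

lemma slope_dir_nth: "slope_dir v $ 1 = 1 / sqrt (1 + v\<^sup>2)" "slope_dir v $ 2 = v / sqrt (1 + v\<^sup>2)"
  by (simp_all add: slope_dir_def)

lemma norm_real2: "norm (x :: real ^ 2) = sqrt ((x $ 1)\<^sup>2 + (x $ 2)\<^sup>2)"
  by (simp add: norm_vec_def L2_set_def sum_2)

lemma norm_slope_dir [simp]: "norm (slope_dir v) = 1"
proof -
  have "1 + v\<^sup>2 > 0" by (simp add: add_pos_nonneg)
  then show ?thesis by (simp add: norm_real2 slope_dir_nth power_divide flip: add_divide_distrib)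
qed

lemma slope_dir_measurable [measurable]: "slope_dir \<in> borel_measurable borel"
proof -
  have "1 + v\<^sup>2 > 0" for v :: real by (simp add: add_pos_nonneg)
  then have "sqrt (1 + v\<^sup>2) \<noteq> 0" for v :: real by (metis real_sqrt_gt_zero less_irrefl)
  then show ?thesis unfolding slope_dir_def[abs_def] mkv_eq
    by (intro borel_measurable_continuous_onI) (auto intro!: continuous_intros)
qed

text \<open>The Jacobian comes from two scalings: b = a v contributes |a|, and a = \<rho> / w with w
  = sqrt (1 + v^2) contributes 1 / w and turns |a| into |\<rho>| / w. The vertical line a = 0, which
  has no slope, is a null set.\<close>

lemma nn_integral_slope_polar:
  fixes f :: "real ^ 2 \<Rightarrow> ennreal"
  assumes [measurable]: "f \<in> borel_measurable borel"
  shows "(\<integral>\<^sup>+x. f x \<partial>lborel) = (\<integral>\<^sup>+v. \<integral>\<^sup>+\<rho>. ennreal (\<bar>\<rho>\<bar> / (1 + v\<^sup>2)) * f (\<rho> *\<^sub>R slope_dir v) \<partial>lborel \<partial>lborel)"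
proof -
  have mk: "mkv (a, b) = a *\<^sub>R axis 1 1 + b *\<^sub>R axis 2 1" for a b by (simp add: mkv_eq)
  have [measurable]: "(\<lambda>b. f (mkv (a, b))) \<in> borel_measurable borel" for a
    unfolding mk by measurable
  have [measurable]: "(\<lambda>p. mkv (fst p, fst p * snd p)) \<in> borel_measurable (borel \<Otimes>\<^sub>M borel)"
    unfolding mk by (auto simp: borel_prod intro!: borel_measurable_continuous_onI continuous_intros)
  have [measurable]: "(\<lambda>a. mkv (a, a * v)) \<in> borel_measurable borel" for v
    unfolding mk by (auto intro!: borel_measurable_continuous_onI continuous_intros)
  have "(\<integral>\<^sup>+x. f x \<partial>lborel) = (\<integral>\<^sup>+a. \<integral>\<^sup>+b. f (mkv (a, b)) \<partial>lborel \<partial>lborel)"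
    by (rule nn_integral_real2) simp
  also have "\<dots> = (\<integral>\<^sup>+a. \<integral>\<^sup>+v. ennreal \<bar>a\<bar> * f (mkv (a, a * v)) \<partial>lborel \<partial>lborel)"
  proof (rule nn_integral_cong_AE, rule AE_mp[OF AE_lborel_singleton[of 0]], rule AE_I2, rule impI)
    fix a :: real assume a: "a \<noteq> 0"
    have "(\<integral>\<^sup>+b. f (mkv (a, b)) \<partial>lborel) = ennreal \<bar>a\<bar> * (\<integral>\<^sup>+v. f (mkv (a, a * v)) \<partial>lborel)"
      using nn_integral_real_affine[of "\<lambda>b. f (mkv (a, b))" a 0] a by simp
    also have "\<dots> = (\<integral>\<^sup>+v. ennreal \<bar>a\<bar> * f (mkv (a, a * v)) \<partial>lborel)"
    proof (rule nn_integral_cmult[symmetric])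
      have "(\<lambda>v. mkv (a, a * v)) \<in> borel_measurable borel"
        unfolding mk by (auto intro!: borel_measurable_continuous_onI continuous_intros)
      then show "(\<lambda>v. f (mkv (a, a * v))) \<in> borel_measurable lborel" by measurable
    qed
    finally show "(\<integral>\<^sup>+b. f (mkv (a, b)) \<partial>lborel) = (\<integral>\<^sup>+v. ennreal \<bar>a\<bar> * f (mkv (a, a * v)) \<partial>lborel)" .
  qed
  also have "\<dots> = (\<integral>\<^sup>+v. \<integral>\<^sup>+a. ennreal \<bar>a\<bar> * f (mkv (a, a * v)) \<partial>lborel \<partial>lborel)"
  proof -
    have "(\<lambda>(a, v). ennreal \<bar>a\<bar> * f (mkv (a, a * v))) \<in> borel_measurable (lborel \<Otimes>\<^sub>M lborel)"
      unfolding split_beta' by measurable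
    from lborel_pair.Fubini'[OF this] show ?thesis by simp
  qed
  also have "\<dots> = (\<integral>\<^sup>+v. \<integral>\<^sup>+\<rho>. ennreal (\<bar>\<rho>\<bar> / (1 + v\<^sup>2)) * f (\<rho> *\<^sub>R slope_dir v) \<partial>lborel \<partial>lborel)"
  proof (rule nn_integral_cong)
    fix v :: real
    define w where "w = sqrt (1 + v\<^sup>2)"
    have w: "w > 0" "w * w = 1 + v\<^sup>2" unfolding w_def by (auto simp: add_pos_nonneg)
    have eq: "mkv (\<rho> / w, \<rho> * v / w) = \<rho> *\<^sub>R slope_dir v" for \<rho>
      by (simp add: vec_eq_iff forall_2 slope_dir_nth w_def)
    have "(\<integral>\<^sup>+a. ennreal \<bar>a\<bar> * f (mkv (a, a * v)) \<partial>lborel)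
      = ennreal \<bar>1 / w\<bar> * (\<integral>\<^sup>+\<rho>. ennreal \<bar>\<rho> / w\<bar> * f (\<rho> *\<^sub>R slope_dir v) \<partial>lborel)"
      using nn_integral_real_affine[of "\<lambda>a. ennreal \<bar>a\<bar> * f (mkv (a, a * v))" "1 / w" 0] w by (simp add: eq)
    also have "\<dots> = (\<integral>\<^sup>+\<rho>. ennreal \<bar>1 / w\<bar> * (ennreal \<bar>\<rho> / w\<bar> * f (\<rho> *\<^sub>R slope_dir v)) \<partial>lborel)"
      by (rule nn_integral_cmult[symmetric]) measurable
    also have "\<dots> = (\<integral>\<^sup>+\<rho>. ennreal (\<bar>\<rho>\<bar> / (1 + v\<^sup>2)) * f (\<rho> *\<^sub>R slope_dir v) \<partial>lborel)"
    proof (rule nn_integral_cong)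
      fix \<rho>
      have "\<bar>1 / w\<bar> * \<bar>\<rho> / w\<bar> = \<bar>\<rho>\<bar> / (1 + v\<^sup>2)" using w by (simp add: abs_mult flip: w(2))
      then show "ennreal \<bar>1 / w\<bar> * (ennreal \<bar>\<rho> / w\<bar> * f (\<rho> *\<^sub>R slope_dir v)) = ennreal (\<bar>\<rho>\<bar> / (1 + v\<^sup>2)) * f (\<rho> *\<^sub>R slope_dir v)"
        by (metis mult.assoc ennreal_mult abs_ge_zero)
    qed
    finally show "(\<integral>\<^sup>+a. ennreal \<bar>a\<bar> * f (mkv (a, a * v)) \<partial>lborel)
      = (\<integral>\<^sup>+\<rho>. ennreal (\<bar>\<rho>\<bar> / (1 + v\<^sup>2)) * f (\<rho> *\<^sub>R slope_dir v) \<partial>lborel)" .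
  qed
  finally show ?thesis .
qed

subsection \<open>The kernel\<close>

text \<open>The factor \<open>1 / (1 + sqrt \<tau> |ln |z| - ln |\<zeta>||)\<close> is all that is kept of the Gaussian decay of the Carleman weight.
  On the diagonal \<open>kern\<close> is \<open>0\<close>, by division by zero; this is harmless, as \<open>1 / norm (z - \<zeta>)\<close> has the same value there.\<close>

definition kern :: "real \<Rightarrow> real ^ 2 \<Rightarrow> real ^ 2 \<Rightarrow> real" where
  "kern \<tau> z \<zeta> = max (norm z) (norm \<zeta>) / ((1 + sqrt \<tau> * \<bar>ln (norm z) - ln (norm \<zeta>)\<bar>) * norm (z - \<zeta>))"

text \<open>Lagrange's identity: the squares of the cross and dot products add up to the product of
  the squared norms.\<close>

lemma cross_le:
  fixes a b :: "real ^ 2"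
  shows "\<bar>a $ 1 * b $ 2 - a $ 2 * b $ 1\<bar> \<le> norm a * norm b"
proof -
  have "(a $ 1 * b $ 2 - a $ 2 * b $ 1)\<^sup>2 + (a $ 1 * b $ 1 + a $ 2 * b $ 2)\<^sup>2
      = ((a $ 1)\<^sup>2 + (a $ 2)\<^sup>2) * ((b $ 1)\<^sup>2 + (b $ 2)\<^sup>2)"
    by (simp add: power2_eq_square algebra_simps)
  then have "(a $ 1 * b $ 2 - a $ 2 * b $ 1)\<^sup>2 \<le> (norm a * norm b)\<^sup>2"
    by (simp add: norm_real2 power_mult_distrib) (metis le_add_same_cancel1 zero_le_power2)
  then show ?thesis by (simp add: abs_le_square_iff[symmetric])
qed

text \<open>Both the distance from \<open>z\<close> to the line through \<open>\<rho> \<omega>\<close> and that from \<open>\<rho> \<omega>\<close> to the line through \<open>z\<close> bound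
  \<open>norm (z - \<rho> \<omega>)\<close> from below; the larger of the two carries the factor \<open>max (norm z) \<bar>\<rho>\<bar>\<close>.\<close>

lemma dist_slope_dir_ge:
  assumes "z \<noteq> 0"
  shows "max (norm z) \<bar>\<rho>\<bar> * \<bar>z $ 1 * v - z $ 2\<bar> \<le> norm (z - \<rho> *\<^sub>R slope_dir v) * (norm z * sqrt (1 + v\<^sup>2))"
proof -
  define w where "w = sqrt (1 + v\<^sup>2)"
  define N where "N = norm (z - \<rho> *\<^sub>R slope_dir v)"
  define c where "c = z $ 1 * v - z $ 2"
  have w: "w > 0" unfolding w_def by (simp add: add_pos_nonneg)
  have 1: "\<bar>c\<bar> \<le> N * w"
  proof -
    have "\<bar>(z $ 1 - \<rho> * (1 / w)) * (v / w) - (z $ 2 - \<rho> * (v / w)) * (1 / w)\<bar> \<le> N"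
      using cross_le[of "z - \<rho> *\<^sub>R slope_dir v" "slope_dir v"] by (simp add: slope_dir_nth N_def w_def)
    moreover have "(z $ 1 - \<rho> * (1 / w)) * (v / w) - (z $ 2 - \<rho> * (v / w)) * (1 / w) = c / w"
      by (simp add: c_def algebra_simps diff_divide_distrib)
    ultimately show ?thesis using w by (simp add: pos_divide_le_eq)
  qed
  have "\<bar>z $ 1 * (z $ 2 - \<rho> * (v / w)) - z $ 2 * (z $ 1 - \<rho> * (1 / w))\<bar> \<le> norm z * N"
    using cross_le[of z "z - \<rho> *\<^sub>R slope_dir v"] by (simp add: slope_dir_nth N_def w_def)
  moreover have "z $ 1 * (z $ 2 - \<rho> * (v / w)) - z $ 2 * (z $ 1 - \<rho> * (1 / w)) = - (\<rho> * c / w)"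
    by (simp add: c_def algebra_simps diff_divide_distrib)
  ultimately have 2: "\<bar>\<rho>\<bar> * \<bar>c\<bar> \<le> norm z * N * w"
    using w by (simp add: abs_mult pos_divide_le_eq)
  show ?thesis
    unfolding N_def[symmetric] w_def[symmetric] c_def[symmetric]
    using 2 mult_left_mono[OF 1, of "norm z"] by (simp add: max_def mult_ac)
qed

text \<open>The condition on z keeps its slope v0 in [-1, 1]. For |v| <= 2 the distance is at least
  a fixed multiple of the larger radius times both a and |v - v0|. For |v| > 2 the directions are
  well separated, the quotient is at most 4, and 1 / (1 + v^2) is left to be integrated.\<close>

lemma angular_bound:
  fixes z :: "real ^ 2"
  assumes z: "\<bar>z $ 2\<bar> \<le> \<bar>z $ 1\<bar>" "z \<noteq> 0" and \<rho>: "\<rho> \<noteq> 0" "\<bar>\<rho>\<bar> \<noteq> norm z" and \<sigma>: "0 < \<sigma>" "\<sigma> < 2"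
  defines "a \<equiv> 1 - exp (- \<bar>ln (norm z) - ln \<bar>\<rho>\<bar>\<bar>)"
  shows "(max (norm z) \<bar>\<rho>\<bar> / norm (z - \<rho> *\<^sub>R slope_dir v)) powr \<sigma> / (1 + v\<^sup>2)
    \<le> 16 * (1 / (1 + v\<^sup>2) + max a \<bar>v - z $ 2 / z $ 1\<bar> powr (- \<sigma>))"
proof -
  define M where "M = max (norm z) \<bar>\<rho>\<bar>"
  define N where "N = norm (z - \<rho> *\<^sub>R slope_dir v)"
  define w where "w = sqrt (1 + v\<^sup>2)"
  define v0 where "v0 = z $ 2 / z $ 1"
  have w: "w > 0" "w\<^sup>2 = 1 + v\<^sup>2" unfolding w_def by (auto simp: add_pos_nonneg)
  have z1: "z $ 1 \<noteq> 0" using z by (auto simp: vec_eq_iff forall_2)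
  have Z: "norm z > 0" using z by simp
  have M: "M > 0" using Z by (simp add: M_def less_max_iff_disj)
  have Z2: "(norm z)\<^sup>2 \<le> 2 * (z $ 1)\<^sup>2" using z(1) by (simp add: norm_real2 abs_le_square_iff)
  have v0: "\<bar>v0\<bar> \<le> 1" using z(1) z1 by (simp add: v0_def)
  have "ln (norm z) \<noteq> ln \<bar>\<rho>\<bar>" using \<rho> Z by simp
  then have a: "a > 0" "a \<le> 1" by (auto simp: a_def)
  \<comment> \<open>The exponential is the smaller radius over the larger one, so M a is the
    difference of the two radii.\<close>
  have e: "exp (- \<bar>ln (norm z) - ln \<bar>\<rho>\<bar>\<bar>) = min (norm z) \<bar>\<rho>\<bar> / M"
    using Z \<rho> by (cases "norm z \<le> \<bar>\<rho>\<bar>") (auto simp: M_def min_def max_def abs_if exp_diff)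
  have "M * a = M - min (norm z) \<bar>\<rho>\<bar>" using M by (simp add: a_def e field_simps)
  also have "\<dots> = \<bar>norm z - norm (\<rho> *\<^sub>R slope_dir v)\<bar>" by (auto simp: M_def)
  also have "\<dots> \<le> N" unfolding N_def by (rule norm_triangle_ineq3)
  finally have Na: "M * a \<le> N" .
  then have N: "N > 0" using M a(1) by (smt (verit) mult_pos_pos)
  have D: "M * \<bar>z $ 1 * v - z $ 2\<bar> \<le> N * (norm z * w)"
    unfolding M_def N_def w_def by (rule dist_slope_dir_ge) fact
  have c: "z $ 1 * v - z $ 2 = z $ 1 * (v - v0)" using z1 by (simp add: v0_def field_simps)
  have pos: "1 + v\<^sup>2 > 0" by (simp add: add_pos_nonneg)
  have p16: "4 powr \<sigma> \<le> (16 :: real)" using powr_mono[of \<sigma> 2 4] \<sigma> by simp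
  show ?thesis
  proof (cases "\<bar>v\<bar> \<le> 2")
    case True
    then have "v\<^sup>2 \<le> 4" using abs_le_square_iff[of v 2] by simp
    then have "(norm z * w)\<^sup>2 \<le> (2 * (z $ 1)\<^sup>2) * 5"
      using Z2 w(2) unfolding power_mult_distrib by (intro mult_mono) auto
    also have "\<dots> \<le> (4 * z $ 1)\<^sup>2" by (simp add: power_mult_distrib)
    finally have "norm z * w \<le> \<bar>4 * z $ 1\<bar>" using Z w by (metis abs_le_square_iff abs_of_nonneg less_imp_le mult_nonneg_nonneg)
    then have "N * (norm z * w) \<le> N * (4 * \<bar>z $ 1\<bar>)" using N by simp
    with D c have "\<bar>z $ 1\<bar> * (M * \<bar>v - v0\<bar>) \<le> \<bar>z $ 1\<bar> * (4 * N)" by (simp add: abs_mult mult_ac)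
    then have "M * \<bar>v - v0\<bar> \<le> 4 * N" using z1 by simp
    then have "M * max a \<bar>v - v0\<bar> \<le> 4 * N" using Na N by (auto simp: max_def)
    then have "M / N \<le> 4 / max a \<bar>v - v0\<bar>" using a N by (simp add: field_simps)
    then have "(M / N) powr \<sigma> \<le> (4 / max a \<bar>v - v0\<bar>) powr \<sigma>" using M N \<sigma> by (intro powr_mono2) auto
    also have "\<dots> = 4 powr \<sigma> * max a \<bar>v - v0\<bar> powr (- \<sigma>)"
      using a by (simp add: powr_divide le_max_iff_disj powr_minus field_simps)
    also have "\<dots> \<le> 16 * max a \<bar>v - v0\<bar> powr (- \<sigma>)" using p16 by (intro mult_right_mono) auto
    finally have *: "(M / N) powr \<sigma> \<le> 16 * max a \<bar>v - v0\<bar> powr (- \<sigma>)" .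
    have "(M / N) powr \<sigma> / (1 + v\<^sup>2) \<le> (M / N) powr \<sigma> / 1" by (intro divide_left_mono) (use pos in auto)
    also have "\<dots> \<le> 16 * (1 / (1 + v\<^sup>2) + max a \<bar>v - v0\<bar> powr (- \<sigma>))"
      using * pos by (simp add: distrib_left add_increasing)
    finally show ?thesis by (simp add: M_def N_def v0_def)
  next
    case False
    then have v: "2 \<le> \<bar>v\<bar>" by simp
    have "\<bar>v\<bar> / 2 \<le> \<bar>v - v0\<bar>" using v v0 by linarith
    then have 1: "v\<^sup>2 / 4 \<le> (v - v0)\<^sup>2" using abs_le_square_iff[of "v / 2" "v - v0"] by (simp add: power_divide)
    have v4: "v\<^sup>2 \<ge> 4" using v abs_le_square_iff[of 2 v] by simp
    have "(norm z * w)\<^sup>2 \<le> (2 * (z $ 1)\<^sup>2) * (2 * v\<^sup>2)"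
      using Z2 w(2) v4 unfolding power_mult_distrib by (intro mult_mono) auto
    also have "\<dots> = 16 * (z $ 1)\<^sup>2 * (v\<^sup>2 / 4)" by simp
    also have "\<dots> \<le> 16 * (z $ 1)\<^sup>2 * (v - v0)\<^sup>2" using 1 by (intro mult_left_mono) auto
    also have "\<dots> = (4 * (z $ 1 * (v - v0)))\<^sup>2" by (simp add: power_mult_distrib)
    finally have "norm z * w \<le> \<bar>4 * (z $ 1 * (v - v0))\<bar>" using Z w by (metis abs_le_square_iff abs_of_nonneg less_imp_le mult_nonneg_nonneg)
    then have "M * (norm z * w) \<le> M * (4 * \<bar>z $ 1 * (v - v0)\<bar>)" using M by (simp add: abs_mult)
    also have "\<dots> \<le> 4 * (N * (norm z * w))" using D c by simp
    finally have "(norm z * w) * M \<le> (norm z * w) * (4 * N)" by (simp add: mult_ac)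
    then have "M \<le> 4 * N" using Z w by simp
    then have "M / N \<le> 4" using N by (simp add: field_simps)
    then have "(M / N) powr \<sigma> \<le> 4 powr \<sigma>" using M N \<sigma> by (intro powr_mono2) auto
    then have "(M / N) powr \<sigma> / (1 + v\<^sup>2) \<le> 16 / (1 + v\<^sup>2)" using p16 pos by (intro divide_right_mono) auto
    then show ?thesis by (simp add: M_def N_def v0_def distrib_left add_increasing2)
  qed
qed

text \<open>Brings the \<tau>-dependence into scaling form, that is, a power of \<tau> times a
  function of sqrt \<tau> x. It rests on 1 - exp (- y) >= y / (1 + y) >= min y 1 / 2.\<close>

lemma radial_kernel_bound:
  assumes \<sigma>: "1 < \<sigma>" "\<sigma> < 2" and x: "x \<noteq> (0::real)" and \<tau>: "\<tau> \<ge> 1"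
  shows "(1 + sqrt \<tau> * \<bar>x\<bar>) powr (- \<sigma>) * (1 - exp (- \<bar>x\<bar>)) powr (1 - \<sigma>)
    \<le> 2 * \<tau> powr ((\<sigma> - 1) / 2) * ((1 + \<bar>sqrt \<tau> * x\<bar>) powr (- \<sigma>) * (\<bar>sqrt \<tau> * x\<bar> powr (1 - \<sigma>) + 1))"
proof -
  define y where "y = \<bar>x\<bar>"
  have y: "y > 0" using x by (simp add: y_def)
  have "1 + y \<le> exp y" by (rule exp_ge_add_one_self)
  then have "exp (- y) \<le> 1 / (1 + y)" using y by (simp add: exp_minus field_simps)
  then have a: "y / (1 + y) \<le> 1 - exp (- y)" using y by (simp add: field_simps)
  have "(1 - exp (- y)) powr (1 - \<sigma>) \<le> (y / (1 + y)) powr (1 - \<sigma>)"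
    using a y \<sigma> by (intro powr_mono2') auto
  also have "\<dots> \<le> (min y 1 / 2) powr (1 - \<sigma>)"
    using y \<sigma> by (intro powr_mono2') (auto simp: min_def field_simps)
  also have "\<dots> = 2 powr (\<sigma> - 1) * min y 1 powr (1 - \<sigma>)"
    using y by (simp add: powr_divide powr_diff)
  also have "\<dots> \<le> 2 * (y powr (1 - \<sigma>) + 1)"
  proof (intro mult_mono)
    show "2 powr (\<sigma> - 1) \<le> (2::real)" using powr_mono[of "\<sigma> - 1" 1 2] \<sigma> by simp
    show "min y 1 powr (1 - \<sigma>) \<le> y powr (1 - \<sigma>) + 1" by (auto simp: min_def)
  qed auto
  also have "y powr (1 - \<sigma>) + 1 \<le> \<tau> powr ((\<sigma> - 1) / 2) * ((sqrt \<tau> * y) powr (1 - \<sigma>) + 1)"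
  proof -
    have "\<tau> powr ((\<sigma> - 1) / 2) * (sqrt \<tau> * y) powr (1 - \<sigma>) = y powr (1 - \<sigma>)"
    proof -
      have "sqrt \<tau> powr (1 - \<sigma>) = (\<tau> powr (1 / 2)) powr (1 - \<sigma>)" using \<tau> by (simp only: powr_half_sqrt)
      also have "\<dots> = \<tau> powr (1 / 2 * (1 - \<sigma>))" by (rule powr_powr)
      finally have "\<tau> powr ((\<sigma> - 1) / 2) * sqrt \<tau> powr (1 - \<sigma>) = \<tau> powr ((\<sigma> - 1) / 2 + 1 / 2 * (1 - \<sigma>))"
        by (simp only: powr_add)
      also have "(\<sigma> - 1) / 2 + 1 / 2 * (1 - \<sigma>) = 0" by (simp add: field_simps)
      finally have "\<tau> powr ((\<sigma> - 1) / 2) * sqrt \<tau> powr (1 - \<sigma>) = 1" using \<tau> by simp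
      moreover have "(sqrt \<tau> * y) powr (1 - \<sigma>) = sqrt \<tau> powr (1 - \<sigma>) * y powr (1 - \<sigma>)"
        using y \<tau> by (intro powr_mult)
      ultimately show ?thesis by (simp add: mult.assoc[symmetric])
    qed
    moreover have "1 \<le> \<tau> powr ((\<sigma> - 1) / 2)" using \<tau> \<sigma> by (intro ge_one_powr_ge_zero) auto
    ultimately show ?thesis by (simp add: distrib_left)
  qed
  finally have "(1 - exp (- y)) powr (1 - \<sigma>) \<le> 2 * (\<tau> powr ((\<sigma> - 1) / 2) * ((sqrt \<tau> * y) powr (1 - \<sigma>) + 1))" by simp
  from mult_left_mono[OF this, of "(1 + sqrt \<tau> * y) powr (- \<sigma>)"]
  show ?thesis using \<tau> by (simp add: y_def abs_mult mult_ac)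
qed

text \<open>At 0 the power y^(1 - \<sigma>) is integrable because \<sigma> < 2, at infinity y^(-
  \<sigma>) because \<sigma> > 1.\<close>

lemma nn_integral_model_kernel_finite:
  fixes \<sigma> :: real
  assumes \<sigma>: "1 < \<sigma>" "\<sigma> < 2"
  shows "(\<integral>\<^sup>+y. ennreal ((1 + \<bar>y\<bar>) powr (- \<sigma>) * (\<bar>y\<bar> powr (1 - \<sigma>) + 1)) \<partial>lborel) < \<infinity>"
proof -
  have 1: "(\<integral>\<^sup>+y. ennreal (indicator {0..1} y * y powr (1 - \<sigma>)) \<partial>lborel) < \<infinity>"
    using nn_integral_has_integral_lebesgue[OF _ has_integral_powr_from_0[of "1 - \<sigma>" 1]] \<sigma> by simp
  have 2: "(\<integral>\<^sup>+y. ennreal (2 * max 1 \<bar>y - 0\<bar> powr (- \<sigma>)) \<partial>lborel) < \<infinity>"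
    using nn_integral_max_powr_le[of 1 \<sigma> 0] \<sigma>
    by (simp add: ennreal_mult' nn_integral_cmult ennreal_mult_less_top order.strict_trans1)
  have "(\<integral>\<^sup>+y. ennreal ((1 + \<bar>y\<bar>) powr (- \<sigma>) * (\<bar>y\<bar> powr (1 - \<sigma>) + 1)) \<partial>lborel)
    \<le> 2 * (\<integral>\<^sup>+y. indicator {0..} y * ennreal ((1 + y) powr (- \<sigma>) * (y powr (1 - \<sigma>) + 1)) \<partial>lborel)"
    by (rule nn_integral_abs_le) simp
  moreover have "(\<integral>\<^sup>+y. indicator {0..} y * ennreal ((1 + y) powr (- \<sigma>) * (y powr (1 - \<sigma>) + 1)) \<partial>lborel) < \<infinity>"
  proof -
    have "(\<integral>\<^sup>+y. indicator {0..} y * ennreal ((1 + y) powr (- \<sigma>) * (y powr (1 - \<sigma>) + 1)) \<partial>lborel)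
    \<le> (\<integral>\<^sup>+y. ennreal (indicator {0..1} y * y powr (1 - \<sigma>)) + ennreal (2 * max 1 \<bar>y - 0\<bar> powr (- \<sigma>)) \<partial>lborel)"
  proof (intro nn_integral_mono)
    fix y :: real
    have "(1 + y) powr (- \<sigma>) * (y powr (1 - \<sigma>) + 1) \<le> indicator {0..1} y * y powr (1 - \<sigma>) + 2 * max 1 \<bar>y - 0\<bar> powr (- \<sigma>)"
      if "y \<ge> 0"
    proof (cases "y \<le> 1")
      case True
      have "(1 + y) powr (- \<sigma>) * (y powr (1 - \<sigma>) + 1) \<le> 1 * (y powr (1 - \<sigma>) + 1)"
        using that \<sigma> by (intro mult_right_mono) (auto simp: powr_minus inverse_le_1_iff ge_one_powr_ge_zero)
      then show ?thesis using True that by simp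
    next
      case False
      have "(1 + y) powr (- \<sigma>) * (y powr (1 - \<sigma>) + 1) \<le> y powr (- \<sigma>) * (1 + 1)"
        using False \<sigma> powr_mono[of "1 - \<sigma>" 0 y] by (intro mult_mono add_right_mono powr_mono2') auto
      then show ?thesis using False that by simp
    qed
    then show "indicator {0..} y * ennreal ((1 + y) powr (- \<sigma>) * (y powr (1 - \<sigma>) + 1))
      \<le> ennreal (indicator {0..1} y * y powr (1 - \<sigma>)) + ennreal (2 * max 1 \<bar>y - 0\<bar> powr (- \<sigma>))"
      by (cases "y \<ge> 0") (auto simp: ennreal_plus[symmetric] simp del: ennreal_plus intro!: ennreal_leI)
  qed
  also have "\<dots> = (\<integral>\<^sup>+y. ennreal (indicator {0..1} y * y powr (1 - \<sigma>)) \<partial>lborel) + (\<integral>\<^sup>+y. ennreal (2 * max 1 \<bar>y - 0\<bar> powr (- \<sigma>)) \<partial>lborel)"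
    by (rule nn_integral_add) auto
  also have "\<dots> < \<infinity>" using 1 2 by simp
  finally show ?thesis .
  qed
  ultimately show ?thesis by (simp add: ennreal_mult_less_top order.strict_trans1)
qed

text \<open>The exponent is (\<sigma> - 1) / 2 from \<open>radial_kernel_bound\<close> plus - 1 / 2
  from rescaling x by sqrt \<tau>.\<close>

lemma radial_kernel_integral:
  fixes \<sigma> :: real
  assumes \<sigma>: "1 < \<sigma>" "\<sigma> < 2"
  shows "\<exists>C>0. \<forall>\<tau>\<ge>1. (\<integral>\<^sup>+x. ennreal ((1 + sqrt \<tau> * \<bar>x\<bar>) powr (- \<sigma>) * (1 - exp (- \<bar>x\<bar>)) powr (1 - \<sigma>)) \<partial>lborel)
    \<le> ennreal (C * \<tau> powr (- (2 - \<sigma>) / 2))"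
proof -
  define G where "G y = (1 + \<bar>y\<bar>) powr (- \<sigma>) * (\<bar>y\<bar> powr (1 - \<sigma>) + 1)" for y :: real
  have [measurable]: "G \<in> borel_measurable borel" unfolding G_def by measurable
  obtain I where I: "(\<integral>\<^sup>+y. ennreal (G y) \<partial>lborel) = ennreal I" "0 \<le> I"
    using nn_integral_model_kernel_finite[OF \<sigma>] unfolding G_def by (cases "\<integral>\<^sup>+y. ennreal ((1 + \<bar>y\<bar>) powr (- \<sigma>) * (\<bar>y\<bar> powr (1 - \<sigma>) + 1)) \<partial>lborel") auto
  show ?thesis
  \<comment> \<open>The summand 1 only serves to make the constant positive.\<close>
  proof (intro exI[of _ "2 * I + 1"] conjI allI impI)
    show "2 * I + 1 > 0" using I by simp
    fix \<tau> :: real assume \<tau>: "\<tau> \<ge> 1"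
    have "(\<integral>\<^sup>+x. ennreal ((1 + sqrt \<tau> * \<bar>x\<bar>) powr (- \<sigma>) * (1 - exp (- \<bar>x\<bar>)) powr (1 - \<sigma>)) \<partial>lborel)
      \<le> (\<integral>\<^sup>+x. ennreal (2 * \<tau> powr ((\<sigma> - 1) / 2)) * ennreal (G (0 + sqrt \<tau> * x)) \<partial>lborel)"
    proof (intro nn_integral_mono_AE, rule AE_mp[OF AE_lborel_singleton[of 0]], rule AE_I2, rule impI)
      fix x :: real assume "x \<noteq> 0"
      from radial_kernel_bound[OF \<sigma> this \<tau>]
      show "ennreal ((1 + sqrt \<tau> * \<bar>x\<bar>) powr (- \<sigma>) * (1 - exp (- \<bar>x\<bar>)) powr (1 - \<sigma>))
        \<le> ennreal (2 * \<tau> powr ((\<sigma> - 1) / 2)) * ennreal (G (0 + sqrt \<tau> * x))"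
        by (subst ennreal_mult'[symmetric]) (auto simp: G_def intro!: ennreal_leI)
    qed
    also have "\<dots> = ennreal (2 * \<tau> powr ((\<sigma> - 1) / 2)) * (\<integral>\<^sup>+x. ennreal (G (0 + sqrt \<tau> * x)) \<partial>lborel)"
      by (rule nn_integral_cmult) measurable
    also have "(\<integral>\<^sup>+x. ennreal (G (0 + sqrt \<tau> * x)) \<partial>lborel) = ennreal (\<tau> powr (- 1 / 2) * I)"
    proof -
      have "ennreal I = ennreal (sqrt \<tau>) * (\<integral>\<^sup>+x. ennreal (G (0 + sqrt \<tau> * x)) \<partial>lborel)"
        using nn_integral_real_affine[of "\<lambda>y. ennreal (G y)" "sqrt \<tau>" 0] \<tau> I(1) by simp
      then have "ennreal (1 / sqrt \<tau>) * ennreal I = ennreal (1 / sqrt \<tau>) * ennreal (sqrt \<tau>) * (\<integral>\<^sup>+x. ennreal (G (0 + sqrt \<tau> * x)) \<partial>lborel)"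
        by (simp add: mult.assoc)
      moreover have "ennreal (1 / sqrt \<tau>) * ennreal (sqrt \<tau>) = 1"
        using \<tau> by (subst ennreal_mult[symmetric]) auto
      moreover have "\<tau> powr (- 1 / 2) = 1 / sqrt \<tau>"
        using \<tau> by (simp add: powr_minus_divide powr_half_sqrt)
      ultimately have "(\<integral>\<^sup>+x. ennreal (G (0 + sqrt \<tau> * x)) \<partial>lborel) = ennreal (\<tau> powr (- 1 / 2)) * ennreal I" by simp
      then show ?thesis using I(2) by (simp add: ennreal_mult)
    qed
    also have "ennreal (2 * \<tau> powr ((\<sigma> - 1) / 2)) * ennreal (\<tau> powr (- 1 / 2) * I) = ennreal (2 * I * \<tau> powr (- (2 - \<sigma>) / 2))"
    proof -
      have "\<tau> powr ((\<sigma> - 1) / 2) * \<tau> powr (- 1 / 2) = \<tau> powr (- (2 - \<sigma>) / 2)"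
        unfolding powr_add[symmetric] by (rule arg_cong[where f = "(powr) \<tau>"]) (simp add: field_simps)
      then show ?thesis by (subst ennreal_mult[symmetric]) (auto simp: I(2) mult_ac)
    qed
    also have "\<dots> \<le> ennreal ((2 * I + 1) * \<tau> powr (- (2 - \<sigma>) / 2))"
      by (intro ennreal_leI mult_right_mono) auto
    finally show "(\<integral>\<^sup>+x. ennreal ((1 + sqrt \<tau> * \<bar>x\<bar>) powr (- \<sigma>) * (1 - exp (- \<bar>x\<bar>)) powr (1 - \<sigma>)) \<partial>lborel)
    \<le> ennreal ((2 * I + 1) * \<tau> powr (- (2 - \<sigma>) / 2))" .
  qed
qed

section \<open>The integral bound for powers of the kernel\<close>

lemma kern_measurable [measurable]:
  assumes [measurable]: "f \<in> borel_measurable M" "g \<in> borel_measurable M"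
  shows "(\<lambda>x. kern \<tau> (f x) (g x)) \<in> borel_measurable M"
  unfolding kern_def by measurable

lemma kern_commute: "kern \<tau> z \<zeta> = kern \<tau> \<zeta> z"
  by (simp add: kern_def max.commute norm_minus_commute abs_minus_commute)

lemma kern_nonneg: "0 \<le> \<tau> \<Longrightarrow> 0 \<le> kern \<tau> z \<zeta>"
  by (auto simp: kern_def le_max_iff_disj intro!: divide_nonneg_nonneg mult_nonneg_nonneg add_nonneg_nonneg)

text \<open>In slope coordinates the measure |\<zeta>|^-2 d\<zeta> is (d\<rho> / |\<rho>|) (dv / (1
  + v^2)). The logarithmic factor of \<open>kern\<close> depends on \<rho> alone, so the v-integral
  is bounded by \<open>angular_bound\<close>, and what remains is an integral in ln |\<rho>|, where
  the position of z drops out by translation.\<close>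

lemma kernel_schur_aux:
  fixes \<sigma> :: real and z :: "real ^ 2"
  assumes \<sigma>: "1 < \<sigma>" "\<sigma> < 2" and \<tau>: "\<tau> \<ge> 1" and z: "z \<noteq> 0" "\<bar>z $ 2\<bar> \<le> \<bar>z $ 1\<bar>"
  shows "(\<integral>\<^sup>+\<zeta>. ennreal (kern \<tau> z \<zeta> powr \<sigma> * norm \<zeta> powr (-2)) \<partial>lborel)
    \<le> ennreal (32 * (4 + 2 * (\<sigma> / (\<sigma> - 1)))) *
      (\<integral>\<^sup>+x. ennreal ((1 + sqrt \<tau> * \<bar>x\<bar>) powr (- \<sigma>) * (1 - exp (- \<bar>x\<bar>)) powr (1 - \<sigma>)) \<partial>lborel)"
proof -
  define Z where "Z = norm z"
  define v0 where "v0 = z $ 2 / z $ 1"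
  define a where "a \<rho> = 1 - exp (- \<bar>ln Z - ln \<bar>\<rho>\<bar>\<bar>)" for \<rho> :: real
  define k where "k \<rho> = (1 + sqrt \<tau> * \<bar>ln Z - ln \<bar>\<rho>\<bar>\<bar>) powr (- \<sigma>)" for \<rho> :: real
  define h where "h x = (1 + sqrt \<tau> * \<bar>x\<bar>) powr (- \<sigma>) * (1 - exp (- \<bar>x\<bar>)) powr (1 - \<sigma>)" for x :: real
  define C where "C = 4 + 2 * (\<sigma> / (\<sigma> - 1))"
  have C: "C > 0" using \<sigma> by (simp add: C_def add_pos_pos)
  have [measurable]: "h \<in> borel_measurable borel" unfolding h_def by measurable
  have Z: "Z > 0" using z by (simp add: Z_def)
  define F where "F \<zeta> = ennreal (kern \<tau> z \<zeta> powr \<sigma> * norm \<zeta> powr (-2))" for \<zeta>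
  have [measurable]: "F \<in> borel_measurable borel" unfolding F_def by measurable
  have [measurable]: "(\<lambda>x. F (snd x *\<^sub>R slope_dir (fst x))) \<in> borel_measurable (borel \<Otimes>\<^sub>M borel)"
    by measurable
  have "(\<integral>\<^sup>+\<zeta>. F \<zeta> \<partial>lborel) = (\<integral>\<^sup>+v. \<integral>\<^sup>+\<rho>. ennreal (\<bar>\<rho>\<bar> / (1 + v\<^sup>2)) * F (\<rho> *\<^sub>R slope_dir v) \<partial>lborel \<partial>lborel)"
    by (rule nn_integral_slope_polar) simp
  also have "\<dots> = (\<integral>\<^sup>+\<rho>. \<integral>\<^sup>+v. ennreal (\<bar>\<rho>\<bar> / (1 + v\<^sup>2)) * F (\<rho> *\<^sub>R slope_dir v) \<partial>lborel \<partial>lborel)"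
  proof -
    have "(\<lambda>(v, \<rho>). ennreal (\<bar>\<rho>\<bar> / (1 + v\<^sup>2)) * F (\<rho> *\<^sub>R slope_dir v)) \<in> borel_measurable (lborel \<Otimes>\<^sub>M lborel)"
      unfolding split_beta' by measurable
    from lborel_pair.Fubini'[OF this] show ?thesis by simp
  qed
  also have "\<dots> \<le> (\<integral>\<^sup>+\<rho>. ennreal (16 * C) * ennreal (h (ln \<bar>\<rho>\<bar> - ln Z) / \<bar>\<rho>\<bar>) \<partial>lborel)"
  proof (intro nn_integral_mono_AE, rule AE_mp[OF AE_lborel_singleton[of 0]], rule AE_mp[OF AE_lborel_singleton[of Z]],
      rule AE_mp[OF AE_lborel_singleton[of "- Z"]], rule AE_I2, intro impI)
    \<comment> \<open>The excluded radii form a null set: \<open>a\<close> vanishes at |\<rho>| = Z,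
      and ln |\<rho>| is a default value at 0.\<close>
    fix \<rho> :: real assume \<rho>: "\<rho> \<noteq> - Z" "\<rho> \<noteq> Z" "\<rho> \<noteq> 0"
    have \<rho>': "\<bar>\<rho>\<bar> \<noteq> norm z" using \<rho> by (auto simp: Z_def abs_if split: if_splits)
    have a: "a \<rho> > 0" "a \<rho> \<le> 1" using \<rho>' \<rho> Z by (auto simp: a_def Z_def)
    have "(\<integral>\<^sup>+v. ennreal (\<bar>\<rho>\<bar> / (1 + v\<^sup>2)) * F (\<rho> *\<^sub>R slope_dir v) \<partial>lborel)
      \<le> (\<integral>\<^sup>+v. ennreal (k \<rho> * 16 / \<bar>\<rho>\<bar>) * (ennreal (1 / (1 + v\<^sup>2)) + ennreal (max (a \<rho>) \<bar>v - v0\<bar> powr (- \<sigma>))) \<partial>lborel)"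
    proof (intro nn_integral_mono)
      fix v :: real
      have pos: "1 + v\<^sup>2 > 0" by (simp add: add_pos_nonneg)
      have "kern \<tau> z (\<rho> *\<^sub>R slope_dir v) powr \<sigma> = (max Z \<bar>\<rho>\<bar> / norm (z - \<rho> *\<^sub>R slope_dir v) / (1 + sqrt \<tau> * \<bar>ln Z - ln \<bar>\<rho>\<bar>\<bar>)) powr \<sigma>"
        by (simp add: kern_def Z_def mult.commute)
      also have "\<dots> = (max Z \<bar>\<rho>\<bar> / norm (z - \<rho> *\<^sub>R slope_dir v)) powr \<sigma> * k \<rho>"
      proof -
        have "0 \<le> max Z \<bar>\<rho>\<bar> / norm (z - \<rho> *\<^sub>R slope_dir v)" using Z by (simp add: le_max_iff_disj)
        moreover have "0 \<le> 1 + sqrt \<tau> * \<bar>ln Z - ln \<bar>\<rho>\<bar>\<bar>" using \<tau> by (simp add: add_nonneg_nonneg)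
        ultimately show ?thesis by (subst powr_divide) (auto simp: k_def powr_minus divide_inverse)
      qed
      finally have K: "kern \<tau> z (\<rho> *\<^sub>R slope_dir v) powr \<sigma> = (max Z \<bar>\<rho>\<bar> / norm (z - \<rho> *\<^sub>R slope_dir v)) powr \<sigma> * k \<rho>" .
      have "\<bar>\<rho>\<bar> / (1 + v\<^sup>2) * (kern \<tau> z (\<rho> *\<^sub>R slope_dir v) powr \<sigma> * \<bar>\<rho>\<bar> powr (-2))
        = k \<rho> / \<bar>\<rho>\<bar> * ((max Z \<bar>\<rho>\<bar> / norm (z - \<rho> *\<^sub>R slope_dir v)) powr \<sigma> / (1 + v\<^sup>2))"
      proof -
        have e: "\<bar>\<rho>\<bar> * \<bar>\<rho>\<bar> powr (-2) = 1 / \<bar>\<rho>\<bar>"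
          using \<rho> by (auto simp add: powr_minus_divide power2_eq_square abs_if)
        have "\<bar>\<rho>\<bar> / (1 + v\<^sup>2) * (kern \<tau> z (\<rho> *\<^sub>R slope_dir v) powr \<sigma> * \<bar>\<rho>\<bar> powr (-2))
          = (\<bar>\<rho>\<bar> * \<bar>\<rho>\<bar> powr (-2)) * (kern \<tau> z (\<rho> *\<^sub>R slope_dir v) powr \<sigma> / (1 + v\<^sup>2))"
          by (simp add: mult_ac)
        then show ?thesis unfolding e K by (simp add: mult_ac)
      qed
      also have "\<dots> \<le> k \<rho> / \<bar>\<rho>\<bar> * (16 * (1 / (1 + v\<^sup>2) + max (a \<rho>) \<bar>v - v0\<bar> powr (- \<sigma>)))"
        unfolding Z_def a_def v0_def using angular_bound[OF z(2,1) \<rho>(3) \<rho>', of \<sigma> v] \<sigma>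
        by (intro mult_left_mono) (auto simp: k_def)
      finally have fin: "\<bar>\<rho>\<bar> / (1 + v\<^sup>2) * (kern \<tau> z (\<rho> *\<^sub>R slope_dir v) powr \<sigma> * \<bar>\<rho>\<bar> powr (-2))
        \<le> k \<rho> / \<bar>\<rho>\<bar> * (16 * (1 / (1 + v\<^sup>2) + max (a \<rho>) \<bar>v - v0\<bar> powr (- \<sigma>)))" .
      have "ennreal (\<bar>\<rho>\<bar> / (1 + v\<^sup>2)) * F (\<rho> *\<^sub>R slope_dir v)
        = ennreal (\<bar>\<rho>\<bar> / (1 + v\<^sup>2) * (kern \<tau> z (\<rho> *\<^sub>R slope_dir v) powr \<sigma> * \<bar>\<rho>\<bar> powr (-2)))"
        unfolding F_def using pos by (subst ennreal_mult[symmetric]) auto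
      also have "\<dots> \<le> ennreal (k \<rho> / \<bar>\<rho>\<bar> * (16 * (1 / (1 + v\<^sup>2) + max (a \<rho>) \<bar>v - v0\<bar> powr (- \<sigma>))))"
        by (rule ennreal_leI[OF fin])
      also have "\<dots> = ennreal (k \<rho> * 16 / \<bar>\<rho>\<bar>) * ennreal (1 / (1 + v\<^sup>2) + max (a \<rho>) \<bar>v - v0\<bar> powr (- \<sigma>))"
        using pos by (subst ennreal_mult[symmetric]) (auto simp: k_def)
      also have "ennreal (1 / (1 + v\<^sup>2) + max (a \<rho>) \<bar>v - v0\<bar> powr (- \<sigma>)) = ennreal (1 / (1 + v\<^sup>2)) + ennreal (max (a \<rho>) \<bar>v - v0\<bar> powr (- \<sigma>))"
        using pos by (intro ennreal_plus) auto
      finally show "ennreal (\<bar>\<rho>\<bar> / (1 + v\<^sup>2)) * F (\<rho> *\<^sub>R slope_dir v)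
        \<le> ennreal (k \<rho> * 16 / \<bar>\<rho>\<bar>) * (ennreal (1 / (1 + v\<^sup>2)) + ennreal (max (a \<rho>) \<bar>v - v0\<bar> powr (- \<sigma>)))" .
    qed
    also have "\<dots> = ennreal (k \<rho> * 16 / \<bar>\<rho>\<bar>) * ((\<integral>\<^sup>+v. ennreal (1 / (1 + v\<^sup>2)) \<partial>lborel) + (\<integral>\<^sup>+v. ennreal (max (a \<rho>) \<bar>v - v0\<bar> powr (- \<sigma>)) \<partial>lborel))"
      by (subst nn_integral_cmult, measurable, subst nn_integral_add) auto
    also have "\<dots> \<le> ennreal (k \<rho> * 16 / \<bar>\<rho>\<bar>) * (ennreal 4 + ennreal (2 * (\<sigma> / (\<sigma> - 1)) * a \<rho> powr (1 - \<sigma>)))"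
      using nn_integral_inverse_1_plus_square_le nn_integral_max_powr_le[OF a(1) \<sigma>(1)]
      by (intro mult_left_mono add_mono) auto
    also have "\<dots> \<le> ennreal (k \<rho> * 16 / \<bar>\<rho>\<bar>) * ennreal (C * a \<rho> powr (1 - \<sigma>))"
    proof (intro mult_left_mono)
      \<comment> \<open>Since a <= 1 and 1 - \<sigma> < 0, the constant 4 can be absorbed into the
        singular term.\<close>
      have "a \<rho> powr (1 - \<sigma>) \<ge> 1" using powr_mono2'[of "1 - \<sigma>" "a \<rho>" 1] a \<sigma> by simp
      then have "4 + 2 * (\<sigma> / (\<sigma> - 1)) * a \<rho> powr (1 - \<sigma>) \<le> C * a \<rho> powr (1 - \<sigma>)" by (simp add: C_def algebra_simps)
      moreover have "ennreal 4 + ennreal (2 * (\<sigma> / (\<sigma> - 1)) * a \<rho> powr (1 - \<sigma>)) = ennreal (4 + 2 * (\<sigma> / (\<sigma> - 1)) * a \<rho> powr (1 - \<sigma>))"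
        using \<sigma> by (intro ennreal_plus[symmetric]) auto
      ultimately show "ennreal 4 + ennreal (2 * (\<sigma> / (\<sigma> - 1)) * a \<rho> powr (1 - \<sigma>)) \<le> ennreal (C * a \<rho> powr (1 - \<sigma>))"
        by (simp only: ennreal_leI)
    qed simp
    also have "\<dots> = ennreal (16 * C) * ennreal (h (ln \<bar>\<rho>\<bar> - ln Z) / \<bar>\<rho>\<bar>)"
    proof -
      have "h (ln \<bar>\<rho>\<bar> - ln Z) = k \<rho> * a \<rho> powr (1 - \<sigma>)"
        by (simp add: h_def k_def a_def abs_minus_commute)
      then show ?thesis using C by (simp add: ennreal_mult'[symmetric] k_def mult_ac)
    qed
    finally show "(\<integral>\<^sup>+v. ennreal (\<bar>\<rho>\<bar> / (1 + v\<^sup>2)) * F (\<rho> *\<^sub>R slope_dir v) \<partial>lborel)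
      \<le> ennreal (16 * C) * ennreal (h (ln \<bar>\<rho>\<bar> - ln Z) / \<bar>\<rho>\<bar>)" .
  qed
  also have "\<dots> = ennreal (16 * C) * (\<integral>\<^sup>+\<rho>. ennreal (h (ln \<bar>\<rho>\<bar> - ln Z) / \<bar>\<rho>\<bar>) \<partial>lborel)"
    by (rule nn_integral_cmult) measurable
  also have "(\<integral>\<^sup>+\<rho>. ennreal (h (ln \<bar>\<rho>\<bar> - ln Z) / \<bar>\<rho>\<bar>) \<partial>lborel) \<le> 2 * (\<integral>\<^sup>+\<rho>. indicator {0..} \<rho> * ennreal (h (ln \<rho> - ln Z) / \<rho>) \<partial>lborel)"
    by (rule nn_integral_abs_le[of "\<lambda>\<rho>. ennreal (h (ln \<rho> - ln Z) / \<rho>)"]) measurable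
  also have "(\<integral>\<^sup>+\<rho>. indicator {0..} \<rho> * ennreal (h (ln \<rho> - ln Z) / \<rho>) \<partial>lborel) \<le> (\<integral>\<^sup>+x. ennreal (h (x - ln Z)) \<partial>lborel)"
    by (rule nn_integral_ln_le) (auto simp: h_def)
  also have "(\<integral>\<^sup>+x. ennreal (h (x - ln Z)) \<partial>lborel) = (\<integral>\<^sup>+x. ennreal (h x) \<partial>lborel)"
    using nn_integral_real_affine[of "\<lambda>x. ennreal (h (x - ln Z))" 1 "ln Z"] by simp
  also have "ennreal (16 * C) * (2 * (\<integral>\<^sup>+x. ennreal (h x) \<partial>lborel)) = ennreal (32 * C) * (\<integral>\<^sup>+x. ennreal (h x) \<partial>lborel)"
  proof -
    have "ennreal (32 * C) = ennreal (16 * C * 2)" by simp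
    also have "\<dots> = ennreal (16 * C) * ennreal 2" using C by (intro ennreal_mult) auto
    finally show ?thesis by (simp add: mult.assoc)
  qed
  finally show ?thesis unfolding F_def h_def C_def by (simp add: mult_left_mono)
qed

text \<open>Exchanging the two coordinates preserves \<open>kern\<close> and Lebesgue measure, which
  reduces every z to the case of slope at most 1.\<close>

lemma kernel_schur:
  fixes \<sigma> :: real
  assumes \<sigma>: "1 < \<sigma>" "\<sigma> < 2"
  shows "\<exists>C>0. \<forall>\<tau>\<ge>1. \<forall>z\<noteq>0. (\<integral>\<^sup>+\<zeta>. ennreal (kern \<tau> z \<zeta> powr \<sigma> * norm \<zeta> powr (-2)) \<partial>lborel) \<le> ennreal (C * \<tau> powr (- (2 - \<sigma>) / 2))"
proof -
  obtain C0 where C0: "C0 > 0" "\<And>\<tau>. \<tau> \<ge> 1 \<Longrightarrow> (\<integral>\<^sup>+x. ennreal ((1 + sqrt \<tau> * \<bar>x\<bar>) powr (- \<sigma>) * (1 - exp (- \<bar>x\<bar>)) powr (1 - \<sigma>)) \<partial>lborel)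
    \<le> ennreal (C0 * \<tau> powr (- (2 - \<sigma>) / 2))" using radial_kernel_integral[OF \<sigma>] by blast
  define C1 where "C1 = 32 * (4 + 2 * (\<sigma> / (\<sigma> - 1)))"
  have C1: "C1 > 0" using \<sigma> by (simp add: C1_def add_pos_pos)
  have main: "(\<integral>\<^sup>+\<zeta>. ennreal (kern \<tau> z \<zeta> powr \<sigma> * norm \<zeta> powr (-2)) \<partial>lborel) \<le> ennreal (C1 * C0 * \<tau> powr (- (2 - \<sigma>) / 2))"
    if "\<tau> \<ge> 1" "z \<noteq> 0" "\<bar>z $ 2\<bar> \<le> \<bar>z $ 1\<bar>" for \<tau> and z :: "real ^ 2"
  proof -
    have "(\<integral>\<^sup>+\<zeta>. ennreal (kern \<tau> z \<zeta> powr \<sigma> * norm \<zeta> powr (-2)) \<partial>lborel) \<le> ennreal C1 * ennreal (C0 * \<tau> powr (- (2 - \<sigma>) / 2))"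
      using kernel_schur_aux[OF \<sigma> that] mult_left_mono[OF C0(2)[OF that(1)], of "ennreal C1"]
      unfolding C1_def by (rule order_trans) simp
    also have "\<dots> = ennreal (C1 * C0 * \<tau> powr (- (2 - \<sigma>) / 2))"
      using C1 by (simp add: ennreal_mult'[symmetric] mult.assoc)
    finally show ?thesis .
  qed
  show ?thesis
  proof (intro exI[of _ "C1 * C0"] conjI allI impI)
    show "C1 * C0 > 0" using C0 C1 by simp
    fix \<tau> :: real and z :: "real ^ 2" assume \<tau>: "\<tau> \<ge> 1" and z: "z \<noteq> 0"
    show "(\<integral>\<^sup>+\<zeta>. ennreal (kern \<tau> z \<zeta> powr \<sigma> * norm \<zeta> powr (-2)) \<partial>lborel) \<le> ennreal (C1 * C0 * \<tau> powr (- (2 - \<sigma>) / 2))"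
    proof (cases "\<bar>z $ 2\<bar> \<le> \<bar>z $ 1\<bar>")
      case False
      define z' where "z' = mkv (z $ 2, z $ 1)"
      have sw: "norm (mkv (b, a)) = norm (mkv (a, b))" for a b by (simp add: norm_real2 add.commute)
      have nz: "norm (mkv (x $ 2, x $ 1)) = norm x" for x :: "real ^ 2" by (simp add: norm_real2 add.commute)
      have dz: "norm (z - mkv (a, b)) = norm (z' - mkv (b, a))" for a b
        by (simp add: norm_real2 z'_def add.commute)
      have kz: "kern \<tau> z (mkv (a, b)) = kern \<tau> z' (mkv (b, a))" for a b
        unfolding kern_def dz sw[of b a] by (simp add: z'_def nz)
      have "(\<integral>\<^sup>+\<zeta>. ennreal (kern \<tau> z \<zeta> powr \<sigma> * norm \<zeta> powr (-2)) \<partial>lborel)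
        = (\<integral>\<^sup>+a. \<integral>\<^sup>+b. ennreal (kern \<tau> z (mkv (a, b)) powr \<sigma> * norm (mkv (a, b)) powr (-2)) \<partial>lborel \<partial>lborel)"
        by (rule nn_integral_real2) measurable
      also have "\<dots> = (\<integral>\<^sup>+a. \<integral>\<^sup>+b. ennreal (kern \<tau> z' (mkv (b, a)) powr \<sigma> * norm (mkv (b, a)) powr (-2)) \<partial>lborel \<partial>lborel)"
        by (intro nn_integral_cong) (metis kz sw)
      also have "\<dots> = (\<integral>\<^sup>+\<zeta>. ennreal (kern \<tau> z' \<zeta> powr \<sigma> * norm \<zeta> powr (-2)) \<partial>lborel)"
        by (rule nn_integral_real2_swap[symmetric]) measurable
      also have "\<dots> \<le> ennreal (C1 * C0 * \<tau> powr (- (2 - \<sigma>) / 2))"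
        using False z by (intro main \<tau>) (auto simp: z'_def simp flip: norm_eq_zero[of "mkv _"] simp: nz)
      finally show ?thesis .
    qed (rule main[OF \<tau> z])
  qed
qed

subsection \<open>Young's inequality\<close>

text \<open>The weighted arithmetic-geometric mean inequality with its coefficients dropped; this is
  the source of the factor 2 in \<open>young_kernel_inequality\<close>.\<close>

lemma powr_weighted_le_sum:
  fixes X Y s :: real
  assumes "0 \<le> X" "0 \<le> Y" "0 < s" "s < 1"
  shows "X powr s * Y powr (1 - s) \<le> X + Y"
proof -
  have "X powr s * Y powr (1 - s) \<le> max X Y powr s * max X Y powr (1 - s)"
    using assms by (intro mult_mono powr_mono2) auto
  also have "\<dots> = max X Y powr (s + (1 - s))" by (simp only: powr_add)
  also have "\<dots> = max X Y" using assms by (simp add: le_max_iff_disj)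
  also have "\<dots> \<le> X + Y" using assms by auto
  finally show ?thesis .
qed

text \<open>A Young inequality for kernels without convolution structure. Write K f as u v with u =
  K^(\<sigma>/2) f^(p/2) and apply Cauchy-Schwarz for fixed z. The square of v is K^(2-\<sigma>)
  f^(2-p), whose exponents relative to \<sigma> and p add up to 1, so its integral is bounded
  uniformly in z. The square of u is integrated in z by Tonelli.\<close>

lemma young_kernel_inequality:
  fixes K :: "'a \<Rightarrow> 'a \<Rightarrow> real" and f :: "'a \<Rightarrow> real"
  assumes M: "sigma_finite_measure M"
    and K [measurable]: "(\<lambda>x. K (fst x) (snd x)) \<in> borel_measurable (M \<Otimes>\<^sub>M M)"
    and f [measurable]: "f \<in> borel_measurable M"
    and nn: "\<And>x y. 0 \<le> K x y" "\<And>x. 0 \<le> f x"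
    and \<sigma>: "1 < \<sigma>" "\<sigma> < 2" and p: "1 < p" "p < 2" and \<sigma>p: "1 / \<sigma> + 1 / p = 3 / 2"
    and B: "B > 0" "AE z in M. (\<integral>\<^sup>+\<zeta>. ennreal (K z \<zeta> powr \<sigma>) \<partial>M) \<le> ennreal B"
      "AE \<zeta> in M. (\<integral>\<^sup>+z. ennreal (K z \<zeta> powr \<sigma>) \<partial>M) \<le> ennreal B"
    and A: "A > 0" "(\<integral>\<^sup>+\<zeta>. ennreal (f \<zeta> powr p) \<partial>M) \<le> ennreal (A powr p)"
  shows "(\<integral>\<^sup>+z. (\<integral>\<^sup>+\<zeta>. ennreal (K z \<zeta> * f \<zeta>) \<partial>M)\<^sup>2 \<partial>M) \<le> ennreal (2 * A\<^sup>2 * B powr (2 / \<sigma>))"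
proof -
  interpret sigma_finite_measure M by (rule M)
  interpret pair_sigma_finite M M ..
  \<comment> \<open>The relation between \<sigma> and p says exactly that (2 - \<sigma>) / \<sigma>
    and (2 - p) / p add up to 1.\<close>
  define s where "s = (2 - \<sigma>) / \<sigma>"
  have s1: "1 - s = (2 - p) / p" using \<sigma>p \<sigma> p by (simp add: s_def field_simps)
  have s: "0 < s" "s < 1" using \<sigma> p s1 by (auto simp: s_def field_simps)
  \<comment> \<open>The value Hoelder's inequality would give for the integral of v^2; the cruder
    pointwise bound used here gives 2 c.\<close>
  define c where "c = B powr s * A powr (2 - p)"
  have c: "c > 0" using A B by (simp add: c_def)
  have Kz [measurable]: "(\<lambda>\<zeta>. K z \<zeta>) \<in> borel_measurable M" if "z \<in> space M" for z
    using measurable_compose[OF measurable_Pair1'[OF that] K] by simp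
  have main: "(\<integral>\<^sup>+\<zeta>. ennreal (K z \<zeta> * f \<zeta>) \<partial>M)\<^sup>2 \<le> ennreal (2 * c) * (\<integral>\<^sup>+\<zeta>. ennreal (K z \<zeta> powr \<sigma>) * ennreal (f \<zeta> powr p) \<partial>M)"
    if z: "z \<in> space M" and zB: "(\<integral>\<^sup>+\<zeta>. ennreal (K z \<zeta> powr \<sigma>) \<partial>M) \<le> ennreal B" for z
  proof -
    note [measurable] = Kz[OF z]
    define u where "u \<zeta> = ennreal (K z \<zeta> powr (\<sigma> / 2) * f \<zeta> powr (p / 2))" for \<zeta>
    define v where "v \<zeta> = ennreal (K z \<zeta> powr (1 - \<sigma> / 2) * f \<zeta> powr (1 - p / 2))" for \<zeta>
    have [measurable]: "u \<in> borel_measurable M" "v \<in> borel_measurable M" unfolding u_def v_def by measurable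
    have sq: "(x powr (a / 2))\<^sup>2 = x powr a" "(x powr (1 - a / 2))\<^sup>2 = x powr (2 - a)" for x a :: real
      by (simp_all add: power2_eq_square flip: powr_add)
    have pw: "x powr a * x powr (1 - a) = x" if "x \<ge> 0" for x a :: real
      using that by (simp flip: powr_add)
    have uv: "ennreal (K z \<zeta> * f \<zeta>) = u \<zeta> * v \<zeta>" for \<zeta>
      unfolding u_def v_def using pw[OF nn(1), of z \<zeta> "\<sigma> / 2"] pw[OF nn(2), of \<zeta> "p / 2"]
      by (subst ennreal_mult[symmetric]) (auto simp: mult_ac)
    have u2: "u \<zeta> ^ 2 = ennreal (K z \<zeta> powr \<sigma>) * ennreal (f \<zeta> powr p)" for \<zeta>
    proof -
      have "(K z \<zeta> powr (\<sigma> / 2) * f \<zeta> powr (p / 2))\<^sup>2 = K z \<zeta> powr \<sigma> * f \<zeta> powr p"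
        by (simp add: power_mult_distrib sq)
      then show ?thesis unfolding u_def by (subst ennreal_power, simp) (simp only: ennreal_mult powr_ge_zero)
    qed
    have v2: "v \<zeta> ^ 2 \<le> ennreal (c / B) * ennreal (K z \<zeta> powr \<sigma>) + ennreal (c / A powr p) * ennreal (f \<zeta> powr p)" for \<zeta>
    proof -
      have "(K z \<zeta> powr \<sigma> / B) powr s * (f \<zeta> powr p / A powr p) powr (1 - s) \<le> K z \<zeta> powr \<sigma> / B + f \<zeta> powr p / A powr p"
        using A B s by (intro powr_weighted_le_sum) auto
      moreover have "(K z \<zeta> powr \<sigma> / B) powr s = K z \<zeta> powr (2 - \<sigma>) / B powr s"
        using B \<sigma> by (subst powr_divide) (auto simp: powr_powr s_def)
      moreover have "(f \<zeta> powr p / A powr p) powr (1 - s) = f \<zeta> powr (2 - p) / A powr (2 - p)"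
        using A p by (subst powr_divide) (auto simp: powr_powr s1)
      ultimately have "K z \<zeta> powr (2 - \<sigma>) * f \<zeta> powr (2 - p) / c \<le> K z \<zeta> powr \<sigma> / B + f \<zeta> powr p / A powr p"
        by (simp add: c_def)
      then have "K z \<zeta> powr (2 - \<sigma>) * f \<zeta> powr (2 - p) \<le> c * (K z \<zeta> powr \<sigma> / B + f \<zeta> powr p / A powr p)"
        using c by (simp add: pos_divide_le_eq mult.commute)
      also have "\<dots> = c / B * K z \<zeta> powr \<sigma> + c / A powr p * f \<zeta> powr p" by (simp add: distrib_left)
      finally have *: "K z \<zeta> powr (2 - \<sigma>) * f \<zeta> powr (2 - p) \<le> c / B * K z \<zeta> powr \<sigma> + c / A powr p * f \<zeta> powr p" .
      have "v \<zeta> ^ 2 = ennreal (K z \<zeta> powr (2 - \<sigma>) * f \<zeta> powr (2 - p))"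
        unfolding v_def by (subst ennreal_power) (auto simp: power_mult_distrib sq)
      also have "\<dots> \<le> ennreal (c / B * K z \<zeta> powr \<sigma> + c / A powr p * f \<zeta> powr p)" by (rule ennreal_leI[OF *])
      also have "\<dots> = ennreal (c / B) * ennreal (K z \<zeta> powr \<sigma>) + ennreal (c / A powr p) * ennreal (f \<zeta> powr p)"
        using c A(1) B(1) ennreal_mult[of "c / B" "K z \<zeta> powr \<sigma>"] ennreal_mult[of "c / A powr p" "f \<zeta> powr p"]
        by (subst ennreal_plus) simp_all
      finally show ?thesis .
    qed
    have "(\<integral>\<^sup>+\<zeta>. v \<zeta> ^ 2 \<partial>M) \<le> (\<integral>\<^sup>+\<zeta>. ennreal (c / B) * ennreal (K z \<zeta> powr \<sigma>) + ennreal (c / A powr p) * ennreal (f \<zeta> powr p) \<partial>M)"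
      by (intro nn_integral_mono v2)
    also have "\<dots> = ennreal (c / B) * (\<integral>\<^sup>+\<zeta>. ennreal (K z \<zeta> powr \<sigma>) \<partial>M) + ennreal (c / A powr p) * (\<integral>\<^sup>+\<zeta>. ennreal (f \<zeta> powr p) \<partial>M)"
      by (simp add: nn_integral_add nn_integral_cmult)
    also have "\<dots> \<le> ennreal (c / B) * ennreal B + ennreal (c / A powr p) * ennreal (A powr p)"
      by (intro add_mono mult_left_mono zB A) auto
    also have "\<dots> = ennreal c + ennreal c" using A B c by (simp add: ennreal_mult'[symmetric])
    also have "\<dots> = ennreal (2 * c)" using c by (simp add: ennreal_plus[symmetric] del: ennreal_plus)
    finally have v: "(\<integral>\<^sup>+\<zeta>. v \<zeta> ^ 2 \<partial>M) \<le> ennreal (2 * c)" .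
    have "(\<integral>\<^sup>+\<zeta>. ennreal (K z \<zeta> * f \<zeta>) \<partial>M)\<^sup>2 = (\<integral>\<^sup>+\<zeta>. u \<zeta> * v \<zeta> \<partial>M)\<^sup>2" by (simp add: uv)
    also have "\<dots> \<le> (\<integral>\<^sup>+\<zeta>. u \<zeta> ^ 2 \<partial>M) * (\<integral>\<^sup>+\<zeta>. v \<zeta> ^ 2 \<partial>M)" by (rule Cauchy_Schwarz_nn_integral) auto
    also have "\<dots> \<le> (\<integral>\<^sup>+\<zeta>. u \<zeta> ^ 2 \<partial>M) * ennreal (2 * c)" by (intro mult_left_mono v) auto
    finally show ?thesis by (simp add: u2 mult.commute)
  qed
  have "(\<integral>\<^sup>+z. (\<integral>\<^sup>+\<zeta>. ennreal (K z \<zeta> * f \<zeta>) \<partial>M)\<^sup>2 \<partial>M)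
    \<le> (\<integral>\<^sup>+z. ennreal (2 * c) * (\<integral>\<^sup>+\<zeta>. ennreal (K z \<zeta> powr \<sigma>) * ennreal (f \<zeta> powr p) \<partial>M) \<partial>M)"
    using B(2) by (intro nn_integral_mono_AE) (auto elim!: AE_mp intro!: main)
  also have "\<dots> = ennreal (2 * c) * (\<integral>\<^sup>+z. (\<integral>\<^sup>+\<zeta>. ennreal (K z \<zeta> powr \<sigma>) * ennreal (f \<zeta> powr p) \<partial>M) \<partial>M)"
    by (rule nn_integral_cmult) measurable
  also have "(\<integral>\<^sup>+z. (\<integral>\<^sup>+\<zeta>. ennreal (K z \<zeta> powr \<sigma>) * ennreal (f \<zeta> powr p) \<partial>M) \<partial>M)
    = (\<integral>\<^sup>+\<zeta>. (\<integral>\<^sup>+z. ennreal (K z \<zeta> powr \<sigma>) * ennreal (f \<zeta> powr p) \<partial>M) \<partial>M)"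
  proof -
    have "(\<lambda>(z, \<zeta>). ennreal (K z \<zeta> powr \<sigma>) * ennreal (f \<zeta> powr p)) \<in> borel_measurable (M \<Otimes>\<^sub>M M)"
      unfolding split_beta' by measurable
    from Fubini'[OF this] show ?thesis by simp
  qed
  also have "\<dots> \<le> (\<integral>\<^sup>+\<zeta>. ennreal B * ennreal (f \<zeta> powr p) \<partial>M)"
  proof (intro nn_integral_mono_AE, rule AE_mp[OF B(3)], rule AE_I2, rule impI)
    fix \<zeta> assume \<zeta>: "\<zeta> \<in> space M" "(\<integral>\<^sup>+z. ennreal (K z \<zeta> powr \<sigma>) \<partial>M) \<le> ennreal B"
    have [measurable]: "(\<lambda>z. K z \<zeta>) \<in> borel_measurable M"
      using measurable_compose[OF measurable_Pair2'[OF \<zeta>(1)] K] by simp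
    show "(\<integral>\<^sup>+z. ennreal (K z \<zeta> powr \<sigma>) * ennreal (f \<zeta> powr p) \<partial>M) \<le> ennreal B * ennreal (f \<zeta> powr p)"
      using \<zeta>(2) by (subst nn_integral_multc) (auto intro: mult_right_mono)
  qed
  also have "\<dots> = ennreal B * (\<integral>\<^sup>+\<zeta>. ennreal (f \<zeta> powr p) \<partial>M)" by (rule nn_integral_cmult) measurable
  also have "\<dots> \<le> ennreal B * ennreal (A powr p)" by (intro mult_left_mono A) auto
  also have "ennreal (2 * c) * (ennreal B * ennreal (A powr p)) = ennreal (2 * A\<^sup>2 * B powr (2 / \<sigma>))"
  proof -
    have "B powr s * B = B powr (s + 1)" using B by (simp add: powr_add)
    also have "s + 1 = 2 / \<sigma>" using \<sigma> by (simp add: s_def field_simps)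
    finally have 1: "B powr s * B = B powr (2 / \<sigma>)" .
    have 2: "A powr (2 - p) * A powr p = A\<^sup>2" using A by (simp flip: powr_add)
    have "2 * c * (B * A powr p) = 2 * (A powr (2 - p) * A powr p) * (B powr s * B)" by (simp add: c_def mult_ac)
    also have "\<dots> = 2 * A\<^sup>2 * B powr (2 / \<sigma>)" by (simp only: 1 2)
    finally show ?thesis using c B by (simp flip: ennreal_mult')
  qed
  finally show ?thesis by (simp add: mult_left_mono)
qed

subsection \<open>A Cauchy--Pompeiu inequality\<close>

definition vec_complex :: "real ^ 2 \<Rightarrow> complex" where "vec_complex x = Complex (x $ 1) (x $ 2)"

definition dbar :: "(real ^ 2 \<Rightarrow> complex) \<Rightarrow> real ^ 2 \<Rightarrow> complex" where
  "dbar f x = partial_deriv 1 f x + \<i> * partial_deriv 2 f x"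

lemma bounded_linear_vec_complex: "bounded_linear vec_complex"
proof -
  have "vec_complex = (\<lambda>x. of_real (x $ 1) + of_real (x $ 2) * \<i>)" by (auto simp: vec_complex_def complex_eq_iff)
  moreover have "bounded_linear \<dots>"
    by (intro bounded_linear_add bounded_linear_mult_left[THEN bounded_linear_compose]
      bounded_linear_of_real[THEN bounded_linear_compose] bounded_linear_vec_nth)
  ultimately show ?thesis by simp
qed

lemma norm_vec_complex [simp]: "norm (vec_complex x) = norm x"
  by (simp add: vec_complex_def norm_real2 cmod_def)

lemma vec_complex_eq_0_iff [simp]: "vec_complex x = 0 \<longleftrightarrow> x = 0"
  using norm_vec_complex by (metis norm_eq_zero)

lemma has_pd_vec_complex: "has_pd 1 vec_complex 1 x" "has_pd 2 vec_complex \<i> x"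
proof -
  have "vec_complex (axis 1 1) = 1" "vec_complex (axis 2 1) = \<i>" by (auto simp: vec_complex_def axis_def complex_eq_iff)
  then show "has_pd 1 vec_complex 1 x" "has_pd 2 vec_complex \<i> x"
    using has_derivative_imp_has_pd[OF bounded_linear_imp_has_derivative[OF bounded_linear_vec_complex], of _ x] by metis+
qed

lemma continuous_on_vec_complex [continuous_intros]: "continuous_on S f \<Longrightarrow> continuous_on S (\<lambda>x. vec_complex (f x))"
  by (rule bounded_linear.continuous_on[OF bounded_linear_vec_complex])

lemma compact_supp_add:
  assumes "compact_supp \<Omega> f" "compact_supp \<Omega> g" shows "compact_supp \<Omega> (\<lambda>x. f x + g x)"
proof -
  obtain K L where "compact K" "K \<subseteq> \<Omega>" "\<And>x. x \<notin> K \<Longrightarrow> f x = 0" "compact L" "L \<subseteq> \<Omega>" "\<And>x. x \<notin> L \<Longrightarrow> g x = 0"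
    using assms unfolding compact_supp_def by metis
  moreover have "continuous_on UNIV (\<lambda>x. f x + g x)"
    using assms by (intro continuous_intros compact_supp_continuous)
  moreover from calculation have "f x + g x = 0" if "x \<notin> K \<union> L" for x using that by auto
  ultimately show ?thesis
    unfolding compact_supp_def by (intro conjI exI[of _ "K \<union> L"]) (auto intro: compact_Un)
qed

lemma integral_partial_deriv_eq_0_complex:
  fixes f :: "real ^ 'n::finite \<Rightarrow> complex"
  assumes f: "compact_supp \<Omega> f" and f': "compact_supp \<Omega> f'" and pd: "\<And>x. has_pd i f (f' x) x" and \<Omega>: "open \<Omega>"
  shows "(\<integral>x. f' x \<partial>lborel) = 0"
proof -
  have *: "h (\<integral>x. f' x \<partial>lborel) = 0" if h: "bounded_linear h" for h :: "complex \<Rightarrow> real"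
  proof -
    have compact_supp: "compact_supp \<Omega> (\<lambda>x. h (g x))" if "compact_supp \<Omega> g" for g
      using that by (rule compact_supp_weight[OF _ \<Omega>])
        (auto intro!: bounded_linear.continuous_on[OF h] compact_supp_continuous[OF that] simp: linear_0 bounded_linear.linear[OF h])
    have "h (\<integral>x. f' x \<partial>lborel) = (\<integral>x. h (f' x) \<partial>lborel)"
      by (rule integral_bounded_linear[OF h compact_supp_integrable[OF f'], symmetric])
    also have "\<dots> = 0"
      by (rule integral_partial_deriv_eq_0[OF compact_supp[OF f] compact_supp[OF f'] has_pd_bounded_linear[OF h pd]])
    finally show ?thesis .
  qed
  show ?thesis using *[OF bounded_linear_Re] *[OF bounded_linear_Im] by (simp add: complex_eq_iff)
qed

text \<open>The integrand is at most the product of 1 / (1 + a^2) and 1 / (1 + b^2), which separates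
  under Tonelli.\<close>

lemma integrable_cauchy_approx: "integrable lborel (\<lambda>x :: real ^ 2. 1 / (1 + (norm x)\<^sup>2)\<^sup>2)"
proof (rule integrableI_bounded)
  have "(\<integral>\<^sup>+x. ennreal (norm (1 / (1 + (norm x)\<^sup>2)\<^sup>2)) \<partial>(lborel :: (real ^ 2) measure))
    = (\<integral>\<^sup>+a. \<integral>\<^sup>+b. ennreal (1 / (1 + (norm (mkv (a, b)))\<^sup>2)\<^sup>2) \<partial>lborel \<partial>lborel)"
    by (subst nn_integral_real2) (auto simp: norm_divide norm_power)
  also have "\<dots> \<le> (\<integral>\<^sup>+a. \<integral>\<^sup>+b. ennreal (1 / (1 + a\<^sup>2)) * ennreal (1 / (1 + b\<^sup>2)) \<partial>lborel \<partial>lborel)"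
  proof (intro nn_integral_mono)
    fix a b :: real
    have "(1 + a\<^sup>2) * (1 + b\<^sup>2) \<le> (1 + (norm (mkv (a, b)))\<^sup>2)\<^sup>2"
    proof -
      have "(1 + (norm (mkv (a, b)))\<^sup>2)\<^sup>2 - (1 + a\<^sup>2) * (1 + b\<^sup>2) = a\<^sup>2 + b\<^sup>2 + (a\<^sup>2)\<^sup>2 + (b\<^sup>2)\<^sup>2 + a\<^sup>2 * b\<^sup>2"
        by (simp add: norm_real2) (simp add: power2_eq_square power4_eq_xxxx algebra_simps)
      also have "\<dots> \<ge> 0" by (intro add_nonneg_nonneg mult_nonneg_nonneg) auto
      finally show ?thesis by simp
    qed
    then have "1 / (1 + (norm (mkv (a, b)))\<^sup>2)\<^sup>2 \<le> 1 / ((1 + a\<^sup>2) * (1 + b\<^sup>2))"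
      by (intro divide_left_mono mult_pos_pos zero_less_power add_pos_nonneg) auto
    then show "ennreal (1 / (1 + (norm (mkv (a, b)))\<^sup>2)\<^sup>2) \<le> ennreal (1 / (1 + a\<^sup>2)) * ennreal (1 / (1 + b\<^sup>2))"
      by (subst ennreal_mult[symmetric]) (auto intro!: ennreal_leI)
  qed
  also have "\<dots> = (\<integral>\<^sup>+a. ennreal (1 / (1 + a\<^sup>2)) \<partial>lborel) * (\<integral>\<^sup>+b. ennreal (1 / (1 + b\<^sup>2)) \<partial>lborel)"
    by (simp add: nn_integral_cmult nn_integral_multc)
  also have "\<dots> \<le> 4 * 4" by (intro mult_mono nn_integral_inverse_1_plus_square_le) auto
  also have "\<dots> < \<infinity>" by (simp add: ennreal_mult_less_top)
  finally show "(\<integral>\<^sup>+x. ennreal (norm (1 / (1 + (norm x)\<^sup>2)\<^sup>2)) \<partial>(lborel :: (real ^ 2) measure)) < \<infinity>" .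
qed measurable

lemma lborel_integral_scale:
  fixes f :: "real ^ 2 \<Rightarrow> 'b::{banach, second_countable_topology}"
  assumes [measurable]: "f \<in> borel_measurable borel" and d: "d > 0"
  shows "(\<integral>x. f x \<partial>lborel) = (\<integral>x. d\<^sup>2 *\<^sub>R f (z + d *\<^sub>R x) \<partial>lborel)"
  by (subst lborel_affine[of d z]) (use d in \<open>simp_all add: integral_density integral_distr\<close>)

text \<open>Lets \<open>pd_intros\<close> build a schematic derivative, so that agreement with the
  wanted expression becomes a purely algebraic goal.\<close>

lemma has_pd_eqI: "has_pd i f D x \<Longrightarrow> D = D' \<Longrightarrow> has_pd i f D' x"
  by simp

text \<open>Integrating by parts against the smooth kernel \<open>cnj \<zeta> / (|\<zeta>|\<^sup>2 + d\<^sup>2)\<close> in place of \<open>1 / \<zeta>\<close> and letting \<open>d\<close> tend to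
  \<open>0\<close> avoids singular integrals. The value of \<open>\<kappa>\<close> (which is \<open>2 pi\<close>) plays no role, only its positivity.\<close>

lemma cauchy_pompeiu_inequality:
  fixes g :: "real ^ 2 \<Rightarrow> complex"
  defines "\<kappa> \<equiv> 2 * (\<integral>x. 1 / (1 + (norm x)\<^sup>2)\<^sup>2 \<partial>(lborel :: (real ^ 2) measure))"
  assumes g: "compact_supp UNIV g" and g': "\<And>i. compact_supp UNIV (g' i)" and pd: "\<And>i x. has_pd i g (g' i x) x"
  shows "ennreal (\<kappa> * norm (g z)) \<le> (\<integral>\<^sup>+\<zeta>. ennreal (norm (g' 1 \<zeta> + \<i> * g' 2 \<zeta>) / norm (z - \<zeta>)) \<partial>lborel)"
proof -
  define D where "D \<zeta> = g' 1 \<zeta> + \<i> * g' 2 \<zeta>" for \<zeta>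
  define I where "I = (\<integral>\<^sup>+\<zeta>. ennreal (norm (D \<zeta>) / norm (z - \<zeta>)) \<partial>lborel)"
  define q where "q x = 1 / (1 + (norm x)\<^sup>2)\<^sup>2" for x :: "real ^ 2"
  have [measurable]: "g \<in> borel_measurable borel" "g' i \<in> borel_measurable borel" for i
    using compact_supp_measurable g g' by auto
  have ccD: "compact_supp UNIV D" unfolding D_def
    by (intro compact_supp_add g' compact_supp_weight[OF g'[of 2]] continuous_intros compact_supp_continuous[OF g'[of 2]]) auto
  have [measurable]: "D \<in> borel_measurable borel" by (rule compact_supp_measurable[OF ccD])
  have step: "ennreal (norm (\<integral>x. complex_of_real (2 * q x) * g (z + d *\<^sub>R x) \<partial>lborel)) \<le> I" if d: "d > 0" for d
  proof -
    define r where "r x = (norm (x - z))\<^sup>2 + d\<^sup>2" for x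
    have r: "r x > 0" for x using d by (simp add: r_def add_nonneg_pos)
    have r_eq: "r = (\<lambda>x. (x $ 1 - z $ 1) * (x $ 1 - z $ 1) + (x $ 2 - z $ 2) * (x $ 2 - z $ 2) + d\<^sup>2)"
      by (simp add: r_def norm_real2 fun_eq_iff power2_eq_square)
    define k where "k x = complex_of_real (1 / r x) * cnj (vec_complex (x - z))" for x
    define r' where "r' i x = 2 * (x - z) $ i" for i and x :: "real ^ 2"
    \<comment> \<open>The partial derivatives of cnj (x1 + i x2), the conjugates of those of
      \<open>vec_complex\<close>.\<close>
    define e where "e i = (if i = (1 :: 2) then 1 else - \<i>)" for i
    define k' where "k' i x = complex_of_real (1 / r x) * e i + complex_of_real (- 1 / (r x)\<^sup>2 * r' i x) * cnj (vec_complex (x - z))" for i x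
    have pr: "has_pd i r (r' i x) x" for i x
    proof -
      have i: "i = 1 \<or> i = 2" by (rule exhaust_2)
      show ?thesis unfolding r_eq
        by (rule has_pd_eqI, (rule pd_intros)+) (use i in \<open>auto simp: r'_def\<close>)
    qed
    have pk: "has_pd i k (k' i x) x" for i x
    proof -
      have "((\<lambda>y. 1 / y) has_real_derivative - 1 / (r x)\<^sup>2) (at (r x))"
        using r[of x] by (auto intro!: derivative_eq_intros simp: power2_eq_square)
      from has_pd_chain[OF this pr] have 1: "has_pd i (\<lambda>x. 1 / r x) (- 1 / (r x)\<^sup>2 * r' i x) x" .
      have "has_pd i (\<lambda>x. vec_complex (x + - z)) (cnj (e i)) x"
        unfolding has_pd_shift using has_pd_vec_complex[of "x + - z"] exhaust_2[of i] by (auto simp: e_def)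
      then have 2: "has_pd i (\<lambda>x. cnj (vec_complex (x - z))) (e i) x"
        using has_pd_cnj by fastforce
      show ?thesis unfolding k_def k'_def by (rule has_pd_mult[OF has_pd_of_real[OF 1] 2])
    qed
    have cr: "continuous_on UNIV r" unfolding r_def by (intro continuous_intros)
    have r0: "\<forall>x\<in>UNIV. r x \<noteq> 0" using r by (metis less_irrefl)
    have ck: "continuous_on UNIV k" unfolding k_def
      by (intro continuous_intros cr r0)
    have ck': "continuous_on UNIV (k' i)" for i unfolding k'_def r'_def
      by (intro continuous_intros cr r0) (use r0 in auto)
    define G' where "G' i x = g x * k' i x + g' i x * k x" for i x
    have ccG: "compact_supp UNIV (\<lambda>x. g x * k x)"
      by (rule compact_supp_weight[OF g]) (auto intro!: continuous_intros ck compact_supp_continuous[OF g])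
    have ccG': "compact_supp UNIV (G' i)" for i unfolding G'_def
    proof (rule compact_supp_add)
      show "compact_supp UNIV (\<lambda>x. g x * k' i x)"
        by (rule compact_supp_weight[OF g]) (auto intro!: continuous_intros ck' compact_supp_continuous[OF g])
      show "compact_supp UNIV (\<lambda>x. g' i x * k x)"
        by (rule compact_supp_weight[OF g'[of i]]) (auto intro!: continuous_intros ck compact_supp_continuous[OF g'])
    qed
    have int0: "(\<integral>x. G' i x \<partial>lborel) = 0" for i
      by (rule integral_partial_deriv_eq_0_complex[OF ccG ccG'[of i]]) (auto simp: G'_def intro!: has_pd_mult pd pk)
    \<comment> \<open>The smoothed kernel is no longer holomorphic: its \<open>dbar\<close> is 2 d^2
      / r^2, which has mass \<kappa> for every d and concentrates at z as d tends to 0.\<close>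
    have eq: "G' 1 x + \<i> * G' 2 x = g x * complex_of_real (2 * d\<^sup>2 / (r x)\<^sup>2) + D x * k x" for x
    proof -
      have "r' 1 x + \<i> * r' 2 x = 2 * vec_complex (x - z)" by (simp add: r'_def vec_complex_def complex_eq_iff)
      moreover have "k' 1 x + \<i> * k' 2 x = 2 * complex_of_real (1 / r x)
        - complex_of_real (1 / (r x)\<^sup>2) * ((r' 1 x + \<i> * r' 2 x) * cnj (vec_complex (x - z)))"
        by (simp add: k'_def e_def algebra_simps)
      ultimately have "k' 1 x + \<i> * k' 2 x = 2 * complex_of_real (1 / r x)
        - complex_of_real (1 / (r x)\<^sup>2) * (2 * (vec_complex (x - z) * cnj (vec_complex (x - z))))" by (simp only: mult.assoc)
      also have "vec_complex (x - z) * cnj (vec_complex (x - z)) = complex_of_real (r x - d\<^sup>2)"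
        by (simp only: complex_norm_square[symmetric] norm_vec_complex) (simp add: r_def)
      also have "2 * complex_of_real (1 / r x) - complex_of_real (1 / (r x)\<^sup>2) * (2 * complex_of_real (r x - d\<^sup>2))
        = complex_of_real (2 * (1 / r x) - 1 / (r x)\<^sup>2 * (2 * (r x - d\<^sup>2)))" by simp
      also have "2 * (1 / r x) - 1 / (r x)\<^sup>2 * (2 * (r x - d\<^sup>2)) = 2 * d\<^sup>2 / (r x)\<^sup>2"
        using r[of x] by (simp add: field_simps power2_eq_square)
      finally have "k' 1 x + \<i> * k' 2 x = complex_of_real (2 * d\<^sup>2 / (r x)\<^sup>2)" .
      moreover have "G' 1 x + \<i> * G' 2 x = g x * (k' 1 x + \<i> * k' 2 x) + D x * k x"
        by (simp add: G'_def D_def algebra_simps)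
      ultimately show ?thesis by simp
    qed
    have cc1: "compact_supp UNIV (\<lambda>x. g x * complex_of_real (2 * d\<^sup>2 / (r x)\<^sup>2))"
      by (rule compact_supp_weight[OF g]) (use r0 in \<open>auto intro!: continuous_intros cr compact_supp_continuous[OF g]\<close>)
    have cc2: "compact_supp UNIV (\<lambda>x. D x * k x)"
      by (rule compact_supp_weight[OF ccD]) (auto intro!: continuous_intros ck compact_supp_continuous[OF ccD])
    have "(\<integral>x. g x * complex_of_real (2 * d\<^sup>2 / (r x)\<^sup>2) \<partial>lborel) + (\<integral>x. D x * k x \<partial>lborel)
      = (\<integral>x. G' 1 x + \<i> * G' 2 x \<partial>lborel)"
      unfolding eq by (rule Bochner_Integration.integral_add[OF compact_supp_integrable[OF cc1] compact_supp_integrable[OF cc2], symmetric])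
    also have "\<dots> = (\<integral>x. G' 1 x \<partial>lborel) + \<i> * (\<integral>x. G' 2 x \<partial>lborel)"
      by (simp add: compact_supp_integrable[OF ccG'])
    also have "\<dots> = 0" by (simp add: int0)
    finally have "(\<integral>x. g x * complex_of_real (2 * d\<^sup>2 / (r x)\<^sup>2) \<partial>lborel) = - (\<integral>x. D x * k x \<partial>lborel)"
      unfolding eq_neg_iff_add_eq_0 .
    then have "norm (\<integral>x. g x * complex_of_real (2 * d\<^sup>2 / (r x)\<^sup>2) \<partial>lborel) = norm (\<integral>x. D x * k x \<partial>lborel)"
      by (simp only: norm_minus_cancel)
    moreover have "ennreal (norm (\<integral>x. D x * k x \<partial>lborel)) \<le> (\<integral>\<^sup>+x. ennreal (norm (D x * k x)) \<partial>lborel)"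
      by (rule integral_norm_bound_ennreal[OF compact_supp_integrable[OF cc2]])
    moreover have "(\<integral>\<^sup>+x. ennreal (norm (D x * k x)) \<partial>lborel) \<le> I" unfolding I_def
    proof (intro nn_integral_mono ennreal_leI)
      fix x
      have "norm (k x) = norm (x - z) / r x" using r[of x] by (simp add: k_def norm_mult norm_divide)
      also have "\<dots> \<le> 1 / norm (z - x)"
      \<comment> \<open>At x = z both sides are 0, the right one by division by zero.\<close>
      proof (cases "x = z")
        case False
        then show ?thesis using r[of x] by (simp add: norm_minus_commute divide_simps) (simp add: r_def power2_eq_square norm_minus_commute)
      qed simp
      finally have "norm (D x) * norm (k x) \<le> norm (D x) * (1 / norm (z - x))" by (intro mult_left_mono) auto
      then show "norm (D x * k x) \<le> norm (D x) / norm (z - x)" by (simp add: norm_mult)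
    qed
    moreover have "(\<integral>x. g x * complex_of_real (2 * d\<^sup>2 / (r x)\<^sup>2) \<partial>lborel) = (\<integral>x. complex_of_real (2 * q x) * g (z + d *\<^sub>R x) \<partial>lborel)"
    proof -
      have "(\<integral>x. g x * complex_of_real (2 * d\<^sup>2 / (r x)\<^sup>2) \<partial>lborel)
        = (\<integral>x. d\<^sup>2 *\<^sub>R (g (z + d *\<^sub>R x) * complex_of_real (2 * d\<^sup>2 / (r (z + d *\<^sub>R x))\<^sup>2)) \<partial>lborel)"
        by (rule lborel_integral_scale[OF compact_supp_measurable[OF cc1] d])
      also have "\<dots> = (\<integral>x. complex_of_real (2 * q x) * g (z + d *\<^sub>R x) \<partial>lborel)"
      proof (rule Bochner_Integration.integral_cong[OF refl])
        fix x :: "real ^ 2"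
        have "r (z + d *\<^sub>R x) = d\<^sup>2 * (1 + (norm x)\<^sup>2)" by (simp add: r_def power_mult_distrib algebra_simps)
        moreover have "1 + (norm x)\<^sup>2 > 0" by (simp add: add_pos_nonneg)
        moreover have "d\<^sup>2 * (2 * d\<^sup>2 / (d\<^sup>2 * t)\<^sup>2) = 2 * (1 / t\<^sup>2)" if "t > 0" for t
          using d that by (simp add: field_simps power2_eq_square)
        ultimately have "d\<^sup>2 * (2 * d\<^sup>2 / (r (z + d *\<^sub>R x))\<^sup>2) = 2 * q x"
          unfolding q_def by metis
        moreover have "c *\<^sub>R (w * complex_of_real a) = complex_of_real (c * a) * w" for a c w
          by (simp add: scaleR_conv_of_real)
        ultimately show "d\<^sup>2 *\<^sub>R (g (z + d *\<^sub>R x) * complex_of_real (2 * d\<^sup>2 / (r (z + d *\<^sub>R x))\<^sup>2)) = complex_of_real (2 * q x) * g (z + d *\<^sub>R x)"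
          by (simp only:)
      qed
      finally show ?thesis .
    qed
    ultimately show ?thesis by simp
  qed
  show ?thesis
  \<comment> \<open>If \<open>I\<close> is infinite there is nothing to prove. Otherwise it bounds
    the smoothed integrals for every d > 0, and d tends to 0 by dominated convergence.\<close>
  proof (cases I)
    case (real c)
    define h where "h n = inverse (real (Suc n))" for n
    have h: "h n > 0" for n by (simp add: h_def)
    obtain B where B: "0 \<le> B" "\<And>x. norm (g x) \<le> B" by (rule compact_supp_bounded[OF g]) blast
    have cg: "isCont g z" using compact_supp_continuous[OF g, of UNIV] by (simp add: continuous_on_eq_continuous_at)
    have qm [measurable]: "q \<in> borel_measurable borel" unfolding q_def by measurable
    have "(\<lambda>n. \<integral>x. complex_of_real (2 * q x) * g (z + h n *\<^sub>R x) \<partial>lborel) \<longlonglongrightarrow> (\<integral>x. complex_of_real (2 * q x) * g z \<partial>lborel)"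
    proof (rule integral_dominated_convergence[where w = "\<lambda>x. 2 * B * q x"])
      show "integrable lborel (\<lambda>x. 2 * B * q x)"
        unfolding q_def by (intro integrable_mult_right integrable_cauchy_approx)
      show "AE x in lborel. (\<lambda>n. complex_of_real (2 * q x) * g (z + h n *\<^sub>R x)) \<longlonglongrightarrow> complex_of_real (2 * q x) * g z"
      proof (rule AE_I2)
        fix x :: "real ^ 2"
        have "h \<longlonglongrightarrow> 0" unfolding h_def by (rule LIMSEQ_inverse_real_of_nat)
        then have "(\<lambda>n. z + h n *\<^sub>R x) \<longlonglongrightarrow> z + 0 *\<^sub>R x" by (intro tendsto_intros)
        then have "(\<lambda>n. z + h n *\<^sub>R x) \<longlonglongrightarrow> z" by simp
        from isCont_tendsto_compose[OF cg this]
        show "(\<lambda>n. complex_of_real (2 * q x) * g (z + h n *\<^sub>R x)) \<longlonglongrightarrow> complex_of_real (2 * q x) * g z"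
          by (intro tendsto_mult tendsto_const)
      qed
      show "AE x in lborel. norm (complex_of_real (2 * q x) * g (z + h n *\<^sub>R x)) \<le> 2 * B * q x" for n
      proof (rule AE_I2)
        fix x :: "real ^ 2"
        have "0 \<le> q x" by (simp add: q_def)
        then show "norm (complex_of_real (2 * q x) * g (z + h n *\<^sub>R x)) \<le> 2 * B * q x"
          using mult_left_mono[OF B(2)[of "z + h n *\<^sub>R x"], of "2 * q x"] by (simp add: norm_mult mult_ac)
      qed
    qed measurable
    then have "(\<lambda>n. norm (\<integral>x. complex_of_real (2 * q x) * g (z + h n *\<^sub>R x) \<partial>lborel)) \<longlonglongrightarrow> norm (\<integral>x. complex_of_real (2 * q x) * g z \<partial>lborel)"
      by (rule tendsto_norm)
    moreover have "norm (\<integral>x. complex_of_real (2 * q x) * g (z + h n *\<^sub>R x) \<partial>lborel) \<le> c" for n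
      using step[OF h[of n]] real by simp
    ultimately have *: "norm (\<integral>x. complex_of_real (2 * q x) * g z \<partial>lborel) \<le> c"
      by (intro LIMSEQ_le_const2) auto
    have "(\<integral>x. complex_of_real (2 * q x) * g z \<partial>lborel) = (\<integral>x. complex_of_real (2 * q x) \<partial>lborel) * g z"
      by (rule integral_mult_left_zero)
    also have "(\<integral>x. complex_of_real (2 * q x) \<partial>lborel) = complex_of_real (\<integral>x. 2 * q x \<partial>lborel)"
      by (rule integral_complex_of_real)
    also have "(\<integral>x. 2 * q x \<partial>lborel) = \<kappa>" unfolding q_def \<kappa>_def by (rule integral_mult_right_zero)
    finally have "(\<integral>x. complex_of_real (2 * q x) * g z \<partial>lborel) = complex_of_real \<kappa> * g z" .
    moreover have "\<kappa> \<ge> 0" unfolding \<kappa>_def by (intro mult_nonneg_nonneg Bochner_Integration.integral_nonneg) auto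
    ultimately have "norm (\<integral>x. complex_of_real (2 * q x) * g z \<partial>lborel) = \<kappa> * norm (g z)"
      by (simp only: norm_mult norm_of_real abs_of_nonneg)
    with * real show ?thesis unfolding I_def[symmetric] D_def[symmetric] by (simp add: ennreal_leI)
  next
    case top
    then show ?thesis unfolding I_def[symmetric] D_def[symmetric] by simp
  qed
qed

lemma cauchy_approx_mass_pos: "0 < (\<integral>x. 1 / (1 + (norm x)\<^sup>2)\<^sup>2 \<partial>(lborel :: (real ^ 2) measure))"
proof -
  have pos: "1 / (1 + (norm x)\<^sup>2)\<^sup>2 > 0" for x :: "real ^ 2"
    by (intro divide_pos_pos zero_less_power add_pos_nonneg) auto
  have "(\<integral>x. 1 / (1 + (norm x)\<^sup>2)\<^sup>2 \<partial>(lborel :: (real ^ 2) measure)) \<noteq> 0"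
  proof
    assume "(\<integral>x. 1 / (1 + (norm x)\<^sup>2)\<^sup>2 \<partial>(lborel :: (real ^ 2) measure)) = 0"
    then have "AE x :: real ^ 2 in lborel. 1 / (1 + (norm x)\<^sup>2)\<^sup>2 = 0"
      by (subst (asm) integral_nonneg_eq_0_iff_AE[OF integrable_cauchy_approx]) auto
    then have "AE x :: real ^ 2 in lborel. False" using pos by (metis (mono_tags, lifting) AE_cong less_irrefl)
    then show False by (simp add: AE_iff_measurable[of UNIV])
  qed
  moreover have "0 \<le> (\<integral>x. 1 / (1 + (norm x)\<^sup>2)\<^sup>2 \<partial>(lborel :: (real ^ 2) measure))" by (intro Bochner_Integration.integral_nonneg) auto
  ultimately show ?thesis by linarith
qed

subsection \<open>The Carleman kernel\<close>

text \<open>The right side is quadratic at x = 1 but only linear at infinity, so (x - 1)^2 has to be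
  damped by (max 1 x)^2. With x = y^2, the inequality ln y <= y - 1 makes the right side at least (y
  - 1)^2, and y + 1 <= 2 max 1 x accounts for the 1/4.\<close>

lemma log_convexity:
  fixes x :: real
  assumes "x > 0"
  shows "((x - 1) / max 1 x)\<^sup>2 / 4 \<le> x - 1 - ln x"
proof -
  define y where "y = sqrt x"
  have y: "y > 0" "x = y\<^sup>2" using assms by (auto simp: y_def)
  have "ln x = 2 * ln y" using y by (simp add: ln_realpow)
  also have "ln y \<le> y - 1" using ln_le_minus_one y by blast
  finally have "(y - 1)\<^sup>2 \<le> x - 1 - ln x" using y(2) by (simp add: power2_eq_square algebra_simps)
  moreover have "((x - 1) / max 1 x)\<^sup>2 / 4 \<le> (y - 1)\<^sup>2"
  proof -
    have "y + 1 \<le> 2 * max 1 x"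
    proof (cases "y \<le> 1")
      case True then show ?thesis using max.cobounded1[of 1 x] by linarith
    next
      case False
      then have "y \<le> x" using y by (simp add: power2_eq_square)
      then show ?thesis using False by simp
    qed
    then have "(y + 1) / (2 * max 1 x) \<le> 1" by (simp add: divide_le_eq_1 less_max_iff_disj)
    then have "((y + 1) / (2 * max 1 x))\<^sup>2 \<le> 1" using y by (intro power_le_one) (auto simp: le_max_iff_disj)
    then have "(y - 1)\<^sup>2 * ((y + 1) / (2 * max 1 x))\<^sup>2 \<le> (y - 1)\<^sup>2 * 1" by (intro mult_left_mono) auto
    moreover have "((x - 1) / max 1 x)\<^sup>2 / 4 = (y - 1)\<^sup>2 * ((y + 1) / (2 * max 1 x))\<^sup>2"
    proof -
      have "(y - 1) * ((y + 1) / (2 * max 1 x)) = (x - 1) / max 1 x / 2"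
        by (simp add: y(2) power2_eq_square algebra_simps)
      then have "((y - 1) * ((y + 1) / (2 * max 1 x)))\<^sup>2 = ((x - 1) / max 1 x / 2)\<^sup>2" by simp
      then show ?thesis unfolding power_mult_distrib by (simp add: power_divide)
    qed
    ultimately show ?thesis by simp
  qed
  ultimately show ?thesis by linarith
qed

text \<open>With \<open>x = s / t\<close>, the difference of \<open>t + ln (t\<^sup>2)\<close> and its tangent line is \<open>2 (ln x - x + 1)\<close>, which is negative away
  from \<open>x = 1\<close>. The slope \<open>m\<close> exceeds that of the tangent by less than \<open>1\<close> because it has to be an integer.\<close>

lemma carleman_weight_bound:
  fixes t s \<tau> m :: real
  assumes t: "t \<le> -1" and s: "s \<le> -1" and \<tau>: "\<tau> \<ge> 1"
    and m: "\<tau> * (1 + 2 / t) \<le> m" "m \<le> \<tau> * (1 + 2 / t) + 1"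
  shows "exp (\<tau> * ((s + ln (s\<^sup>2)) - (t + ln (t\<^sup>2))) + m * (t - s)) * exp s * (1 + sqrt \<tau> * \<bar>t - s\<bar>)
    \<le> 2 * \<bar>t\<bar> * \<bar>s\<bar> * max (exp t) (exp s)"
proof -
  define x where "x = s / t"
  \<comment> \<open>The rounding error of m; everything else in the exponent is \<tau> times the gap
    between a concave function and its tangent.\<close>
  define d where "d = m - \<tau> * (1 + 2 / t)"
  have x: "x > 0" using t s by (simp add: x_def divide_neg_neg)
  have d: "0 \<le> d" "d \<le> 1" using m by (auto simp: d_def)
  have st: "s = x * t" using t by (simp add: x_def)
  have l: "ln (s\<^sup>2) = 2 * ln x + ln (t\<^sup>2)"
  proof -
    have "s\<^sup>2 = x\<^sup>2 * t\<^sup>2" by (simp add: st power_mult_distrib)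
    then have "ln (s\<^sup>2) = ln (x\<^sup>2) + ln (t\<^sup>2)" using x t by (simp add: ln_mult)
    then show ?thesis using x by (simp add: ln_realpow)
  qed
  have e: "\<tau> * ((s + ln (s\<^sup>2)) - (t + ln (t\<^sup>2))) + m * (t - s) = - 2 * \<tau> * (x - 1 - ln x) + d * (t - s)"
  proof -
    have "m = d + \<tau> + 2 * \<tau> / t" by (simp add: d_def algebra_simps)
    moreover have "2 * \<tau> / t * (t - s) = 2 * \<tau> * (1 - x)" using t by (simp add: st field_simps)
    ultimately have "m * (t - s) = d * (t - s) + \<tau> * (t - s) + 2 * \<tau> * (1 - x)" by (simp add: distrib_right)
    then show ?thesis by (simp add: l algebra_simps)
  qed
  \<comment> \<open>A convex combination of t and s, because 0 <= d <= 1. So the rounding error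
    together with exp s costs no more than \<open>max (exp t) (exp s)\<close>, the numerator of
    \<open>kern\<close>.\<close>
  have "d * (t - s) + s = d * t + (1 - d) * s" by (simp add: algebra_simps)
  also have "\<dots> \<le> d * max t s + (1 - d) * max t s" using d by (intro add_mono mult_left_mono) auto
  finally have "d * (t - s) + s \<le> max t s" by (simp add: algebra_simps)
  then have "exp (d * (t - s) + s) \<le> exp (max t s)" by simp
  also have "\<dots> = max (exp t) (exp s)" by (simp add: max_def)
  finally have 1: "exp (d * (t - s)) * exp s \<le> max (exp t) (exp s)" by (simp add: exp_add)
  \<comment> \<open>The Gaussian variable: the exponent is at most - Y^2 / 2.\<close>
  define Y where "Y = sqrt \<tau> * (\<bar>x - 1\<bar> / max 1 x)"
  have Y: "Y \<ge> 0" using \<tau> by (auto simp: Y_def le_max_iff_disj intro!: mult_nonneg_nonneg divide_nonneg_nonneg)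
  have "Y\<^sup>2 / 2 = 2 * \<tau> * (((x - 1) / max 1 x)\<^sup>2 / 4)" using \<tau> by (simp add: Y_def power_mult_distrib power_divide)
  also have "\<dots> \<le> 2 * \<tau> * (x - 1 - ln x)" using log_convexity[OF x] \<tau> by (intro mult_left_mono) auto
  finally have "exp (- 2 * \<tau> * (x - 1 - ln x)) \<le> exp (- (Y\<^sup>2 / 2))" by simp
  moreover have "exp (- (Y\<^sup>2 / 2)) * (1 + Y) \<le> 2"
  proof -
    have "0 \<le> (Y - 1 / 2)\<^sup>2" by simp
    then have "1 + Y \<le> 2 * (1 + Y\<^sup>2 / 2)" by (simp add: power2_eq_square algebra_simps)
    also have "\<dots> \<le> 2 * exp (Y\<^sup>2 / 2)" by (intro mult_left_mono exp_ge_add_one_self) auto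
    finally show ?thesis by (simp add: exp_minus field_simps)
  qed
  \<comment> \<open>The Gaussian controls the relative distance |s / t - 1|, while
    \<open>kern\<close> involves t - s. Passing from one to the other costs |t| |s|, which is why
    the logarithmic weights appear on both sides of the estimate.\<close>
  moreover have "1 + sqrt \<tau> * \<bar>t - s\<bar> \<le> \<bar>t\<bar> * \<bar>s\<bar> * (1 + Y)"
  proof -
    have ts: "1 * 1 \<le> \<bar>t\<bar> * \<bar>s\<bar>" using t s by (intro mult_mono) auto
    have sx: "max 1 x \<le> \<bar>s\<bar>"
    proof -
      have "x * 1 \<le> x * \<bar>t\<bar>" using x t by (intro mult_left_mono) auto
      moreover have "\<bar>s\<bar> = x * \<bar>t\<bar>" using x by (simp add: st abs_mult)
      moreover have "1 \<le> \<bar>s\<bar>" using s by simp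
      ultimately show ?thesis by simp
    qed
    have "\<bar>t - s\<bar> = \<bar>t\<bar> * \<bar>x - 1\<bar>"
    proof -
      have "t - s = - (t * (x - 1))" by (simp add: st algebra_simps)
      then show ?thesis by (simp add: abs_mult)
    qed
    also have "\<bar>x - 1\<bar> = max 1 x * (\<bar>x - 1\<bar> / max 1 x)" using x by (simp add: max_def)
    also have "\<bar>t\<bar> * \<dots> \<le> \<bar>t\<bar> * (\<bar>s\<bar> * (\<bar>x - 1\<bar> / max 1 x))"
      using sx by (intro mult_left_mono mult_right_mono) (auto simp: le_max_iff_disj intro!: divide_nonneg_nonneg)
    finally have "sqrt \<tau> * \<bar>t - s\<bar> \<le> sqrt \<tau> * (\<bar>t\<bar> * (\<bar>s\<bar> * (\<bar>x - 1\<bar> / max 1 x)))" using \<tau> by (intro mult_left_mono) auto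
    also have "\<dots> = \<bar>t\<bar> * \<bar>s\<bar> * Y" by (simp add: Y_def mult_ac)
    finally show ?thesis using ts by (simp add: distrib_left)
  qed
  ultimately have "exp (- 2 * \<tau> * (x - 1 - ln x)) * (1 + sqrt \<tau> * \<bar>t - s\<bar>) \<le> exp (- (Y\<^sup>2 / 2)) * (\<bar>t\<bar> * \<bar>s\<bar> * (1 + Y))"
    using \<tau> by (intro mult_mono) (auto intro!: add_nonneg_nonneg)
  also have "\<dots> = \<bar>t\<bar> * \<bar>s\<bar> * (exp (- (Y\<^sup>2 / 2)) * (1 + Y))" by (simp add: mult_ac)
  also have "\<dots> \<le> \<bar>t\<bar> * \<bar>s\<bar> * 2" using \<open>exp (- (Y\<^sup>2 / 2)) * (1 + Y) \<le> 2\<close> by (intro mult_left_mono) auto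
  finally have 2: "exp (- 2 * \<tau> * (x - 1 - ln x)) * (1 + sqrt \<tau> * \<bar>t - s\<bar>) \<le> \<bar>t\<bar> * \<bar>s\<bar> * 2" .
  have "exp (\<tau> * ((s + ln (s\<^sup>2)) - (t + ln (t\<^sup>2))) + m * (t - s)) * exp s * (1 + sqrt \<tau> * \<bar>t - s\<bar>)
    = (exp (- 2 * \<tau> * (x - 1 - ln x)) * (1 + sqrt \<tau> * \<bar>t - s\<bar>)) * (exp (d * (t - s)) * exp s)"
    unfolding e exp_add by (simp only: mult_ac)
  also have "\<dots> \<le> (\<bar>t\<bar> * \<bar>s\<bar> * 2) * max (exp t) (exp s)"
    by (rule mult_mono[OF 2 1]) auto
  finally show ?thesis by (simp add: mult_ac)
qed

text \<open>The radius \<open>exp (-6)\<close> makes the logarithm at most \<open>-6\<close>, as needed for \<open>zero_order_estimate\<close>.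
  At the origin \<open>polar_wt\<close> is \<open>0\<close>.\<close>

definition punctured_disc :: "(real ^ 2) set" where "punctured_disc = ball 0 (exp (- 6)) - {0}"

abbreviation lnr :: "real ^ 2 \<Rightarrow> real" where "lnr x \<equiv> ln (norm x)"
abbreviation wtE :: "real \<Rightarrow> real ^ 2 \<Rightarrow> real" where "wtE \<tau> x \<equiv> exp (- \<tau> * phi (norm x))"
abbreviation polar_wt :: "real ^ 2 \<Rightarrow> real" where "polar_wt x \<equiv> norm x powr (- 2)"

lemma open_punctured_disc: "open punctured_disc" by (simp add: punctured_disc_def open_delete)

lemma punctured_discD:
  assumes "x \<in> punctured_disc" shows "x \<noteq> 0" "lnr x < - 6"
proof -
  show 0: "x \<noteq> 0" using assms by (auto simp: punctured_disc_def)
  have "norm x < exp (- 6)" using assms by (simp add: punctured_disc_def)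
  then have "ln (norm x) < ln (exp (- 6 :: real))" using 0 by (subst ln_less_cancel_iff) auto
  then show "lnr x < - 6" by simp
qed

text \<open>The twisted Cauchy kernel placed between the two Carleman weights, written as a density
  for r^-2 dx. One factor |\<zeta>| goes to the weighted right-hand side, and |\<zeta>|
  \<open>polar_wt \<zeta>\<close> is the 1 / |\<zeta>| left over from exp s.\<close>

lemma kernel_pointwise:
  assumes z: "z \<in> punctured_disc" and \<zeta>: "\<zeta> \<in> punctured_disc" and \<tau>: "\<tau> \<ge> 1"
    and m: "m = \<lceil>\<tau> * (1 + 2 / lnr z)\<rceil>"
  shows "inverse \<bar>lnr z\<bar> * wtE \<tau> z * norm z powi m * (norm \<zeta> powi (- m) / norm (z - \<zeta>))
    \<le> 2 * kern \<tau> z \<zeta> * (\<bar>lnr \<zeta>\<bar> * wtE \<tau> \<zeta> * norm \<zeta>) * polar_wt \<zeta>"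
proof -
  define t where "t = lnr z"
  define s where "s = lnr \<zeta>"
  note zz = punctured_discD[OF z] punctured_discD[OF \<zeta>]
  have ts: "t < -6" "s < -6" "norm z = exp t" "norm \<zeta> = exp s" using zz by (auto simp: t_def s_def)
  define X where "X = 1 + sqrt \<tau> * \<bar>t - s\<bar>"
  have X: "X > 0" using \<tau> by (auto simp: X_def intro!: add_pos_nonneg)
  have "exp (\<tau> * ((s + ln (s\<^sup>2)) - (t + ln (t\<^sup>2))) + m * (t - s)) * exp s * X \<le> 2 * \<bar>t\<bar> * \<bar>s\<bar> * max (exp t) (exp s)"
    unfolding X_def
  proof (rule carleman_weight_bound)
    \<comment> \<open>The slope 1 + 2 / t is the derivative of \<open>phi\<close> in t = ln |z|, and
      rounding up stays in the admissible unit interval.\<close>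
    show "\<tau> * (1 + 2 / t) \<le> m" "m \<le> \<tau> * (1 + 2 / t) + 1" unfolding m t_def[symmetric] by linarith+
  qed (use ts \<tau> in auto)
  moreover have "exp (\<tau> * ((s + ln (s\<^sup>2)) - (t + ln (t\<^sup>2))) + m * (t - s))
    = wtE \<tau> z * norm z powi m * norm \<zeta> powi (- m) / wtE \<tau> \<zeta>"
  proof -
    have "norm z powi m = exp (m * t)" "norm \<zeta> powi (- m) = exp (- m * s)"
      using ts powr_real_of_int'[of "norm z" m] powr_real_of_int'[of "norm \<zeta>" "- m"] by (auto simp: powr_def)
    then show ?thesis
      unfolding phi_def t_def[symmetric] s_def[symmetric] exp_diff[symmetric] exp_add[symmetric]
      by (simp add: algebra_simps flip: exp_add exp_diff)
  qed
  ultimately have "(wtE \<tau> z * norm z powi m * norm \<zeta> powi (- m) / wtE \<tau> \<zeta>) * norm \<zeta> * X \<le> 2 * \<bar>t\<bar> * \<bar>s\<bar> * max (norm z) (norm \<zeta>)"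
    by (simp only: ts(3,4))
  then have "wtE \<tau> z * norm z powi m * norm \<zeta> powi (- m) \<le> 2 * \<bar>t\<bar> * \<bar>s\<bar> * max (norm z) (norm \<zeta>) * wtE \<tau> \<zeta> / (norm \<zeta> * X)"
    using X ts zz(3) by (simp add: field_simps)
  then have "inverse \<bar>t\<bar> / norm (z - \<zeta>) * (wtE \<tau> z * norm z powi m * norm \<zeta> powi (- m))
     \<le> inverse \<bar>t\<bar> / norm (z - \<zeta>) * (2 * \<bar>t\<bar> * \<bar>s\<bar> * max (norm z) (norm \<zeta>) * wtE \<tau> \<zeta> / (norm \<zeta> * X))"
    by (intro mult_left_mono) auto
  also have "\<dots> = 2 * (max (norm z) (norm \<zeta>) / (X * norm (z - \<zeta>))) * (\<bar>s\<bar> * wtE \<tau> \<zeta>) / norm \<zeta>"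
    using ts by (simp add: field_simps)
  also have "\<dots> = 2 * kern \<tau> z \<zeta> * (\<bar>s\<bar> * wtE \<tau> \<zeta> * norm \<zeta>) * polar_wt \<zeta>"
  proof -
    have "norm \<zeta> * polar_wt \<zeta> = 1 / norm \<zeta>" using zz(3) by (simp add: powr_minus_divide power2_eq_square)
    moreover have "2 * kern \<tau> z \<zeta> * (\<bar>s\<bar> * wtE \<tau> \<zeta> * norm \<zeta>) * polar_wt \<zeta> = 2 * kern \<tau> z \<zeta> * (\<bar>s\<bar> * wtE \<tau> \<zeta>) * (norm \<zeta> * polar_wt \<zeta>)"
      by (simp only: mult_ac)
    ultimately show ?thesis unfolding kern_def X_def t_def s_def by simp
  qed
  finally show ?thesis by (simp add: t_def s_def divide_inverse mult_ac)
qed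

text \<open>Multiplication by a power of \<open>z\<close> commutes with \<open>dbar\<close>, and any integer exponent is allowed since \<open>U\<close> vanishes near
  the origin. Below, the exponent is chosen depending on the point \<open>z\<close>.\<close>

lemma cauchy_pompeiu_twisted:
  fixes U :: "real ^ 2 \<Rightarrow> complex" and m :: int
  defines "\<kappa> \<equiv> 2 * (\<integral>x. 1 / (1 + (norm x)\<^sup>2)\<^sup>2 \<partial>(lborel :: (real ^ 2) measure))"
  assumes U: "U \<in> test_functions \<Omega>" and \<Omega>: "open \<Omega>" "0 \<notin> \<Omega>"
  shows "ennreal (\<kappa> * (norm (U z) * norm z powi (- m)))
    \<le> (\<integral>\<^sup>+\<zeta>. ennreal (norm (dbar U \<zeta>) * norm \<zeta> powi (- m) / norm (z - \<zeta>)) \<partial>lborel)"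
proof -
  define g where "g x = U x * vec_complex x powi (- m)" for x
  define e where "e i = (if i = (1 :: 2) then 1 else \<i>)" for i
  define P where "P x = vec_complex x powi (- m)" for x
  define Q where "Q x = of_int (- m) * vec_complex x powi (- m - 1)" for x
  define g' where "g' i x = U x * (e i * Q x) + partial_deriv i U x * P x" for i x
  note Ui = test_fun_partial_deriv[OF U] and ccU = compact_supp_TF[OF U]
  note ccUi = compact_supp_TF[OF Ui]
  have \<Omega>0: "\<forall>x\<in>\<Omega>. vec_complex x \<noteq> 0" using \<Omega> by auto
  have c: "continuous_on \<Omega> P" "continuous_on \<Omega> Q"
    unfolding P_def Q_def using \<Omega>0 by (auto intro!: continuous_intros)
  have "compact_supp \<Omega> g" unfolding g_def P_def[symmetric]
    by (rule compact_supp_weight[OF ccU \<Omega>(1)]) (auto intro!: continuous_intros c compact_supp_continuous[OF ccU])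
  then have 1: "compact_supp UNIV g" by (rule compact_supp_mono) simp
  have "compact_supp \<Omega> (g' i)" for i unfolding g'_def
  proof (rule compact_supp_add)
    show "compact_supp \<Omega> (\<lambda>x. U x * (e i * Q x))"
      by (rule compact_supp_weight[OF ccU \<Omega>(1)]) (auto intro!: continuous_intros c compact_supp_continuous[OF ccU])
    show "compact_supp \<Omega> (\<lambda>x. partial_deriv i U x * P x)"
      by (rule compact_supp_weight[OF ccUi[of i] \<Omega>(1)]) (auto intro!: continuous_intros c compact_supp_continuous[OF ccUi])
  qed
  then have 2: "compact_supp UNIV (g' i)" for i by (rule compact_supp_mono) simp
  have 3: "has_pd i g (g' i x) x" for i x
  proof (cases "x = 0")
    \<comment> \<open>The chain rule fails at the origin, where a negative power is singular, but
      \<open>U\<close> vanishes on a neighbourhood of it.\<close>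
    case True
    have "closure {x. U x \<noteq> 0} \<subseteq> \<Omega>" using U by (simp add: test_functions_def)
    then have x: "x \<notin> closure {x. U x \<noteq> 0}" using True \<Omega> by auto
    have "has_pd i U 0 x" by (rule has_pd_zero_outside[OF x])
    then have "partial_deriv i U x = 0" by (rule partial_deriv_eqI)
    moreover have "U x = 0" using x by (rule test_fun_zero_outside)
    ultimately have "g' i x = 0" by (simp add: g'_def)
    moreover have "has_pd i g 0 x"
    proof (rule has_pd_cong_open[of i "\<lambda>_. 0" 0 x "- closure {x. U x \<noteq> 0}"])
      show "\<And>y. y \<in> - closure {x. U x \<noteq> 0} \<Longrightarrow> 0 = g y"
        using closure_subset[of "{x. U x \<noteq> 0}"] by (auto simp: g_def)
    qed (use x in \<open>auto intro: has_pd_const\<close>)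
    ultimately show ?thesis by simp
  next
    case False
    have "((\<lambda>w. w powi (- m)) has_field_derivative of_int (- m) * vec_complex x powi (- m - 1)) (at (vec_complex x))"
      using False by (auto intro!: derivative_eq_intros)
    moreover have "has_pd i vec_complex (e i) x" using exhaust_2[of i] has_pd_vec_complex by (auto simp: e_def)
    ultimately have "has_pd i P (e i * Q x) x" unfolding P_def Q_def by (rule has_pd_field_chain)
    from has_pd_mult[OF test_fun_has_pd[OF U] this] show ?thesis unfolding g_def P_def[symmetric] g'_def .
  qed
  have D: "g' 1 x + \<i> * g' 2 x = dbar U x * P x" for x
  proof -
    \<comment> \<open>The Cauchy-Riemann equation for z: \<open>dbar\<close> annihilates the
      holomorphic twist.\<close>
    have "e 1 + \<i> * e 2 = 0" by (simp add: e_def)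
    moreover have "g' 1 x + \<i> * g' 2 x = U x * (e 1 + \<i> * e 2) * Q x + dbar U x * P x"
      by (simp add: g'_def dbar_def algebra_simps)
    ultimately show ?thesis by simp
  qed
  have "ennreal (\<kappa> * norm (g z)) \<le> (\<integral>\<^sup>+\<zeta>. ennreal (norm (g' 1 \<zeta> + \<i> * g' 2 \<zeta>) / norm (z - \<zeta>)) \<partial>lborel)"
    unfolding \<kappa>_def by (rule cauchy_pompeiu_inequality[OF 1 2 3])
  then show ?thesis unfolding D by (simp add: g_def P_def norm_mult norm_power_int)
qed

lemma dbar_zero_outside:
  assumes "U \<in> test_functions \<Omega>" "x \<notin> \<Omega>" shows "dbar U x = 0"
proof -
  have "x \<notin> closure {x. U x \<noteq> 0}" using assms by (auto simp: test_functions_def)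
  then have "has_pd i U 0 x" for i by (rule has_pd_zero_outside)
  then show ?thesis using partial_deriv_eqI unfolding dbar_def by (metis add.right_neutral mult_zero_right)
qed

lemma compact_supp_dbar: "U \<in> test_functions \<Omega> \<Longrightarrow> open \<Omega> \<Longrightarrow> compact_supp \<Omega> (dbar U)"
  unfolding dbar_def
  by (intro compact_supp_add compact_supp_TF test_fun_partial_deriv compact_supp_weight[OF compact_supp_TF[OF test_fun_partial_deriv[of U \<Omega> 2]]] continuous_intros compact_supp_continuous[OF compact_supp_TF[OF test_fun_partial_deriv[of U \<Omega> 2]]]) auto

text \<open>The twisted formula bounds the weighted U pointwise by \<open>kern\<close> applied to
  the weighted \<open>dbar U\<close>, and Young's inequality for r^-2 dx maps L^p to L^2. Using A >
  0 in place of the norm itself allows division by A, also when the norm is 0.\<close>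

lemma core_estimate_nn:
  assumes p: "1 < p" "p < 2"
  shows "\<exists>C>0. \<forall>\<tau>\<ge>1. \<forall>U\<in>test_functions punctured_disc. \<forall>A>0.
    (\<integral>\<^sup>+x. ennreal ((\<bar>lnr x\<bar> * wtE \<tau> x * norm x * norm (dbar U x)) powr p * polar_wt x) \<partial>lborel) \<le> ennreal (A powr p) \<longrightarrow>
    (\<integral>\<^sup>+x. ennreal ((inverse \<bar>lnr x\<bar> * wtE \<tau> x * norm (U x))\<^sup>2 * polar_wt x) \<partial>lborel) \<le> ennreal ((C * \<tau> powr (- (1 - 1 / p)) * A)\<^sup>2)"
proof -
  \<comment> \<open>The solution of 1/\<sigma> + 1/p = 3/2; the range 1 < p < 2 corresponds to 1 <
    \<sigma> < 2.\<close>
  define \<sigma> where "\<sigma> = 2 * p / (3 * p - 2)"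
  have \<sigma>p: "1 / \<sigma> + 1 / p = 3 / 2" using p by (simp add: \<sigma>_def field_simps)
  have \<sigma>: "1 < \<sigma>" "\<sigma> < 2" using p by (auto simp: \<sigma>_def field_simps)
  obtain C0 where C0: "C0 > 0" "\<And>\<tau> z. \<tau> \<ge> 1 \<Longrightarrow> z \<noteq> 0 \<Longrightarrow>
    (\<integral>\<^sup>+\<zeta>. ennreal (kern \<tau> z \<zeta> powr \<sigma> * norm \<zeta> powr (-2)) \<partial>lborel) \<le> ennreal (C0 * \<tau> powr (- (2 - \<sigma>) / 2))"
    using kernel_schur[OF \<sigma>] by blast
  define \<kappa> where "\<kappa> = 2 * (\<integral>x. 1 / (1 + (norm x)\<^sup>2)\<^sup>2 \<partial>(lborel :: (real ^ 2) measure))"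
  have \<kappa>: "\<kappa> > 0" using cauchy_approx_mass_pos by (simp add: \<kappa>_def)
  \<comment> \<open>2 / \<kappa> combines the factor 2 of \<open>kernel_pointwise\<close> with the
    mass of the Cauchy kernel; sqrt 2 and the power of C0 come from Young's inequality.\<close>
  define C where "C = 2 / \<kappa> * sqrt 2 * C0 powr (1 / \<sigma>)"
  have C: "C > 0" using C0 \<kappa> by (simp add: C_def)
  define M where "M = density lborel (\<lambda>x. ennreal (polar_wt x))"
  have sM [measurable_cong, simp]: "sets M = sets borel" by (simp add: M_def)
  have sf: "sigma_finite_measure M"
    unfolding M_def by (subst sigma_finite_measure.sigma_finite_iff_density_finite[OF sigma_finite_lborel]) auto
  have nM: "(\<integral>\<^sup>+x. f x \<partial>M) = (\<integral>\<^sup>+x. ennreal (polar_wt x) * f x \<partial>lborel)" if "f \<in> borel_measurable borel" for f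
    unfolding M_def using that by (subst nn_integral_density) auto
  show ?thesis
  proof (intro exI[of _ C] conjI allI impI ballI C)
    fix \<tau> A :: real and U :: "real ^ 2 \<Rightarrow> complex"
    assume \<tau>: "\<tau> \<ge> 1" and U: "U \<in> test_functions punctured_disc" and A: "A > 0"
      and Ab: "(\<integral>\<^sup>+x. ennreal ((\<bar>lnr x\<bar> * wtE \<tau> x * norm x * norm (dbar U x)) powr p * polar_wt x) \<partial>lborel) \<le> ennreal (A powr p)"
    have [measurable]: "dbar U \<in> borel_measurable borel" "U \<in> borel_measurable borel"
      using compact_supp_measurable[OF compact_supp_dbar[OF U open_punctured_disc]] compact_supp_measurable[OF compact_supp_TF[OF U]] by auto
    define f where "f x = \<bar>lnr x\<bar> * wtE \<tau> x * norm x * norm (dbar U x)" for x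
    define W where "W x = inverse \<bar>lnr x\<bar> * wtE \<tau> x * norm (U x)" for x
    have f0: "f x \<ge> 0" for x by (simp add: f_def)
    have W0: "W x \<ge> 0" for x by (simp add: W_def)
    have [measurable]: "f \<in> borel_measurable borel" "W \<in> borel_measurable borel"
      unfolding f_def W_def phi_def by measurable
    define B where "B = C0 * \<tau> powr (- (2 - \<sigma>) / 2)"
    have B: "B > 0" using C0 \<tau> by (simp add: B_def)
    have k0: "kern \<tau> x y \<ge> 0" for x y using \<tau> by (intro kern_nonneg) simp
    have Bz: "(\<integral>\<^sup>+\<zeta>. ennreal (kern \<tau> z \<zeta> powr \<sigma>) \<partial>M) \<le> ennreal B" if "z \<noteq> 0" for z
      using C0(2)[OF \<tau> that] by (subst nM) (auto simp: B_def ennreal_mult' mult.commute)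
    \<comment> \<open>The kernel bound holds off the origin only, which is a null set for M. By
      symmetry of \<open>kern\<close> one bound serves both variables.\<close>
    have AE0: "AE z in M. z \<noteq> 0" unfolding M_def by (subst AE_density) auto
    have young: "(\<integral>\<^sup>+z. (\<integral>\<^sup>+\<zeta>. ennreal (kern \<tau> z \<zeta> * f \<zeta>) \<partial>M)\<^sup>2 \<partial>M) \<le> ennreal (2 * A\<^sup>2 * B powr (2 / \<sigma>))"
    proof (rule young_kernel_inequality[OF sf _ _ k0 f0 \<sigma> p \<sigma>p B _ _ A])
      show "(\<lambda>x. kern \<tau> (fst x) (snd x)) \<in> borel_measurable (M \<Otimes>\<^sub>M M)" by measurable
      show "AE z in M. (\<integral>\<^sup>+\<zeta>. ennreal (kern \<tau> z \<zeta> powr \<sigma>) \<partial>M) \<le> ennreal B"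
        using AE0 by (rule AE_mp) (auto intro: Bz)
      then show "AE \<zeta> in M. (\<integral>\<^sup>+z. ennreal (kern \<tau> z \<zeta> powr \<sigma>) \<partial>M) \<le> ennreal B"
        by (subst kern_commute)
      show "(\<integral>\<^sup>+\<zeta>. ennreal (f \<zeta> powr p) \<partial>M) \<le> ennreal (A powr p)"
      proof -
        have "(\<integral>\<^sup>+\<zeta>. ennreal (f \<zeta> powr p) \<partial>M) = (\<integral>\<^sup>+\<zeta>. ennreal (polar_wt \<zeta>) * ennreal (f \<zeta> powr p) \<partial>lborel)"
          by (rule nM) measurable
        also have "\<dots> = (\<integral>\<^sup>+\<zeta>. ennreal (f \<zeta> powr p * polar_wt \<zeta>) \<partial>lborel)"
          by (simp add: ennreal_mult' mult.commute)
        finally show ?thesis using Ab unfolding f_def by simp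
      qed
    qed simp
    have pw: "ennreal (\<kappa> / 2 * W z) \<le> (\<integral>\<^sup>+\<zeta>. ennreal (kern \<tau> z \<zeta> * f \<zeta>) \<partial>M)" for z
    proof (cases "z \<in> punctured_disc")
      case False
      then have "U z = 0" using U by (auto simp: test_functions_def intro: test_fun_zero_outside)
      then show ?thesis by (simp add: W_def)
    next
      case True
      define m where "m = \<lceil>\<tau> * (1 + 2 / lnr z)\<rceil>"
      have [measurable]: "(\<lambda>x :: real ^ 2. norm x powi (- m)) \<in> borel_measurable borel"
        unfolding power_int_def by measurable
      define c where "c = inverse \<bar>lnr z\<bar> * wtE \<tau> z * norm z powi m"
      have c: "c \<ge> 0" by (simp add: c_def)
      have z0: "z \<noteq> 0" using punctured_discD True by blast
      have "\<kappa> / 2 * W z = c / 2 * (\<kappa> * (norm (U z) * norm z powi (- m)))"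
        using z0 by (simp add: W_def c_def power_int_minus field_simps)
      then have "ennreal (\<kappa> / 2 * W z) = ennreal (c / 2) * ennreal (\<kappa> * (norm (U z) * norm z powi (- m)))"
        using c \<kappa> by (simp only: ennreal_mult' divide_nonneg_nonneg)
      also have "\<dots> \<le> ennreal (c / 2) * (\<integral>\<^sup>+\<zeta>. ennreal (norm (dbar U \<zeta>) * norm \<zeta> powi (- m) / norm (z - \<zeta>)) \<partial>lborel)"
        unfolding \<kappa>_def by (intro mult_left_mono cauchy_pompeiu_twisted[OF U open_punctured_disc]) (auto simp: punctured_disc_def)
      also have "\<dots> = (\<integral>\<^sup>+\<zeta>. ennreal (c / 2) * ennreal (norm (dbar U \<zeta>) * norm \<zeta> powi (- m) / norm (z - \<zeta>)) \<partial>lborel)"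
        by (rule nn_integral_cmult[symmetric]) measurable
      also have "\<dots> \<le> (\<integral>\<^sup>+\<zeta>. ennreal (polar_wt \<zeta>) * ennreal (kern \<tau> z \<zeta> * f \<zeta>) \<partial>lborel)"
      proof (intro nn_integral_mono)
        fix \<zeta>
        have "c / 2 * (norm (dbar U \<zeta>) * norm \<zeta> powi (- m) / norm (z - \<zeta>)) \<le> polar_wt \<zeta> * (kern \<tau> z \<zeta> * f \<zeta>)"
        proof (cases "\<zeta> \<in> punctured_disc")
          case False
          then show ?thesis using dbar_zero_outside[OF U] by (simp add: f_def)
        next
          case \<zeta>: True
          from kernel_pointwise[OF True this \<tau> m_def]
          have "c * (norm \<zeta> powi (- m) / norm (z - \<zeta>)) \<le> 2 * kern \<tau> z \<zeta> * (\<bar>lnr \<zeta>\<bar> * wtE \<tau> \<zeta> * norm \<zeta>) * polar_wt \<zeta>"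
            unfolding c_def .
          from mult_right_mono[OF this, of "norm (dbar U \<zeta>) / 2"] show ?thesis
            by (simp add: f_def mult_ac)
        qed
        then show "ennreal (c / 2) * ennreal (norm (dbar U \<zeta>) * norm \<zeta> powi (- m) / norm (z - \<zeta>)) \<le> ennreal (polar_wt \<zeta>) * ennreal (kern \<tau> z \<zeta> * f \<zeta>)"
          using c by (subst (1 2) ennreal_mult'[symmetric]) (auto intro: ennreal_leI)
      qed
      also have "\<dots> = (\<integral>\<^sup>+\<zeta>. ennreal (kern \<tau> z \<zeta> * f \<zeta>) \<partial>M)"
        by (rule nM[symmetric]) measurable
      finally show ?thesis .
    qed
    have "(\<integral>\<^sup>+x. ennreal ((W x)\<^sup>2 * polar_wt x) \<partial>lborel) = (\<integral>\<^sup>+x. ennreal ((W x)\<^sup>2) \<partial>M)"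
      by (subst nM) (auto simp: ennreal_mult' mult.commute)
    also have "\<dots> \<le> (\<integral>\<^sup>+z. ennreal ((2 / \<kappa>)\<^sup>2) * (\<integral>\<^sup>+\<zeta>. ennreal (kern \<tau> z \<zeta> * f \<zeta>) \<partial>M)\<^sup>2 \<partial>M)"
    proof (intro nn_integral_mono)
      fix z
      have "W z = 2 / \<kappa> * (\<kappa> / 2 * W z)" using \<kappa> by simp
      then have "ennreal ((W z)\<^sup>2) = ennreal ((2 / \<kappa>)\<^sup>2 * (\<kappa> / 2 * W z)\<^sup>2)" by (metis power_mult_distrib)
      also have "\<dots> = ennreal ((2 / \<kappa>)\<^sup>2) * (ennreal (\<kappa> / 2 * W z))\<^sup>2"
        using \<kappa> W0[of z] by (subst ennreal_mult) (simp_all only: ennreal_power mult_nonneg_nonneg divide_nonneg_nonneg zero_le_power2 order.strict_implies_order zero_le_numeral)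
      also have "\<dots> \<le> ennreal ((2 / \<kappa>)\<^sup>2) * (\<integral>\<^sup>+\<zeta>. ennreal (kern \<tau> z \<zeta> * f \<zeta>) \<partial>M)\<^sup>2"
        by (intro mult_left_mono power_mono pw) auto
      finally show "ennreal ((W z)\<^sup>2) \<le> ennreal ((2 / \<kappa>)\<^sup>2) * (\<integral>\<^sup>+\<zeta>. ennreal (kern \<tau> z \<zeta> * f \<zeta>) \<partial>M)\<^sup>2" .
    qed
    also have "\<dots> = ennreal ((2 / \<kappa>)\<^sup>2) * (\<integral>\<^sup>+z. (\<integral>\<^sup>+\<zeta>. ennreal (kern \<tau> z \<zeta> * f \<zeta>) \<partial>M)\<^sup>2 \<partial>M)"
    proof (rule nn_integral_cmult)
      interpret sigma_finite_measure M by (rule sf)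
      show "(\<lambda>z. (\<integral>\<^sup>+\<zeta>. ennreal (kern \<tau> z \<zeta> * f \<zeta>) \<partial>M)\<^sup>2) \<in> borel_measurable M" by measurable
    qed
    also have "\<dots> \<le> ennreal ((2 / \<kappa>)\<^sup>2) * ennreal (2 * A\<^sup>2 * B powr (2 / \<sigma>))" by (intro mult_left_mono young) auto
    also have "\<dots> = ennreal ((2 / \<kappa>)\<^sup>2 * (2 * A\<^sup>2 * B powr (2 / \<sigma>)))" by (rule ennreal_mult'[symmetric]) simp
    also have "(2 / \<kappa>)\<^sup>2 * (2 * A\<^sup>2 * B powr (2 / \<sigma>)) = (C * \<tau> powr (- (1 - 1 / p)) * A)\<^sup>2"
    proof -
      have "B powr (1 / \<sigma>) = C0 powr (1 / \<sigma>) * \<tau> powr (- (2 - \<sigma>) / 2 * (1 / \<sigma>))"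
        using C0 \<tau> by (simp add: B_def powr_mult powr_powr)
      also have "- (2 - \<sigma>) / 2 * (1 / \<sigma>) = 1 / 2 - 1 / \<sigma>" using \<sigma> by (simp add: field_simps)
      \<comment> \<open>Here the exponent of \<tau> becomes the one in the theorem.\<close>
      also have "1 / 2 - 1 / \<sigma> = - (1 - 1 / p)" using \<sigma>p by linarith
      finally have 1: "B powr (1 / \<sigma>) = C0 powr (1 / \<sigma>) * \<tau> powr (- (1 - 1 / p))" .
      have "B powr (2 / \<sigma>) = (B powr (1 / \<sigma>))\<^sup>2" by (simp add: power2_eq_square flip: powr_add)
      then show ?thesis unfolding 1 C_def by (simp add: power_mult_distrib power_divide)
    qed
    finally show "(\<integral>\<^sup>+x. ennreal ((inverse \<bar>lnr x\<bar> * wtE \<tau> x * norm (U x))\<^sup>2 * polar_wt x) \<partial>lborel) \<le> ennreal ((C * \<tau> powr (- (1 - 1 / p)) * A)\<^sup>2)"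
      unfolding W_def .
  qed
qed

subsection \<open>Integral identities\<close>

lemma test_fun_vanish:
  assumes u: "u \<in> test_functions \<Omega>" and x: "x \<notin> closure {x. u x \<noteq> 0}"
  shows "u x = 0" "partial_deriv i u x = 0" "partial_deriv i (partial_deriv j u) x = 0"
proof -
  let ?K = "closure {x. u x \<noteq> 0}"
  have 1: "partial_deriv i u y = 0" if "y \<notin> ?K" for i y
    by (rule partial_deriv_eqI[OF has_pd_zero_outside[OF that]])
  have "has_pd i (partial_deriv j u) 0 x"
    by (rule has_pd_cong_open[OF has_pd_const, of "- ?K"]) (use x 1 in auto)
  then show "partial_deriv i (partial_deriv j u) x = 0" by (rule partial_deriv_eqI)
  show "u x = 0" using x by (rule test_fun_zero_outside)
  show "partial_deriv i u x = 0" by (rule 1[OF x])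
qed

lemma has_pd_extend:
  assumes K: "compact K" "K \<subseteq> \<Omega>" and pd: "\<And>x. x \<in> \<Omega> \<Longrightarrow> has_pd i f (f' x) x"
    and z: "\<And>x. x \<notin> K \<Longrightarrow> f x = 0" "\<And>x. x \<notin> K \<Longrightarrow> f' x = 0"
  shows "has_pd i f (f' x) x"
proof (cases "x \<in> K")
  case False
  have "has_pd i f 0 x"
    by (rule has_pd_cong_open[OF has_pd_const, of "- K"]) (use False z K in \<open>auto intro: compact_imp_closed\<close>)
  then show ?thesis using z(2)[OF False] by simp
qed (use pd K in auto)

text \<open>The form of the divergence theorem needed for singular weights: differentiability is
  checked on \<Omega> only, and vanishing off the support of u supplies the rest.\<close>

lemma integral_partial_deriv_weighted:
  fixes f :: "real ^ 'n::finite \<Rightarrow> real"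
  assumes u: "u \<in> test_functions \<Omega>" and \<Omega>: "open \<Omega>"
    and f: "continuous_on \<Omega> f" and f': "continuous_on \<Omega> f'"
    and pd: "\<And>x. x \<in> \<Omega> \<Longrightarrow> has_pd i f (f' x) x"
    and z: "\<And>x. x \<notin> closure {x. u x \<noteq> 0} \<Longrightarrow> f x = 0" "\<And>x. x \<notin> closure {x. u x \<noteq> 0} \<Longrightarrow> f' x = 0"
  shows "compact_supp \<Omega> f'" "(\<integral>x. f' x \<partial>lborel) = 0"
proof -
  let ?K = "closure {x. u x \<noteq> 0}"
  have K: "compact ?K" "?K \<subseteq> \<Omega>" using u by (auto simp: test_functions_def)
  show cc': "compact_supp \<Omega> f'" by (rule ccI[OF K z(2) \<Omega> f'])
  have "has_pd i f (f' x) x" for x by (rule has_pd_extend[OF K pd z])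
  from integral_partial_deriv_eq_0[OF ccI[OF K z(1) \<Omega> f] cc' this] show "(\<integral>x. f' x \<partial>lborel) = 0" by simp
qed

section \<open>Derivatives and continuity of the weights\<close>

definition wtS :: "real \<Rightarrow> real ^ 2 \<Rightarrow> real" where "wtS \<tau> x = exp (- 2 * \<tau> * phi (norm x))"

lemma wtS_eq: "wtS \<tau> x = (wtE \<tau> x)\<^sup>2"
  by (simp add: wtS_def power2_eq_square flip: exp_add)

text \<open>The density r^-2 in a form whose partial derivatives are polynomials in the coordinates
  and \<open>irs\<close> itself, as suits \<open>algebra_simps\<close>. It agrees with
  \<open>polar_wt\<close> even at the origin, where both are 0.\<close>

definition irs :: "real ^ 2 \<Rightarrow> real" where "irs x = inverse ((x $ 1)\<^sup>2 + (x $ 2)\<^sup>2)"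

lemma irs_eq: "irs x = inverse ((norm x)\<^sup>2)"
  by (simp add: irs_def norm_real2)

lemma has_pd_irs:
  assumes "x \<noteq> 0" shows "has_pd i irs (- 2 * x $ i * (irs x)\<^sup>2) x"
proof -
  have i: "i = 1 \<or> i = 2" by (rule exhaust_2)
  have eq: "irs = (\<lambda>x. inverse (x $ 1 * x $ 1 + x $ 2 * x $ 2))" by (simp add: irs_def[abs_def] power2_eq_square)
  have pos: "x $ 1 * x $ 1 + x $ 2 * x $ 2 \<noteq> 0"
    using assms by (auto simp: vec_eq_iff forall_2 sum_squares_eq_zero_iff)
  have "has_pd i (\<lambda>x. x $ 1 * x $ 1 + x $ 2 * x $ 2) (2 * x $ i) x"
    by (rule has_pd_eqI, (rule pd_intros)+) (use i in auto)
  note h = has_pd_chain[OF DERIV_inverse[OF pos] this]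
  show ?thesis unfolding eq by (rule has_pd_eqI[OF h]) (simp add: power2_eq_square)
qed

lemma has_pd_inverse_lnr:
  assumes "x \<noteq> 0" "lnr x \<noteq> 0" shows "has_pd i (\<lambda>x. inverse (lnr x)) (- (inverse (lnr x))\<^sup>2 * (x $ i * irs x)) x"
  using has_pd_chain[OF DERIV_inverse[OF assms(2)] has_pd_ln_norm[OF assms(1), of i]]
  by (simp add: irs_eq divide_inverse power2_eq_square numeral_2_eq_2 power_inverse)

lemma punctured_disc_lnr_neq: "x \<in> punctured_disc \<Longrightarrow> lnr x \<noteq> 0"
  using punctured_discD(2)[of x] by linarith

lemma has_pd_wtS:
  assumes "x \<noteq> 0" "lnr x \<noteq> 0"
  shows "has_pd i (wtS \<tau>) (- 2 * \<tau> * (1 + 2 * inverse (lnr x)) * (x $ i * irs x) * wtS \<tau> x) x"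
proof -
  have "((\<lambda>t. exp (- 2 * \<tau> * (t + ln (t\<^sup>2)))) has_real_derivative
    - 2 * \<tau> * (1 + 2 * inverse (lnr x)) * exp (- 2 * \<tau> * (lnr x + ln ((lnr x)\<^sup>2)))) (at (lnr x))"
  proof -
    have "0 < lnr x * lnr x" using assms(2) by (auto simp: zero_less_mult_iff linorder_neq_iff)
    then show ?thesis using assms(2) by (auto intro!: derivative_eq_intros simp: field_simps power2_eq_square)
  qed
  from has_pd_chain[OF this has_pd_ln_norm[OF assms(1), of i]]
  show ?thesis unfolding wtS_def[abs_def] phi_def
    by (rule has_pd_eqI) (simp add: irs_eq divide_inverse)
qed

lemma continuous_on_weights [continuous_intros]:
  "continuous_on punctured_disc (\<lambda>x. inverse (lnr x))" "continuous_on punctured_disc irs" "continuous_on punctured_disc (wtS \<tau>)" "continuous_on punctured_disc lnr"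
  "continuous_on punctured_disc (wtE \<tau>)" "continuous_on punctured_disc polar_wt" "continuous_on punctured_disc (\<lambda>x. phi (norm x))"
proof -
  have 1: "\<forall>x\<in>punctured_disc. norm x \<noteq> 0" "\<forall>x\<in>punctured_disc. lnr x \<noteq> 0" "\<forall>x\<in>punctured_disc. (lnr x)\<^sup>2 \<noteq> 0" using punctured_discD by fastforce+
  show l: "continuous_on punctured_disc lnr" by (intro continuous_intros 1)
  show "continuous_on punctured_disc (\<lambda>x. inverse (lnr x))" by (intro continuous_intros l 1)
  show "continuous_on punctured_disc irs" unfolding irs_eq[abs_def] using 1 by (auto intro!: continuous_intros)
  show 2: "continuous_on punctured_disc (\<lambda>x. phi (norm x))" unfolding phi_def by (intro continuous_intros l 1)
  show "continuous_on punctured_disc (wtS \<tau>)" "continuous_on punctured_disc (wtE \<tau>)" unfolding wtS_def[abs_def] by (intro continuous_intros 2)+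
  show "continuous_on punctured_disc polar_wt" using 1 by (intro continuous_intros) auto
qed

lemma irs_sq: "x \<noteq> 0 \<Longrightarrow> ((x $ 1)\<^sup>2 + (x $ 2)\<^sup>2) * irs x = 1"
proof -
  assume "x \<noteq> 0"
  moreover have "(x $ 1)\<^sup>2 + (x $ 2)\<^sup>2 = (norm x)\<^sup>2" by (simp add: norm_real2)
  ultimately show ?thesis unfolding irs_eq by simp
qed

lemma polar_wt_eq_irs: "polar_wt x = irs x"
  by (cases "x = 0") (auto simp: irs_eq powr_minus)

lemma test_fun_continuous:
  assumes "u \<in> test_functions \<Omega>"
  shows "continuous_on S u" "continuous_on S (partial_deriv i u)" "continuous_on S (partial_deriv i (partial_deriv j u))"
  using compact_supp_continuous compact_supp_TF assms test_fun_partial_deriv by blast+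

text \<open>With \<open>w = exp (- \<psi>) U\<close>, the function \<open>exp (- \<psi>) dbar U\<close> is \<open>P + Q\<close>, where \<open>P = w\<^sub>x + \<i> \<psi>\<^sub>y w\<close> is skew-adjoint and
  \<open>Q = \<psi>\<^sub>x w + \<i> w\<^sub>y\<close> is self-adjoint. The identity is \<open>|P + Q|\<^sup>2 = |P - Q|\<^sup>2 + 4 Re (P cnj Q)\<close>, with the last term written as
  a divergence plus the commutator term. Here \<open>S = exp (- 2 \<psi>)\<close> and \<open>U = a + \<i> b\<close>.\<close>

lemma energy_identity:
  fixes a b a1 b1 a2 b2 a11 b11 a12 b12 \<psi>1 \<psi>2 \<psi>11 \<psi>22 S L :: real
  assumes L: "\<psi>11 + \<psi>22 = - L"
  shows "S * ((a1 - b2)\<^sup>2 + (b1 + a2)\<^sup>2) =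
    2 * L * S * (a\<^sup>2 + b\<^sup>2)
    + (2 * (\<psi>11 * S + \<psi>1 * (- 2 * \<psi>1 * S)) * (a\<^sup>2 + b\<^sup>2) + 2 * \<psi>1 * S * (2 * (a * a1 + b * b1))
       + 2 * (- 2 * \<psi>1 * S) * (b * a2 - a * b2) + 2 * S * (b1 * a2 + b * a12 - (a1 * b2 + a * b12)))
    + (2 * (\<psi>22 * S + \<psi>2 * (- 2 * \<psi>2 * S)) * (a\<^sup>2 + b\<^sup>2) + 2 * \<psi>2 * S * (2 * (a * a2 + b * b2))
       - 2 * (- 2 * \<psi>2 * S) * (b * a1 - a * b1) - 2 * S * (b2 * a1 + b * a12 - (a2 * b1 + a * b12)))
    + S * ((a1 + b2 - 2 * (\<psi>1 * a + \<psi>2 * b))\<^sup>2 + (b1 - a2 - 2 * (\<psi>1 * b - \<psi>2 * a))\<^sup>2)"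
proof -
  have *: "\<psi>22 = - L - \<psi>11" using L by simp
  show ?thesis unfolding * by (simp add: power2_eq_square algebra_simps)
qed

lemma has_pd_norm_sq:
  assumes "has_pd i u D x"
  shows "has_pd i (\<lambda>x. (Re (u x))\<^sup>2 + (Im (u x))\<^sup>2) (2 * (Re (u x) * Re D + Im (u x) * Im D)) x"
proof -
  have "has_pd i (\<lambda>x. Re (u x) * Re (u x) + Im (u x) * Im (u x)) (2 * (Re (u x) * Re D + Im (u x) * Im D)) x"
    by (rule has_pd_eqI, (rule pd_intros assms)+) simp
  then show ?thesis by (simp add: power2_eq_square)
qed

text \<open>The case \<open>p = 2\<close>, where the kernel bound would lose a logarithm of \<open>\<tau>\<close>.\<close>

lemma core_estimate_energy:
  assumes \<tau>: "\<tau> \<ge> 1" and U: "U \<in> test_functions punctured_disc"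
  shows "4 * \<tau> * (\<integral>x. (inverse (lnr x))\<^sup>2 * irs x * wtS \<tau> x * (norm (U x))\<^sup>2 \<partial>lborel)
    \<le> (\<integral>x. wtS \<tau> x * (norm (dbar U x))\<^sup>2 \<partial>lborel)"
proof -
  define L where "L x = inverse (lnr x)" for x :: "real ^ 2"
  \<comment> \<open>\<open>\<psi> i\<close> and \<open>\<psi>' i\<close> are the first and the
    unmixed second partial derivatives of \<tau> times \<open>phi (norm x)\<close>.\<close>
  define \<psi> where "\<psi> i x = \<tau> * (1 + 2 * L x) * (x $ i * irs x)" for i x
  define \<psi>' where "\<psi>' i x = \<tau> * (1 + 2 * L x) * (irs x - 2 * x $ i * x $ i * (irs x)\<^sup>2)
     - 2 * \<tau> * (L x)\<^sup>2 * (x $ i * irs x) * (x $ i * irs x)" for i x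
  define S where "S = wtS \<tau>"
  define a where "a x = Re (U x)" for x
  define b where "b x = Im (U x)" for x
  define a' where "a' i x = Re (partial_deriv i U x)" for i x
  define b' where "b' i x = Im (partial_deriv i U x)" for i x
  define aa where "aa x = Re (partial_deriv 1 (partial_deriv 2 U) x)" for x
  define bb where "bb x = Im (partial_deriv 1 (partial_deriv 2 U) x)" for x
  note defs = L_def \<psi>_def \<psi>'_def S_def a_def b_def a'_def b'_def aa_def bb_def
  have Ui: "partial_deriv i U \<in> test_functions punctured_disc" for i by (rule test_fun_partial_deriv[OF U])
  have pL: "has_pd i L (- (L x)\<^sup>2 * (x $ i * irs x)) x" if "x \<in> punctured_disc" for i x
    using has_pd_inverse_lnr[OF punctured_discD(1)[OF that] punctured_disc_lnr_neq[OF that], of i] unfolding L_def[abs_def] .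
  have p\<psi>: "has_pd i (\<psi> i) (\<psi>' i x) x" if "x \<in> punctured_disc" for i x
    unfolding \<psi>_def[abs_def] \<psi>'_def
    by (rule has_pd_eqI, (rule pd_intros pL[OF that] has_pd_irs punctured_discD(1)[OF that])+) (simp add: algebra_simps power2_eq_square)
  have pS: "has_pd i S (- 2 * \<psi> i x * S x) x" if "x \<in> punctured_disc" for i x
    unfolding S_def \<psi>_def L_def
    by (rule has_pd_eqI[OF has_pd_wtS[OF punctured_discD(1)[OF that] punctured_disc_lnr_neq[OF that]]]) (simp add: algebra_simps)
  have pa: "has_pd i a (a' i x) x" "has_pd i b (b' i x) x" for i x
    unfolding defs[abs_def] by (intro has_pd_Re has_pd_Im test_fun_has_pd[OF U])+
  have mix: "partial_deriv 2 (partial_deriv 1 U) x = partial_deriv 1 (partial_deriv 2 U) x" for x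
    by (rule mixed_partials_eq[OF test_fun_C_k[OF U]])
  have paa: "has_pd 1 (a' 2) (aa x) x" "has_pd 1 (b' 2) (bb x) x" "has_pd 2 (a' 1) (aa x) x" "has_pd 2 (b' 1) (bb x) x" for x
    unfolding defs[abs_def] using has_pd_Re has_pd_Im test_fun_has_pd[OF Ui] mix by metis+
  \<comment> \<open>The vector field (\<open>X1\<close>, \<open>X2\<close>) has divergence
    \<open>Y1\<close> + \<open>Y2\<close>, the two bracketed groups of
    \<open>energy_identity\<close>. The second derivatives of U cancel in the sum because mixed
    partials agree.\<close>
  define X1 where "X1 x = 2 * (\<psi> 1 x * S x) * ((a x)\<^sup>2 + (b x)\<^sup>2) + 2 * S x * (b x * a' 2 x - a x * b' 2 x)" for x
  define X2 where "X2 x = 2 * (\<psi> 2 x * S x) * ((a x)\<^sup>2 + (b x)\<^sup>2) - 2 * S x * (b x * a' 1 x - a x * b' 1 x)" for x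
  define Y1 where "Y1 x = 2 * (\<psi>' 1 x * S x + \<psi> 1 x * (- 2 * \<psi> 1 x * S x)) * ((a x)\<^sup>2 + (b x)\<^sup>2) + 2 * \<psi> 1 x * S x * (2 * (a x * a' 1 x + b x * b' 1 x))
       + 2 * (- 2 * \<psi> 1 x * S x) * (b x * a' 2 x - a x * b' 2 x) + 2 * S x * (b' 1 x * a' 2 x + b x * aa x - (a' 1 x * b' 2 x + a x * bb x))" for x
  define Y2 where "Y2 x = 2 * (\<psi>' 2 x * S x + \<psi> 2 x * (- 2 * \<psi> 2 x * S x)) * ((a x)\<^sup>2 + (b x)\<^sup>2) + 2 * \<psi> 2 x * S x * (2 * (a x * a' 2 x + b x * b' 2 x))
       - 2 * (- 2 * \<psi> 2 x * S x) * (b x * a' 1 x - a x * b' 1 x) - 2 * S x * (b' 2 x * a' 1 x + b x * aa x - (a' 2 x * b' 1 x + a x * bb x))" for x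
  have pN: "has_pd i (\<lambda>x. (a x)\<^sup>2 + (b x)\<^sup>2) (2 * (a x * a' i x + b x * b' i x)) x" for i x
    unfolding a_def b_def a'_def b'_def by (rule has_pd_norm_sq[OF test_fun_has_pd[OF U]])
  have pX1: "has_pd 1 X1 (Y1 x) x" if "x \<in> punctured_disc" for x
    unfolding X1_def[abs_def] Y1_def
    by (rule has_pd_eqI, (rule pN pd_intros p\<psi>[OF that] pS[OF that] pa paa)+) (simp add: algebra_simps)
  have pX2: "has_pd 2 X2 (Y2 x) x" if "x \<in> punctured_disc" for x
    unfolding X2_def[abs_def] Y2_def
    by (rule has_pd_eqI, (rule pN pd_intros p\<psi>[OF that] pS[OF that] pa paa)+) (simp add: algebra_simps)
  note cont = continuous_on_weights test_fun_continuous[OF U]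
  have cX: "continuous_on punctured_disc X1" "continuous_on punctured_disc X2" "continuous_on punctured_disc Y1" "continuous_on punctured_disc Y2"
  proof -
    have 1: "continuous_on punctured_disc L" "continuous_on punctured_disc S" "continuous_on punctured_disc irs" unfolding L_def[abs_def] S_def by (rule cont)+
    have 2: "continuous_on punctured_disc (\<psi> i)" "continuous_on punctured_disc (\<psi>' i)" for i
      unfolding \<psi>_def[abs_def] \<psi>'_def[abs_def] by (intro continuous_intros 1)+
    have 3: "continuous_on punctured_disc a" "continuous_on punctured_disc b" "continuous_on punctured_disc (a' i)" "continuous_on punctured_disc (b' i)"
      "continuous_on punctured_disc aa" "continuous_on punctured_disc bb" for i
      unfolding a_def[abs_def] b_def[abs_def] a'_def[abs_def] b'_def[abs_def] aa_def[abs_def] bb_def[abs_def]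
      by (intro continuous_on_Re continuous_on_Im cont)+
    show "continuous_on punctured_disc X1" "continuous_on punctured_disc X2" "continuous_on punctured_disc Y1" "continuous_on punctured_disc Y2"
      unfolding X1_def[abs_def] X2_def[abs_def] Y1_def[abs_def] Y2_def[abs_def]
      by (intro continuous_on_add continuous_on_diff continuous_on_mult continuous_on_power continuous_on_const continuous_on_minus 1 2 3)+
  qed
  have van: "a x = 0" "b x = 0" "a' i x = 0" "b' i x = 0" "aa x = 0" "bb x = 0" if "x \<notin> closure {x. U x \<noteq> 0}" for x i
    unfolding a_def b_def a'_def b'_def aa_def bb_def using test_fun_vanish[OF U that] by simp_all
  have I1: "compact_supp punctured_disc Y1" "(\<integral>x. Y1 x \<partial>lborel) = 0"
    by (rule integral_partial_deriv_weighted[OF U open_punctured_disc cX(1,3) pX1]; simp add: X1_def Y1_def van)+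
  have I2: "compact_supp punctured_disc Y2" "(\<integral>x. Y2 x \<partial>lborel) = 0"
    by (rule integral_partial_deriv_weighted[OF U open_punctured_disc cX(2,4) pX2]; simp add: X2_def Y2_def van)+
  define Z where "Z x = (L x)\<^sup>2 * irs x * S x * (norm (U x))\<^sup>2" for x
  have ccZ: "compact_supp punctured_disc Z"
    by (rule compact_supp_weight[OF compact_supp_TF[OF U] open_punctured_disc]) (auto simp: Z_def[abs_def] defs[abs_def] intro!: continuous_intros cont)
  have ccD: "compact_supp punctured_disc (\<lambda>x. S x * (norm (dbar U x))\<^sup>2)"
    by (rule compact_supp_weight[OF compact_supp_dbar[OF U open_punctured_disc] open_punctured_disc]) (auto simp: S_def intro!: continuous_intros cont compact_supp_continuous[OF compact_supp_dbar[OF U open_punctured_disc]])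
  have "4 * \<tau> * Z x + Y1 x + Y2 x \<le> S x * (norm (dbar U x))\<^sup>2" for x
  proof (cases "x \<in> punctured_disc")
    case False
    then have nx: "x \<notin> closure {x. U x \<noteq> 0}" using U by (auto simp: test_functions_def)
    show ?thesis using test_fun_vanish[OF U nx] by (simp add: Z_def Y1_def Y2_def van[OF nx] dbar_def)
  next
    case True
    \<comment> \<open>Since ln r is harmonic, only the second derivative of ln (t^2) survives in the
      Laplacian of the weight. Its negative sign is the positivity of the commutator.\<close>
    have "\<psi>' 1 x + \<psi>' 2 x = 2 * \<tau> * (1 + 2 * L x) * (irs x * (1 - ((x $ 1)\<^sup>2 + (x $ 2)\<^sup>2) * irs x))
      - 2 * \<tau> * (L x)\<^sup>2 * irs x * (((x $ 1)\<^sup>2 + (x $ 2)\<^sup>2) * irs x)"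
      by (simp add: \<psi>'_def power2_eq_square algebra_simps)
    then have L: "\<psi>' 1 x + \<psi>' 2 x = - (2 * \<tau> * (L x)\<^sup>2 * irs x)"
      unfolding irs_sq[OF punctured_discD(1)[OF True]] by simp
    have "(norm (dbar U x))\<^sup>2 = (a' 1 x - b' 2 x)\<^sup>2 + (b' 1 x + a' 2 x)\<^sup>2"
      by (simp add: dbar_def cmod_power2 a'_def b'_def)
    moreover have "(norm (U x))\<^sup>2 = (a x)\<^sup>2 + (b x)\<^sup>2" by (simp add: cmod_power2 a_def b_def)
    moreover have "0 \<le> S x * ((a' 1 x + b' 2 x - 2 * (\<psi> 1 x * a x + \<psi> 2 x * b x))\<^sup>2 + (b' 1 x - a' 2 x - 2 * (\<psi> 1 x * b x - \<psi> 2 x * a x))\<^sup>2)"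
      by (simp add: S_def wtS_def)
    ultimately show ?thesis
      using energy_identity[OF L, of "S x" "a' 1 x" "b' 2 x" "b' 1 x" "a' 2 x" "a x" "b x" "\<psi> 1 x" "aa x" "bb x" "\<psi> 2 x"]
      unfolding Z_def Y1_def Y2_def by (simp add: mult_ac)
  qed
  then have "(\<integral>x. 4 * \<tau> * Z x + Y1 x + Y2 x \<partial>lborel) \<le> (\<integral>x. S x * (norm (dbar U x))\<^sup>2 \<partial>lborel)"
    by (intro integral_mono Bochner_Integration.integrable_add integrable_mult_right compact_supp_integrable[OF ccZ] compact_supp_integrable[OF I1(1)] compact_supp_integrable[OF I2(1)] compact_supp_integrable[OF ccD])
  also have "(\<integral>x. 4 * \<tau> * Z x + Y1 x + Y2 x \<partial>lborel) = 4 * \<tau> * (\<integral>x. Z x \<partial>lborel)"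
    using I1 I2 compact_supp_integrable[OF ccZ] compact_supp_integrable[OF I1(1)] compact_supp_integrable[OF I2(1)] by simp
  finally show ?thesis unfolding Z_def L_def S_def .
qed

text \<open>A Hardy-type argument: integrate the divergence of x / |x|^2 times (ln r)^-2 exp (- 2
  \<tau> phi) |u|^2. In the plane x / |x|^2 is divergence-free, so the derivative falls on the
  weight, which yields a multiple of \<tau> |u|^2, and on |u|^2, which yields a radial derivative to
  be absorbed.\<close>

lemma zero_order_estimate:
  fixes u :: "real ^ 2 \<Rightarrow> complex"
  assumes \<tau>: "\<tau> \<ge> 1" and u: "u \<in> test_functions punctured_disc"
  shows "\<tau>\<^sup>2 * (\<integral>x. (inverse (lnr x))\<^sup>2 * irs x * wtS \<tau> x * (norm (u x))\<^sup>2 \<partial>lborel)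
    \<le> 4 * (\<integral>x. (inverse (lnr x))\<^sup>2 * wtS \<tau> x * ((norm (partial_deriv 1 u x))\<^sup>2 + (norm (partial_deriv 2 u x))\<^sup>2) \<partial>lborel)"
proof -
  define L where "L x = inverse (lnr x)" for x :: "real ^ 2"
  define S where "S = wtS \<tau>"
  define a where "a x = Re (u x)" for x
  define b where "b x = Im (u x)" for x
  define a' where "a' i x = Re (partial_deriv i u x)" for i x
  define b' where "b' i x = Im (partial_deriv i u x)" for i x
  define N where "N x = (a x)\<^sup>2 + (b x)\<^sup>2" for x
  note defs = L_def S_def a_def b_def a'_def b'_def
  define X where "X i x = (x $ i * irs x) * ((L x)\<^sup>2 * S x * N x)" for i x
  define Y where "Y i x = (irs x - 2 * x $ i * x $ i * (irs x)\<^sup>2) * ((L x)\<^sup>2 * S x * N x)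
    + (x $ i * irs x) * ((- 2 * (L x) ^ 3 - 2 * \<tau> * (1 + 2 * L x) * (L x)\<^sup>2) * (x $ i * irs x) * S x * N x
       + (L x)\<^sup>2 * S x * (2 * (a x * a' i x + b x * b' i x)))" for i x
  have pL: "has_pd i (\<lambda>x. (L x)\<^sup>2) (- 2 * (L x) ^ 3 * (x $ i * irs x)) x" if "x \<in> punctured_disc" for i x
  proof -
    have "has_pd i L (- (L x)\<^sup>2 * (x $ i * irs x)) x"
      using has_pd_inverse_lnr[OF punctured_discD(1)[OF that] punctured_disc_lnr_neq[OF that], of i] unfolding L_def[abs_def] .
    from has_pd_mult[OF this this] show ?thesis by (simp add: power2_eq_square power3_eq_cube mult_ac)
  qed
  have pS: "has_pd i S (- 2 * \<tau> * (1 + 2 * L x) * (x $ i * irs x) * S x) x" if "x \<in> punctured_disc" for i x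
    using has_pd_wtS[OF punctured_discD(1)[OF that] punctured_disc_lnr_neq[OF that], of i \<tau>] unfolding S_def L_def by simp
  have pN: "has_pd i N (2 * (a x * a' i x + b x * b' i x)) x" for i x
    unfolding a_def b_def a'_def b'_def N_def[abs_def] by (rule has_pd_norm_sq[OF test_fun_has_pd[OF u]])
  have pX: "has_pd i (X i) (Y i x) x" if "x \<in> punctured_disc" for i x
    unfolding X_def[abs_def] Y_def
    by (rule has_pd_eqI, (rule pL[OF that] pd_intros pS[OF that] pN has_pd_irs punctured_discD(1)[OF that])+) (simp add: algebra_simps power2_eq_square)
  note cont = continuous_on_weights test_fun_continuous[OF u]
  have cX: "continuous_on punctured_disc (X i)" "continuous_on punctured_disc (Y i)" for i
  proof -
    have 1: "continuous_on punctured_disc L" "continuous_on punctured_disc S" "continuous_on punctured_disc irs" unfolding L_def[abs_def] S_def by (rule cont)+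
    have 3: "continuous_on punctured_disc a" "continuous_on punctured_disc b" "continuous_on punctured_disc (a' i)" "continuous_on punctured_disc (b' i)" for i
      unfolding a_def[abs_def] b_def[abs_def] a'_def[abs_def] b'_def[abs_def]
      by (intro continuous_on_Re continuous_on_Im cont)+
    have 4: "continuous_on punctured_disc N" unfolding N_def[abs_def] by (intro continuous_intros 3)
    have 5: "continuous_on punctured_disc (\<lambda>x. x $ i)" for i by (intro continuous_intros)
    show "continuous_on punctured_disc (X i)" "continuous_on punctured_disc (Y i)" for i
      unfolding X_def[abs_def] Y_def[abs_def]
      by (intro continuous_on_add continuous_on_diff continuous_on_mult continuous_on_power continuous_on_const continuous_on_minus 1 3 4 5)+
  qed
  have van: "a x = 0" "b x = 0" "a' i x = 0" "b' i x = 0" if "x \<notin> closure {x. u x \<noteq> 0}" for x i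
    unfolding a_def b_def a'_def b'_def using test_fun_vanish[OF u that] by simp_all
  have I: "compact_supp punctured_disc (Y i)" "(\<integral>x. Y i x \<partial>lborel) = 0" for i
    by (rule integral_partial_deriv_weighted[OF u open_punctured_disc cX pX]; simp add: X_def Y_def N_def van)+
  define Z where "Z x = (L x)\<^sup>2 * irs x * S x * (norm (u x))\<^sup>2" for x
  define G where "G x = (L x)\<^sup>2 * S x * ((norm (partial_deriv 1 u x))\<^sup>2 + (norm (partial_deriv 2 u x))\<^sup>2)" for x
  have ccZ: "compact_supp punctured_disc Z"
    by (rule compact_supp_weight[OF compact_supp_TF[OF u] open_punctured_disc]) (auto simp: Z_def[abs_def] defs[abs_def] intro!: continuous_intros cont)
  have ccG: "compact_supp punctured_disc G"
  proof (rule ccI[OF _ _ _ open_punctured_disc])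
    show "compact (closure {x. u x \<noteq> 0})" "closure {x. u x \<noteq> 0} \<subseteq> punctured_disc" using u by (auto simp: test_functions_def)
    show "G x = 0" if "x \<notin> closure {x. u x \<noteq> 0}" for x using test_fun_vanish[OF u that] by (simp add: G_def)
    show "continuous_on punctured_disc G" unfolding G_def[abs_def] L_def[abs_def] S_def by (intro continuous_intros cont)
  qed
  have main: "\<tau> / 2 * Z x + Y 1 x + Y 2 x \<le> 2 / \<tau> * G x" for x
  proof (cases "x \<in> punctured_disc")
    case False
    then have nx: "x \<notin> closure {x. u x \<noteq> 0}" using u by (auto simp: test_functions_def)
    show ?thesis using test_fun_vanish[OF u nx] by (simp add: Z_def Y_def N_def van[OF nx] G_def)
  next
    case True
    define w1 where "w1 = x $ 1 * a' 1 x + x $ 2 * a' 2 x"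
    define w2 where "w2 = x $ 1 * b' 1 x + x $ 2 * b' 2 x"
    define R where "R = (x $ 1)\<^sup>2 + (x $ 2)\<^sup>2"
    have R: "R * irs x = 1" "R \<ge> 0" unfolding R_def using irs_sq[OF punctured_discD(1)[OF True]] by auto
    have irs0: "irs x \<ge> 0" by (simp add: irs_def)
    define Q where "Q = (L x)\<^sup>2 * S x"
    have Q: "Q \<ge> 0" by (simp add: Q_def S_def wtS_def)
    have Nn: "N x \<ge> 0" by (simp add: N_def)
    \<comment> \<open>The first term vanishes by R irs = 1: this is the divergence of x /
      |x|^2.\<close>
    have "Y 1 x + Y 2 x = 2 * irs x * (1 - R * irs x) * (Q * N x)
      + Q * ((- 2 * L x - 2 * \<tau> * (1 + 2 * L x)) * irs x * (R * irs x) * N x + 2 * irs x * (a x * w1 + b x * w2))"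
      by (simp add: Y_def Q_def R_def w1_def w2_def algebra_simps power2_eq_square power3_eq_cube)
    then have Y: "Y 1 x + Y 2 x = Q * irs x * ((- 2 * L x - 2 * \<tau> * (1 + 2 * L x)) * N x + 2 * (a x * w1 + b x * w2))"
      unfolding R by (simp add: algebra_simps)
    \<comment> \<open>The source of the radius exp (-6): with L = - 1/6 and \<tau> = 1 the bound -
      \<tau> below holds with equality.\<close>
    have "- 1 / 6 \<le> L x" using punctured_discD(2)[OF True] by (simp add: L_def field_simps)
    then have "\<tau> * (- 1 / 6) \<le> \<tau> * L x" using \<tau> by (intro mult_left_mono) auto
    then have "- 2 * L x - 2 * \<tau> * (1 + 2 * L x) \<le> - \<tau>" using \<tau> \<open>- 1 / 6 \<le> L x\<close> by (simp add: algebra_simps)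
    then have 1: "(- 2 * L x - 2 * \<tau> * (1 + 2 * L x)) * N x \<le> - \<tau> * N x" using Nn by (rule mult_right_mono)
    \<comment> \<open>Weighted so that the cross term uses up only half of \<tau> N.\<close>
    have am: "2 * (c * d) \<le> \<tau> / 2 * c\<^sup>2 + 2 / \<tau> * d\<^sup>2" for c d :: real
    proof -
      have "0 \<le> (\<tau> * c - 2 * d)\<^sup>2" by simp
      then have "4 * \<tau> * (c * d) \<le> \<tau>\<^sup>2 * c\<^sup>2 + 4 * d\<^sup>2" by (simp add: power2_eq_square algebra_simps)
      then have "4 * \<tau> * (c * d) / (2 * \<tau>) \<le> (\<tau>\<^sup>2 * c\<^sup>2 + 4 * d\<^sup>2) / (2 * \<tau>)" using \<tau> by (intro divide_right_mono) auto
      then show ?thesis using \<tau> by (simp add: field_simps power2_eq_square)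
    qed
    have cs: "(x $ 1 * c + x $ 2 * d)\<^sup>2 \<le> R * (c\<^sup>2 + d\<^sup>2)" for c d
    proof -
      have "R * (c\<^sup>2 + d\<^sup>2) - (x $ 1 * c + x $ 2 * d)\<^sup>2 = (x $ 1 * d - x $ 2 * c)\<^sup>2"
        by (simp add: R_def power2_eq_square algebra_simps)
      then show ?thesis by (metis diff_ge_0_iff_ge zero_le_power2)
    qed
    have "2 * (a x * w1 + b x * w2) \<le> \<tau> / 2 * N x + 2 / \<tau> * (w1\<^sup>2 + w2\<^sup>2)"
      using am[of "a x" w1] am[of "b x" w2] by (simp add: N_def distrib_left)
    also have "w1\<^sup>2 + w2\<^sup>2 \<le> R * ((a' 1 x)\<^sup>2 + (a' 2 x)\<^sup>2) + R * ((b' 1 x)\<^sup>2 + (b' 2 x)\<^sup>2)"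
      unfolding w1_def w2_def by (intro add_mono cs)
    also have "\<dots> = R * ((norm (partial_deriv 1 u x))\<^sup>2 + (norm (partial_deriv 2 u x))\<^sup>2)"
      by (simp add: cmod_power2 a'_def b'_def algebra_simps)
    finally have 2: "2 * (a x * w1 + b x * w2) \<le> \<tau> / 2 * N x + 2 / \<tau> * (R * ((norm (partial_deriv 1 u x))\<^sup>2 + (norm (partial_deriv 2 u x))\<^sup>2))"
      using \<tau> by (simp add: mult_left_mono divide_right_mono)
    have "Y 1 x + Y 2 x \<le> Q * irs x * (- \<tau> * N x + (\<tau> / 2 * N x + 2 / \<tau> * (R * ((norm (partial_deriv 1 u x))\<^sup>2 + (norm (partial_deriv 2 u x))\<^sup>2))))"
      unfolding Y using 1 2 Q irs0 by (intro mult_left_mono add_mono) auto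
    also have "\<dots> = - (\<tau> / 2 * (Q * irs x * N x)) + 2 / \<tau> * (R * irs x) * (Q * ((norm (partial_deriv 1 u x))\<^sup>2 + (norm (partial_deriv 2 u x))\<^sup>2))"
      by (simp add: algebra_simps)
    also have "\<dots> = - (\<tau> / 2 * Z x) + 2 / \<tau> * G x"
      unfolding R by (simp add: Z_def G_def Q_def N_def a_def b_def cmod_power2 mult_ac)
    finally show ?thesis by simp
  qed
  then have "(\<integral>x. \<tau> / 2 * Z x + Y 1 x + Y 2 x \<partial>lborel) \<le> (\<integral>x. 2 / \<tau> * G x \<partial>lborel)"
    by (intro integral_mono Bochner_Integration.integrable_add integrable_mult_right compact_supp_integrable[OF ccZ] compact_supp_integrable[OF I(1)] compact_supp_integrable[OF ccG])
  moreover have "(\<integral>x. \<tau> / 2 * Z x + Y 1 x + Y 2 x \<partial>lborel) = \<tau> / 2 * (\<integral>x. Z x \<partial>lborel)"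
    using I compact_supp_integrable[OF ccZ] compact_supp_integrable[OF I(1)] by simp
  moreover have "(\<integral>x. 2 / \<tau> * G x \<partial>lborel) = 2 / \<tau> * (\<integral>x. G x \<partial>lborel)" by (rule integral_mult_right_zero)
  ultimately have "\<tau> / 2 * (\<integral>x. Z x \<partial>lborel) \<le> 2 / \<tau> * (\<integral>x. G x \<partial>lborel)" by simp
  then have "\<tau>\<^sup>2 * (\<integral>x. Z x \<partial>lborel) \<le> 4 * (\<integral>x. G x \<partial>lborel)"
    using \<tau> by (simp add: field_simps power2_eq_square)
  then show ?thesis unfolding Z_def G_def L_def S_def .
qed

subsection \<open>A Gagliardo--Nirenberg inequality\<close>

lemma abs_le_nn_integral_derivative:
  fixes F f :: "real \<Rightarrow> real"
  assumes F: "\<And>s. (F has_real_derivative f s) (at s)" and f: "continuous_on UNIV f"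
    and R: "\<And>s. s < - R \<Longrightarrow> F s = 0"
  shows "ennreal \<bar>F a\<bar> \<le> (\<integral>\<^sup>+s. ennreal \<bar>f s\<bar> \<partial>lborel)"
proof -
  define c where "c = min a (- R - 1)"
  have c: "c \<le> a" "F c = 0" using R by (auto simp: c_def)
  have hb: "has_bochner_integral lborel (\<lambda>x. indicator {c..a} x *\<^sub>R f x) (F a - F c)"
    by (rule has_bochner_integral_FTC_Icc[OF c(1)])
      (use F f in \<open>auto intro: continuous_on_subset has_vector_derivative_at_within simp: has_real_derivative_iff_has_vector_derivative\<close>)
  then have "ennreal \<bar>F a\<bar> = ennreal (norm (\<integral>x. indicator {c..a} x *\<^sub>R f x \<partial>lborel))"
    using c by (simp add: has_bochner_integral_integral_eq)
  also have "\<dots> \<le> (\<integral>\<^sup>+x. ennreal (norm (indicator {c..a} x *\<^sub>R f x)) \<partial>lborel)"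
    by (rule integral_norm_bound_ennreal[OF integrable.intros[OF hb]])
  also have "\<dots> \<le> (\<integral>\<^sup>+s. ennreal \<bar>f s\<bar> \<partial>lborel)"
    by (intro nn_integral_mono) (auto simp: indicator_def)
  finally show ?thesis .
qed

text \<open>Gagliardo's argument: |H (a, b)| is bounded by an integral along the horizontal line, a
  function of b alone, and by one along the vertical line, a function of a alone. The product
  separates under Tonelli.\<close>

lemma sobolev_W11:
  fixes H :: "real ^ 2 \<Rightarrow> real"
  assumes H: "compact_supp \<Omega> H" and H': "\<And>i. compact_supp \<Omega> (H' i)" and pd: "\<And>i x. has_pd i H (H' i x) x"
  shows "(\<integral>\<^sup>+x. ennreal ((H x)\<^sup>2) \<partial>lborel) \<le> (\<integral>\<^sup>+x. ennreal \<bar>H' 1 x\<bar> \<partial>lborel) * (\<integral>\<^sup>+x. ennreal \<bar>H' 2 x\<bar> \<partial>lborel)"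
proof -
  obtain R where R: "0 < R" "\<And>x. norm x > R \<Longrightarrow> H x = 0" by (rule compact_supp_outside_ball[OF H]) blast
  have [measurable]: "H \<in> borel_measurable borel" "H' i \<in> borel_measurable borel" for i
    using compact_supp_measurable H H' by auto
  have [measurable]: "mkv \<in> borel_measurable (borel \<Otimes>\<^sub>M borel)" using mkv_measurable by (simp add: borel_prod)
  define A where "A b = (\<integral>\<^sup>+s. ennreal \<bar>H' 1 (mkv (s, b))\<bar> \<partial>lborel)" for b
  define B where "B a = (\<integral>\<^sup>+s. ennreal \<bar>H' 2 (mkv (a, s))\<bar> \<partial>lborel)" for a
  have [measurable]: "A \<in> borel_measurable borel" "B \<in> borel_measurable borel"
    unfolding A_def[abs_def] B_def[abs_def] by measurable
  have cont: "continuous_on UNIV (\<lambda>s. H' i (f s))" if "continuous_on UNIV f" for i and f :: "real \<Rightarrow> real ^ 2"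
    using continuous_on_compose2[OF compact_supp_continuous[OF H', of UNIV i] that] by simp
  have nA: "\<bar>x $ 1\<bar> \<le> norm x" "\<bar>x $ 2\<bar> \<le> norm x" for x :: "real ^ 2" by (rule component_le_norm_cart)+
  have 1: "ennreal \<bar>H (mkv (a, b))\<bar> \<le> A b" for a b
  proof -
    define c where "c = mkv (0, b)"
    have m: "mkv (s, b) = c + s *\<^sub>R axis 1 1" for s by (simp add: mkv_eq c_def)
    show ?thesis unfolding A_def
    proof (rule abs_le_nn_integral_derivative[where F = "\<lambda>s. H (mkv (s, b))"])
      show "((\<lambda>s. H (mkv (s, b))) has_real_derivative H' 1 (mkv (s, b))) (at s)" for s
        unfolding m by (rule has_pd_has_real_derivative[OF pd])
      show "continuous_on UNIV (\<lambda>s. H' 1 (mkv (s, b)))" unfolding m by (intro cont continuous_intros)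
      show "H (mkv (s, b)) = 0" if "s < - R" for s using nA(1)[of "mkv (s, b)"] that by (intro R(2)) auto
    qed
  qed
  have 2: "ennreal \<bar>H (mkv (a, b))\<bar> \<le> B a" for a b
  proof -
    define c where "c = mkv (a, 0)"
    have m: "mkv (a, s) = c + s *\<^sub>R axis 2 1" for s by (simp add: mkv_eq c_def)
    show ?thesis unfolding B_def
    proof (rule abs_le_nn_integral_derivative[where F = "\<lambda>s. H (mkv (a, s))"])
      show "((\<lambda>s. H (mkv (a, s))) has_real_derivative H' 2 (mkv (a, s))) (at s)" for s
        unfolding m by (rule has_pd_has_real_derivative[OF pd])
      show "continuous_on UNIV (\<lambda>s. H' 2 (mkv (a, s)))" unfolding m by (intro cont continuous_intros)
      show "H (mkv (a, s)) = 0" if "s < - R" for s using nA(2)[of "mkv (a, s)"] that by (intro R(2)) auto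
    qed
  qed
  have "(\<integral>\<^sup>+x. ennreal ((H x)\<^sup>2) \<partial>lborel) = (\<integral>\<^sup>+a. \<integral>\<^sup>+b. ennreal ((H (mkv (a, b)))\<^sup>2) \<partial>lborel \<partial>lborel)"
    by (rule nn_integral_real2) measurable
  also have "\<dots> \<le> (\<integral>\<^sup>+a. \<integral>\<^sup>+b. B a * A b \<partial>lborel \<partial>lborel)"
  proof (intro nn_integral_mono)
    fix a b
    have "ennreal ((H (mkv (a, b)))\<^sup>2) = ennreal \<bar>H (mkv (a, b))\<bar> * ennreal \<bar>H (mkv (a, b))\<bar>"
      by (subst ennreal_mult[symmetric]) (auto simp: power2_eq_square abs_mult_self_eq)
    also have "\<dots> \<le> B a * A b" by (intro mult_mono 1 2) auto
    finally show "ennreal ((H (mkv (a, b)))\<^sup>2) \<le> B a * A b" .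
  qed
  also have "\<dots> = (\<integral>\<^sup>+a. B a \<partial>lborel) * (\<integral>\<^sup>+b. A b \<partial>lborel)"
    by (simp add: nn_integral_cmult nn_integral_multc)
  also have "(\<integral>\<^sup>+a. B a \<partial>lborel) = (\<integral>\<^sup>+x. ennreal \<bar>H' 2 x\<bar> \<partial>lborel)"
    unfolding B_def by (rule nn_integral_real2[symmetric]) measurable
  also have "(\<integral>\<^sup>+b. A b \<partial>lborel) = (\<integral>\<^sup>+x. ennreal \<bar>H' 1 x\<bar> \<partial>lborel)"
    unfolding A_def by (rule nn_integral_real2_swap[symmetric]) measurable
  finally show ?thesis by (simp add: mult.commute)
qed

text \<open>For y <= k the first summand dominates, for y > k the second. With k left free, this
  replaces Hoelder interpolation between moments.\<close>

lemma powr_interpolate: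
  fixes y k q Q :: real
  assumes y: "y \<ge> 0" and k: "k > 0" and q: "2 \<le> q" "q \<le> Q"
  shows "y powr q \<le> k powr (q - 2) * y powr 2 + k powr (q - Q) * y powr Q"
proof (cases "y = 0")
  case False
  then have y: "y > 0" using y by simp
  have e: "y powr q = (y / k) powr (q - 2) * (k powr (q - 2) * y powr 2)"
      "y powr q = (k / y) powr (Q - q) * (k powr (q - Q) * y powr Q)"
    using y k by (simp_all add: powr_divide powr_diff field_simps)
  show ?thesis
  proof (cases "y \<le> k")
    case True
    then have "(y / k) powr (q - 2) \<le> 1" using y k q by (intro powr_le1) auto
    then have "(y / k) powr (q - 2) * (k powr (q - 2) * y powr 2) \<le> 1 * (k powr (q - 2) * y powr 2)" by (intro mult_right_mono) auto
    then show ?thesis using e(1) by (simp add: add_increasing2)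
  next
    case False
    then have "(k / y) powr (Q - q) \<le> 1" using y k q by (intro powr_le1) auto
    then have "(k / y) powr (Q - q) * (k powr (q - Q) * y powr Q) \<le> 1 * (k powr (q - Q) * y powr Q)" by (intro mult_right_mono) auto
    then show ?thesis using e(2) by (simp add: add_increasing)
  qed
qed simp

lemma compact_supp_norm_powr:
  fixes F :: "real ^ 2 \<Rightarrow> 'b::real_normed_vector"
  assumes F: "compact_supp punctured_disc F" and a: "a > 0"
  shows "compact_supp punctured_disc (\<lambda>x. norm (F x) powr a * polar_wt x)"
  by (rule compact_supp_weight[OF F open_punctured_disc])
    (use a in \<open>auto intro!: continuous_intros continuous_on_powr' compact_supp_continuous[OF F] continuous_on_weights\<close>)

text \<open>The inequality \<open>sobolev_W11\<close> is applied to \<open>|V|\<^sup>2\<^sup>j / r\<close>, an even power being differentiable at the zeros of \<open>V\<close>.\<close>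

lemma moment_step:
  fixes V :: "real ^ 2 \<Rightarrow> complex" and j :: nat
  assumes V: "compact_supp punctured_disc V" and V': "\<And>i. compact_supp punctured_disc (V' i)" and pd: "\<And>i x. has_pd i V (V' i x) x" and j: "j \<ge> 1"
  shows "(\<integral>x. norm (V x) powr real (4 * j) * polar_wt x \<partial>lborel) \<le> 4 * (real j)\<^sup>2 *
    (\<integral>x. norm (V x) powr real (4 * j - 2) * polar_wt x \<partial>lborel) *
    (\<integral>x. (norm x * (norm (V' 1 x) + norm (V' 2 x)) + norm (V x))\<^sup>2 * polar_wt x \<partial>lborel)"
proof -
  obtain K where K: "compact K" "K \<subseteq> punctured_disc" "\<And>x. x \<notin> K \<Longrightarrow> V x = 0" using V by (auto simp: compact_supp_def)
  have V'0: "V' i x = 0" if "x \<notin> K" for i x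
  proof -
    have "has_pd i V 0 x"
      by (rule has_pd_cong_open[OF has_pd_const, of "- K"]) (use that K in \<open>auto intro: compact_imp_closed\<close>)
    with pd show ?thesis by (rule has_pd_unique)
  qed
  define a where "a x = Re (V x)" for x
  define b where "b x = Im (V x)" for x
  define N where "N x = (a x)\<^sup>2 + (b x)\<^sup>2" for x
  define N' where "N' i x = 2 * (a x * Re (V' i x) + b x * Im (V' i x))" for i x
  \<comment> \<open>The derivative of |V|^(2j) contributes r times the derivatives of V, that of 1 /
    r contributes |V|; together they form the scale-invariant gradient.\<close>
  define D where "D x = norm x * (norm (V' 1 x) + norm (V' 2 x)) + norm (V x)" for x
  \<comment> \<open>Chosen so that H^2 is |V|^(4j) r^-2, the integrand to be estimated.\<close>
  define H where "H x = N x ^ j * inverse (norm x)" for x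
  define H' where "H' i x = N x ^ j * (- (inverse (norm x))\<^sup>2 * (x $ i / norm x)) + (real j * N x ^ (j - 1) * N' i x) * inverse (norm x)" for i x
  have NV: "N x = (norm (V x))\<^sup>2" for x by (simp add: N_def a_def b_def cmod_power2)
  have pN: "has_pd i N (N' i x) x" for i x
    unfolding N_def[abs_def] N'_def a_def b_def by (rule has_pd_norm_sq[OF pd])
  have n0: "norm x \<noteq> 0" if "x \<in> punctured_disc" for x using punctured_discD(1)[OF that] by simp
  have pH: "has_pd i H (H' i x) x" if x: "x \<in> punctured_disc" for i x
  proof -
    have "((\<lambda>y. y ^ j) has_real_derivative real j * N x ^ (j - 1)) (at (N x))"
      by (auto intro!: derivative_eq_intros)
    from has_pd_chain[OF this pN] have 1: "has_pd i (\<lambda>x. N x ^ j) (real j * N x ^ (j - 1) * N' i x) x" .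
    have "has_pd i (\<lambda>x. inverse (norm x)) (- (inverse (norm x))\<^sup>2 * (x $ i / norm x)) x"
      using has_pd_chain[OF DERIV_inverse[OF n0[OF x]] has_pd_norm[OF punctured_discD(1)[OF x]]] by (simp add: numeral_2_eq_2)
    from has_pd_mult[OF 1 this] show ?thesis unfolding H_def[abs_def] H'_def .
  qed
  have cN: "continuous_on punctured_disc N" "continuous_on punctured_disc (N' i)" for i
    unfolding N_def[abs_def] N'_def[abs_def] a_def b_def
    by (intro continuous_intros compact_supp_continuous[OF V] compact_supp_continuous[OF V'])+
  have z: "N x = 0" "N' i x = 0" if "x \<notin> K" for x i using K(3)[OF that] V'0[OF that] by (simp_all add: N_def N'_def a_def b_def)
  have j0: "0 ^ j = (0 :: real)" using j by simp
  have ccH: "compact_supp punctured_disc H"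
  proof (rule ccI[OF K(1,2) _ open_punctured_disc])
    show "H x = 0" if "x \<notin> K" for x using z[OF that] j0 by (simp add: H_def)
    show "continuous_on punctured_disc H" unfolding H_def[abs_def] using n0 by (intro continuous_intros cN) auto
  qed
  have ccH': "compact_supp punctured_disc (H' i)" for i
  proof (rule ccI[OF K(1,2) _ open_punctured_disc])
    show "H' i x = 0" if "x \<notin> K" for x using z[OF that] j0 by (simp add: H'_def)
    show "continuous_on punctured_disc (H' i)" unfolding H'_def[abs_def] using n0 by (intro continuous_intros cN) auto
  qed
  have pH: "has_pd i H (H' i x) x" for i x
    by (rule has_pd_extend[OF K(1,2) pH]) (auto simp: H_def H'_def z j0)
  have ccD: "compact_supp punctured_disc D" unfolding D_def[abs_def]
  proof (rule ccI[OF K(1,2) _ open_punctured_disc])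
    show "norm x * (norm (V' 1 x) + norm (V' 2 x)) + norm (V x) = 0" if "x \<notin> K" for x using V'0[OF that] K(3)[OF that] by simp
    show "continuous_on punctured_disc (\<lambda>x. norm x * (norm (V' 1 x) + norm (V' 2 x)) + norm (V x))"
      by (intro continuous_intros compact_supp_continuous[OF V] compact_supp_continuous[OF V'])
  qed
  have D0: "D x \<ge> 0" for x by (simp add: D_def)
  have [measurable]: "V \<in> borel_measurable borel" "D \<in> borel_measurable borel" using compact_supp_measurable[OF V] compact_supp_measurable[OF ccD] by auto
  have bound: "\<bar>H' i x\<bar> \<le> 2 * real j * (norm (V x) ^ (2 * j - 1) * D x * polar_wt x)" for i x
  proof (cases "x \<in> punctured_disc")
    case False
    then have "x \<notin> K" using K by auto
    then have "H' i x = 0" using z[of x] j0 by (simp add: H'_def)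
    then show ?thesis using D0[of x] by (simp add: mult_nonneg_nonneg)
  next
    case True
    define v where "v = norm (V x)"
    define r where "r = norm x"
    have v: "v \<ge> 0" and r: "r > 0" using n0[OF True] by (auto simp: v_def r_def)
    have mwr: "polar_wt x = 1 / r\<^sup>2" using r by (simp add: r_def powr_minus_divide)
    have i: "norm (V' i x) \<le> norm (V' 1 x) + norm (V' 2 x)" using exhaust_2[of i] by auto
    have "\<bar>a x * Re (V' i x) + b x * Im (V' i x)\<bar> = \<bar>Re (V x * cnj (V' i x))\<bar>" by (simp add: a_def b_def)
    also have "\<dots> \<le> norm (V x * cnj (V' i x))" by (rule abs_Re_le_cmod)
    also have "\<dots> = v * norm (V' i x)" by (simp add: norm_mult v_def)
    finally have N': "\<bar>N' i x\<bar> \<le> 2 * (v * norm (V' i x))" by (simp add: N'_def)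
    have Nj: "N x ^ (j - 1) = v ^ (2 * j - 2)" "N x ^ j = v ^ (2 * j)"
      unfolding NV v_def by (simp_all add: power_mult[symmetric] diff_mult_distrib2)
    have v1: "v ^ (2 * j - 2) * v = v ^ (2 * j - 1)" "v ^ (2 * j) = v ^ (2 * j - 1) * v"
    proof -
      obtain l where "j = Suc l" using j by (cases j) auto
      then show "v ^ (2 * j - 2) * v = v ^ (2 * j - 1)" "v ^ (2 * j) = v ^ (2 * j - 1) * v" by simp_all
    qed
    have xi: "\<bar>x $ i\<bar> \<le> r" unfolding r_def by (rule component_le_norm_cart)
    have "\<bar>H' i x\<bar> \<le> \<bar>N x ^ j * (- (inverse r)\<^sup>2 * (x $ i / r))\<bar> + \<bar>(real j * N x ^ (j - 1) * N' i x) * inverse r\<bar>"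
      unfolding H'_def r_def by (rule abs_triangle_ineq)
    also have "\<bar>N x ^ j * (- (inverse r)\<^sup>2 * (x $ i / r))\<bar> = v ^ (2 * j) * (1 / r\<^sup>2) * (\<bar>x $ i\<bar> / r)"
      using v r by (simp add: Nj abs_mult divide_inverse power_inverse)
    also have "\<dots> \<le> v ^ (2 * j) * (1 / r\<^sup>2) * 1" using xi r v by (intro mult_left_mono) auto
    also have "\<bar>(real j * N x ^ (j - 1) * N' i x) * inverse r\<bar> = real j * v ^ (2 * j - 2) * inverse r * \<bar>N' i x\<bar>"
      unfolding Nj abs_mult using v r by simp
    also have "\<dots> \<le> real j * v ^ (2 * j - 2) * inverse r * (2 * (v * (norm (V' 1 x) + norm (V' 2 x))))"
      using v r N' i by (intro mult_left_mono order_trans[OF N']) (auto intro: mult_left_mono)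
    also have "real j * v ^ (2 * j - 2) * inverse r * (2 * (v * (norm (V' 1 x) + norm (V' 2 x))))
      = 2 * real j * (v ^ (2 * j - 2) * v) * (r * (norm (V' 1 x) + norm (V' 2 x))) * (1 / r\<^sup>2)"
      using r by (simp add: field_simps power2_eq_square)
    also have "v ^ (2 * j) * (1 / r\<^sup>2) * 1 \<le> 2 * real j * (v ^ (2 * j - 1) * v * (1 / r\<^sup>2))"
    proof -
      have "1 * (v ^ (2 * j - 1) * v * (1 / r\<^sup>2)) \<le> 2 * real j * (v ^ (2 * j - 1) * v * (1 / r\<^sup>2))"
        using j v by (intro mult_right_mono) auto
      then show ?thesis unfolding v1(2) by simp
    qed
    finally have "\<bar>H' i x\<bar> \<le> 2 * real j * (v ^ (2 * j - 1) * v * (1 / r\<^sup>2))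
      + 2 * real j * v ^ (2 * j - 1) * (r * (norm (V' 1 x) + norm (V' 2 x))) * (1 / r\<^sup>2)" unfolding v1(1) by simp
    also have "\<dots> = 2 * real j * (v ^ (2 * j - 1) * D x * (1 / r\<^sup>2))"
      by (simp add: D_def v_def r_def distrib_left distrib_right mult_ac add_divide_distrib)
    finally show ?thesis by (simp add: mwr v_def)
  qed
  define T where "T = (\<integral>\<^sup>+x. ennreal (norm (V x) ^ (2 * j - 1) * D x * polar_wt x) \<partial>lborel)"
  have T: "(\<integral>\<^sup>+x. ennreal \<bar>H' i x\<bar> \<partial>lborel) \<le> ennreal (2 * real j) * T" for i
  proof -
    have "(\<integral>\<^sup>+x. ennreal \<bar>H' i x\<bar> \<partial>lborel) \<le> (\<integral>\<^sup>+x. ennreal (2 * real j) * ennreal (norm (V x) ^ (2 * j - 1) * D x * polar_wt x) \<partial>lborel)"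
      by (intro nn_integral_mono) (use bound[of i] D0 in \<open>simp add: ennreal_mult[symmetric] ennreal_leI\<close>)
    also have "\<dots> = ennreal (2 * real j) * T" unfolding T_def by (rule nn_integral_cmult) measurable
    finally show ?thesis .
  qed
  define M1 where "M1 = (\<integral>x. norm (V x) powr real (4 * j) * polar_wt x \<partial>lborel)"
  define M2 where "M2 = (\<integral>x. norm (V x) powr real (4 * j - 2) * polar_wt x \<partial>lborel)"
  define M3 where "M3 = (\<integral>x. (D x)\<^sup>2 * polar_wt x \<partial>lborel)"
  have pos: "M1 \<ge> 0" "M2 \<ge> 0" "M3 \<ge> 0" unfolding M1_def M2_def M3_def by (auto intro!: Bochner_Integration.integral_nonneg)
  have pw: "y powr real k = y ^ k" if "y \<ge> 0" "k > 0" for y and k :: nat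
    using that by (cases "y = 0") (auto simp: powr_realpow)
  have "ennreal M1 = (\<integral>\<^sup>+x. ennreal (norm (V x) powr real (4 * j) * polar_wt x) \<partial>lborel)"
    unfolding M1_def using j by (intro nn_integral_eq_integral[symmetric] compact_supp_integrable[OF compact_supp_norm_powr[OF V]]) auto
  also have "\<dots> = (\<integral>\<^sup>+x. ennreal ((H x)\<^sup>2) \<partial>lborel)"
  proof (rule nn_integral_cong)
    fix x
    have "polar_wt x = (inverse (norm x))\<^sup>2" by (simp add: polar_wt_eq_irs irs_eq power_inverse)
    moreover have "norm (V x) powr real (4 * j) = (N x ^ j)\<^sup>2"
      using j by (subst pw) (auto simp: NV simp flip: power_mult)
    ultimately show "ennreal (norm (V x) powr real (4 * j) * polar_wt x) = ennreal ((H x)\<^sup>2)"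
      by (simp add: H_def power_mult_distrib)
  qed
  also have "\<dots> \<le> (\<integral>\<^sup>+x. ennreal \<bar>H' 1 x\<bar> \<partial>lborel) * (\<integral>\<^sup>+x. ennreal \<bar>H' 2 x\<bar> \<partial>lborel)"
    by (rule sobolev_W11[OF ccH ccH' pH])
  also have "\<dots> \<le> (ennreal (2 * real j) * T) * (ennreal (2 * real j) * T)" by (intro mult_mono T) auto
  also have "\<dots> = ennreal (4 * (real j)\<^sup>2) * T\<^sup>2"
  proof -
    have "ennreal (4 * (real j)\<^sup>2) = ennreal (2 * real j) * ennreal (2 * real j)"
      by (subst ennreal_mult[symmetric]) (auto simp: power2_eq_square)
    then show ?thesis by (simp add: power2_eq_square mult_ac)
  qed
  also have "T\<^sup>2 \<le> ennreal M2 * ennreal M3"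
  proof -
    \<comment> \<open>Splits r^-2 evenly between the two Cauchy-Schwarz factors, so that both
      integrals carry the same density.\<close>
    define s where "s x = norm x powr (- 1)" for x :: "real ^ 2"
    have ss: "s x * s x = polar_wt x" for x unfolding s_def powr_add[symmetric] by simp
    have [measurable]: "s \<in> borel_measurable borel" unfolding s_def by measurable
    have "T = (\<integral>\<^sup>+x. ennreal (norm (V x) ^ (2 * j - 1) * s x) * ennreal (D x * s x) \<partial>lborel)"
      unfolding T_def ss[symmetric] using D0 by (intro nn_integral_cong) (simp add: ennreal_mult[symmetric] s_def mult_ac)
    then have "T\<^sup>2 \<le> (\<integral>\<^sup>+x. (ennreal (norm (V x) ^ (2 * j - 1) * s x))\<^sup>2 \<partial>lborel) * (\<integral>\<^sup>+x. (ennreal (D x * s x))\<^sup>2 \<partial>lborel)"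
      using Cauchy_Schwarz_nn_integral[of "\<lambda>x. ennreal (norm (V x) ^ (2 * j - 1) * s x)" lborel "\<lambda>x. ennreal (D x * s x)"] by simp
    also have "(\<integral>\<^sup>+x. (ennreal (norm (V x) ^ (2 * j - 1) * s x))\<^sup>2 \<partial>lborel) = (\<integral>\<^sup>+x. ennreal (norm (V x) powr real (4 * j - 2) * polar_wt x) \<partial>lborel)"
    proof (rule nn_integral_cong)
      fix x
      have "(norm (V x) ^ (2 * j - 1))\<^sup>2 = norm (V x) powr real (4 * j - 2)"
      proof -
        have "norm (V x) powr real (4 * j - 2) = norm (V x) ^ (4 * j - 2)" using j by (intro pw) auto
        also have "norm (V x) ^ (4 * j - 2) = norm (V x) ^ ((2 * j - 1) * 2)"
          by (rule arg_cong[where f = "(^) (norm (V x))"]) arith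
        finally show ?thesis by (simp only: power_mult)
      qed
      then have "(norm (V x) ^ (2 * j - 1) * s x)\<^sup>2 = norm (V x) powr real (4 * j - 2) * polar_wt x"
        by (simp add: power_mult_distrib ss[symmetric] power2_eq_square[of "s x"])
      then show "(ennreal (norm (V x) ^ (2 * j - 1) * s x))\<^sup>2 = ennreal (norm (V x) powr real (4 * j - 2) * polar_wt x)"
        by (subst ennreal_power) (auto simp: s_def)
    qed
    also have "\<dots> = ennreal M2"
      unfolding M2_def using j by (intro nn_integral_eq_integral compact_supp_integrable[OF compact_supp_norm_powr[OF V]]) auto
    also have "(\<integral>\<^sup>+x. (ennreal (D x * s x))\<^sup>2 \<partial>lborel) = (\<integral>\<^sup>+x. ennreal ((D x)\<^sup>2 * polar_wt x) \<partial>lborel)"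
      using D0 by (intro nn_integral_cong) (subst ennreal_power; simp add: s_def power_mult_distrib ss[symmetric] power2_eq_square)
    also have "\<dots> = ennreal M3" unfolding M3_def
    proof (intro nn_integral_eq_integral)
      show "integrable lborel (\<lambda>x. (D x)\<^sup>2 * polar_wt x)"
        by (intro compact_supp_integrable[of punctured_disc] compact_supp_weight[OF ccD open_punctured_disc]) (auto intro!: continuous_intros compact_supp_continuous[OF ccD] continuous_on_weights)
    qed auto
    finally show ?thesis .
  qed
  also have "ennreal (4 * (real j)\<^sup>2) * (ennreal M2 * ennreal M3) = ennreal (4 * (real j)\<^sup>2 * M2 * M3)"
    using pos by (simp add: ennreal_mult mult.assoc)
  finally have "ennreal M1 \<le> ennreal (4 * (real j)\<^sup>2 * M2 * M3)" by (simp add: mult_left_mono)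
  then show ?thesis using pos unfolding M1_def M2_def M3_def D_def by (subst (asm) ennreal_le_iff) auto
qed

text \<open>\<open>moment_step\<close> bounds the moment of a high order Q by that of order Q - 2,
  which lies between those of orders 2 and Q. Interpolation brings back half of the Q-th moment, and
  absorbing it leaves the second moment only. A further interpolation reaches q.\<close>

lemma gagliardo_nirenberg:
  assumes q: "q > 2"
  shows "\<exists>C>0. \<forall>V :: real ^ 2 \<Rightarrow> complex. \<forall>V' k. compact_supp punctured_disc V \<longrightarrow> (\<forall>i. compact_supp punctured_disc (V' i)) \<longrightarrow> (\<forall>i x. has_pd i V (V' i x) x) \<longrightarrow>
    k > 0 \<longrightarrow> (\<integral>x. (norm x * (norm (V' 1 x) + norm (V' 2 x)) + norm (V x))\<^sup>2 * polar_wt x \<partial>lborel) \<le> k\<^sup>2 \<longrightarrow>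
    (\<integral>x. norm (V x) powr q * polar_wt x \<partial>lborel) \<le> C * k powr (q - 2) * (\<integral>x. norm (V x) powr 2 * polar_wt x \<partial>lborel)"
proof -
  obtain j :: nat where j: "q < real j" using reals_Archimedean2 by blast
  have j1: "j \<ge> 1" using j q by (cases j) auto
  define Q where "Q = real (4 * j)"
  have Q: "q \<le> Q" "4 \<le> Q" using j j1 by (auto simp: Q_def)
  have Q2: "real (4 * j - 2) = Q - 2" using j1 by (simp add: Q_def of_nat_diff)
  \<comment> \<open>Makes 4 j^2 k0^2 equal to k^2 / 2, so that the coefficient of \<open>M Q\<close>
    after interpolation is exactly 1/2.\<close>
  define c where "c = sqrt 8 * real j"
  have c: "c > 0" "c\<^sup>2 = 8 * (real j)\<^sup>2" using j1 by (auto simp: c_def power_mult_distrib)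
  show ?thesis
  proof (intro exI[of _ "2 * c powr (q - 2)"] conjI allI impI)
    show "2 * c powr (q - 2) > 0" using c by simp
    fix V :: "real ^ 2 \<Rightarrow> complex" and V' and k0 :: real
    assume V: "compact_supp punctured_disc V" "\<forall>i. compact_supp punctured_disc (V' i)" "\<forall>i x. has_pd i V (V' i x) x" and k0: "k0 > 0"
      and N: "(\<integral>x. (norm x * (norm (V' 1 x) + norm (V' 2 x)) + norm (V x))\<^sup>2 * polar_wt x \<partial>lborel) \<le> k0\<^sup>2"
    define M where "M s = (\<integral>x. norm (V x) powr s * polar_wt x \<partial>lborel)" for s
    define k where "k = c * k0"
    have k: "k > 0" using c k0 by (simp add: k_def)
    have M0: "M s \<ge> 0" for s unfolding M_def by (auto intro!: Bochner_Integration.integral_nonneg)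
    have interp: "M s \<le> k powr (s - 2) * M 2 + k powr (s - Q) * M Q" if s: "2 \<le> s" "s \<le> Q" for s
    proof -
      have i: "integrable lborel (\<lambda>x. norm (V x) powr s * polar_wt x)" if "s > 0" for s
        using compact_supp_integrable[OF compact_supp_norm_powr[OF V(1) that]] .
      have "M s \<le> (\<integral>x. k powr (s - 2) * (norm (V x) powr 2 * polar_wt x) + k powr (s - Q) * (norm (V x) powr Q * polar_wt x) \<partial>lborel)"
        unfolding M_def
      proof (intro integral_mono Bochner_Integration.integrable_add integrable_mult_right i)
        fix x
        have "norm (V x) powr s * polar_wt x \<le> (k powr (s - 2) * norm (V x) powr 2 + k powr (s - Q) * norm (V x) powr Q) * polar_wt x"
          by (intro mult_right_mono powr_interpolate k s) auto
        then show "norm (V x) powr s * polar_wt x \<le> k powr (s - 2) * (norm (V x) powr 2 * polar_wt x) + k powr (s - Q) * (norm (V x) powr Q * polar_wt x)"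
          by (simp add: algebra_simps)
      qed (use s Q in auto)
      also have "\<dots> = k powr (s - 2) * M 2 + k powr (s - Q) * M Q"
        unfolding M_def using i[of 2] i[of Q] Q by simp
      finally show ?thesis .
    qed
    have "M Q \<le> 4 * (real j)\<^sup>2 * M (Q - 2) * (\<integral>x. (norm x * (norm (V' 1 x) + norm (V' 2 x)) + norm (V x))\<^sup>2 * polar_wt x \<partial>lborel)"
      using moment_step[OF V(1) V(2)[rule_format] V(3)[rule_format] j1] unfolding M_def Q2 Q_def[symmetric] .
    also have "\<dots> \<le> 4 * (real j)\<^sup>2 * M (Q - 2) * k0\<^sup>2" using N M0 by (intro mult_left_mono) auto
    also have "\<dots> = k\<^sup>2 / 2 * M (Q - 2)" by (simp add: k_def power_mult_distrib c)
    also have "\<dots> \<le> k\<^sup>2 / 2 * (k powr (Q - 4) * M 2 + k powr (- 2) * M Q)"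
      using interp[of "Q - 2"] Q by (intro mult_left_mono) auto
    also have "\<dots> = (k\<^sup>2 * k powr (Q - 4)) / 2 * M 2 + (k\<^sup>2 * k powr (- 2)) / 2 * M Q"
      by (simp add: distrib_left)
    also have "k\<^sup>2 * k powr (- 2) = 1" using k by (simp add: powr_minus_divide)
    also have "k\<^sup>2 * k powr (Q - 4) = k powr (Q - 2)"
    proof -
      have "k\<^sup>2 = k powr 2" using k by simp
      then show ?thesis by (simp flip: powr_add)
    qed
    \<comment> \<open>Subtracting half of \<open>M Q\<close> is legitimate because this is a real
      number, V having compact support in the punctured disc.\<close>
    finally have MQ: "M Q \<le> k powr (Q - 2) * M 2" by simp
    have "M q \<le> k powr (q - 2) * M 2 + k powr (q - Q) * M Q" using interp[of q] q Q by simp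
    also have "\<dots> \<le> k powr (q - 2) * M 2 + k powr (q - Q) * (k powr (Q - 2) * M 2)"
      using MQ by (intro add_left_mono mult_left_mono) auto
    also have "\<dots> = k powr (q - 2) * M 2 + (k powr (q - Q) * k powr (Q - 2)) * M 2" by simp
    also have "k powr (q - Q) * k powr (Q - 2) = k powr (q - 2)" by (simp flip: powr_add)
    also have "k powr (q - 2) * M 2 + k powr (q - 2) * M 2 = 2 * c powr (q - 2) * k0 powr (q - 2) * M 2"
      using c k0 by (simp add: k_def powr_mult)
    finally show "(\<integral>x. norm (V x) powr q * polar_wt x \<partial>lborel) \<le> 2 * c powr (q - 2) * k0 powr (q - 2) * (\<integral>x. norm (V x) powr 2 * polar_wt x \<partial>lborel)"
      unfolding M_def .
  qed
qed

subsection \<open>The first-order estimate\<close>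

abbreviation scaled_u :: "real \<Rightarrow> (real ^ 2 \<Rightarrow> complex) \<Rightarrow> real ^ 2 \<Rightarrow> complex" where
  "scaled_u \<tau> u x \<equiv> (inverse (lnr x) * wtE \<tau> x) *\<^sub>R u x"

abbreviation scaled_grad :: "real \<Rightarrow> (real ^ 2 \<Rightarrow> complex) \<Rightarrow> real ^ 2 \<Rightarrow> complex ^ 2" where
  "scaled_grad \<tau> u x \<equiv> (inverse (lnr x) * wtE \<tau> x * norm x) *\<^sub>R gradient u x"

abbreviation scaled_dbar :: "real \<Rightarrow> (real ^ 2 \<Rightarrow> complex) \<Rightarrow> real ^ 2 \<Rightarrow> complex" where
  "scaled_dbar \<tau> u x \<equiv> (lnr x * wtE \<tau> x * norm x) *\<^sub>R dbar u x"

abbreviation scaled_lap :: "real \<Rightarrow> (real ^ 2 \<Rightarrow> complex) \<Rightarrow> real ^ 2 \<Rightarrow> complex" where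
  "scaled_lap \<tau> u x \<equiv> (lnr x * wtE \<tau> x * (norm x)\<^sup>2) *\<^sub>R laplacian u x"

abbreviation epw :: "real \<Rightarrow> real ^ 2 \<Rightarrow> real" where "epw \<epsilon> x \<equiv> norm x powr (- 2 * (1 - \<epsilon>))"

section \<open>Properties of the weighted norms\<close>

lemma weighted_norm_nonneg: "0 \<le> weighted_norm a w f"
  by (simp add: weighted_norm_def)

lemma weighted_norm_cong:
  "(\<And>x. norm (f x) = norm (g x)) \<Longrightarrow> weighted_norm a w f = weighted_norm a w g"
  by (simp add: weighted_norm_def)

lemma weighted_norm_powr:
  assumes "a > 0" "\<And>x. 0 \<le> w x"
  shows "weighted_norm a w f powr a = (\<integral>x. norm (f x) powr a * w x \<partial>lborel)"
proof -
  have "0 \<le> (\<integral>x. norm (f x) powr a * w x \<partial>lborel)" by (intro Bochner_Integration.integral_nonneg) (simp add: assms)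
  then show ?thesis using assms by (simp add: weighted_norm_def powr_powr)
qed

lemma weighted_norm_2:
  assumes "\<And>x. 0 \<le> w x"
  shows "(weighted_norm 2 w f)\<^sup>2 = (\<integral>x. (norm (f x))\<^sup>2 * w x \<partial>lborel)"
proof -
  have "(weighted_norm 2 w f)\<^sup>2 = weighted_norm 2 w f powr 2"
    using weighted_norm_nonneg[of 2 w f] by (cases "weighted_norm 2 w f = 0") auto
  also have "\<dots> = (\<integral>x. norm (f x) powr 2 * w x \<partial>lborel)" by (rule weighted_norm_powr) (use assms in auto)
  finally have "(weighted_norm 2 w f)\<^sup>2 = (\<integral>x. norm (f x) powr 2 * w x \<partial>lborel)" .
  moreover have "norm (f x) powr 2 = (norm (f x))\<^sup>2" for x by (cases "f x = 0") auto
  ultimately show ?thesis by (simp only:)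
qed

lemma compact_supp_scaled:
  fixes u :: "real ^ 2 \<Rightarrow> 'b::real_normed_vector"
  assumes "compact_supp punctured_disc u" "continuous_on punctured_disc w" shows "compact_supp punctured_disc (\<lambda>x. w x *\<^sub>R u x)"
  by (rule compact_supp_weight[OF assms(1) open_punctured_disc]) (auto intro!: continuous_intros assms(2) compact_supp_continuous[OF assms(1)])

lemma weighted_norm_nn_integral:
  fixes F :: "real ^ 2 \<Rightarrow> 'b::real_normed_vector"
  assumes F: "compact_supp punctured_disc F" and a: "a > 0"
  shows "(\<integral>\<^sup>+x. ennreal (norm (F x) powr a * polar_wt x) \<partial>lborel) = ennreal (weighted_norm a polar_wt F powr a)"
  by (subst weighted_norm_powr) (auto intro!: nn_integral_eq_integral compact_supp_integrable[OF compact_supp_norm_powr[OF F a]] a)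

text \<open>Covers a vanishing right-hand norm: the estimates with a strictly positive bound are
  applied to every larger number.\<close>

lemma le_of_forall_greater:
  fixes X C A :: real
  assumes "C > 0" "\<And>B. B > A \<Longrightarrow> X \<le> C * B" shows "X \<le> C * A"
proof (rule field_le_epsilon)
  fix e :: real assume "e > 0"
  then show "X \<le> C * A + e" using assms(2)[of "A + e / C"] assms(1) by (simp add: distrib_left)
qed

text \<open>For p < 2 this is \<open>core_estimate_nn\<close> in terms of norms. For p = 2 the
  energy estimate has no logarithm on the right, and one is inserted because |ln r| >= 1 on the
  disc.\<close>

lemma core_estimate:
  assumes p: "1 < p" "p \<le> 2"
  shows "\<exists>C>0. \<forall>\<tau>>1. \<forall>U\<in>test_functions punctured_disc.
    \<tau> powr (1 - 1 / p) * weighted_norm 2 polar_wt (scaled_u \<tau> U)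
    \<le> C * weighted_norm p polar_wt (scaled_dbar \<tau> U)"
proof (cases "p = 2")
  case True
  have "\<tau> powr (1 - 1 / p) * weighted_norm 2 polar_wt (scaled_u \<tau> U)
    \<le> 1 * weighted_norm p polar_wt (scaled_dbar \<tau> U)"
    if \<tau>: "\<tau> > 1" and U: "U \<in> test_functions punctured_disc" for \<tau> and U :: "real ^ 2 \<Rightarrow> complex"
  proof -
    note cD = compact_supp_dbar[OF U open_punctured_disc]
    define l where "l = weighted_norm 2 polar_wt (scaled_u \<tau> U)"
    define r where "r = weighted_norm 2 polar_wt (scaled_dbar \<tau> U)"
    have "l\<^sup>2 = (\<integral>x. (inverse (lnr x))\<^sup>2 * irs x * wtS \<tau> x * (norm (U x))\<^sup>2 \<partial>lborel)"
      unfolding l_def by (subst weighted_norm_2, simp) (simp add: polar_wt_eq_irs wtS_eq power_mult_distrib mult_ac power_inverse)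
    then have "4 * \<tau> * l\<^sup>2 \<le> (\<integral>x. wtS \<tau> x * (norm (dbar U x))\<^sup>2 \<partial>lborel)"
      using core_estimate_energy[OF _ U, of \<tau>] \<tau> by simp
    also have "\<dots> \<le> (\<integral>x. (norm ((lnr x * wtE \<tau> x * norm x) *\<^sub>R dbar U x))\<^sup>2 * polar_wt x \<partial>lborel)"
    proof (rule integral_mono)
      show "integrable lborel (\<lambda>x. wtS \<tau> x * (norm (dbar U x))\<^sup>2)"
        by (rule compact_supp_integrable[OF compact_supp_weight[OF cD open_punctured_disc]]) (auto intro!: continuous_intros continuous_on_weights compact_supp_continuous[OF cD])
      show "integrable lborel (\<lambda>x. (norm ((lnr x * wtE \<tau> x * norm x) *\<^sub>R dbar U x))\<^sup>2 * polar_wt x)"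
        by (rule compact_supp_integrable[OF compact_supp_weight[OF cD open_punctured_disc]]) (auto intro!: continuous_intros continuous_on_weights compact_supp_continuous[OF cD])
      fix x
      show "wtS \<tau> x * (norm (dbar U x))\<^sup>2 \<le> (norm ((lnr x * wtE \<tau> x * norm x) *\<^sub>R dbar U x))\<^sup>2 * polar_wt x"
      proof (cases "x \<in> punctured_disc")
        case False
        then show ?thesis using dbar_zero_outside[OF U False] by simp
      next
        case True
        have "(norm x)\<^sup>2 * polar_wt x = 1" using punctured_discD(1)[OF True] by (simp add: polar_wt_eq_irs irs_eq)
        then have "(norm ((lnr x * wtE \<tau> x * norm x) *\<^sub>R dbar U x))\<^sup>2 * polar_wt x = (lnr x)\<^sup>2 * (wtS \<tau> x * (norm (dbar U x))\<^sup>2)"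
          by (simp add: power_mult_distrib wtS_eq mult_ac)
        moreover have "1 \<le> (lnr x)\<^sup>2" using punctured_discD(2)[OF True] abs_le_square_iff[of 1 "lnr x"] by simp
        then have "1 * (wtS \<tau> x * (norm (dbar U x))\<^sup>2) \<le> (lnr x)\<^sup>2 * (wtS \<tau> x * (norm (dbar U x))\<^sup>2)"
          by (intro mult_right_mono) (auto simp: wtS_def)
        ultimately show ?thesis by simp
      qed
    qed
    also have "\<dots> = r\<^sup>2" unfolding r_def by (rule weighted_norm_2[symmetric]) simp
    finally have "4 * \<tau> * l\<^sup>2 \<le> r\<^sup>2" .
    moreover have "0 \<le> \<tau> * l\<^sup>2" using \<tau> by simp
    ultimately have "\<tau> * l\<^sup>2 \<le> r\<^sup>2" by linarith
    then have "(sqrt \<tau> * l)\<^sup>2 \<le> r\<^sup>2" using \<tau> by (simp add: power_mult_distrib)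
    moreover have "0 \<le> r" unfolding r_def by (rule weighted_norm_nonneg)
    ultimately have "sqrt \<tau> * l \<le> r" using power2_le_imp_le by blast
    moreover have "\<tau> powr (1 - 1 / p) = sqrt \<tau>" using \<tau> True by (simp add: powr_half_sqrt)
    ultimately show ?thesis using True by (simp add: l_def r_def)
  qed
  then show ?thesis by (intro exI[of _ 1]) auto
next
  case False
  with p have p2: "p < 2" by simp
  obtain C where C: "C > 0" and main: "\<And>\<tau> U A. \<tau> \<ge> 1 \<Longrightarrow> U\<in>test_functions punctured_disc \<Longrightarrow> A>0 \<Longrightarrow>
    (\<integral>\<^sup>+x. ennreal ((\<bar>lnr x\<bar> * wtE \<tau> x * norm x * norm (dbar U x)) powr p * polar_wt x) \<partial>lborel) \<le> ennreal (A powr p) \<Longrightarrow>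
    (\<integral>\<^sup>+x. ennreal ((inverse \<bar>lnr x\<bar> * wtE \<tau> x * norm (U x))\<^sup>2 * polar_wt x) \<partial>lborel) \<le> ennreal ((C * \<tau> powr (- (1 - 1 / p)) * A)\<^sup>2)"
    using core_estimate_nn[OF p(1) p2] by blast
  have "\<tau> powr (1 - 1 / p) * weighted_norm 2 polar_wt (scaled_u \<tau> U)
    \<le> C * weighted_norm p polar_wt (scaled_dbar \<tau> U)"
    if \<tau>: "\<tau> > 1" and U: "U \<in> test_functions punctured_disc" for \<tau> and U :: "real ^ 2 \<Rightarrow> complex"
  proof (rule le_of_forall_greater[OF C])
    fix A assume A: "A > weighted_norm p polar_wt (scaled_dbar \<tau> U)"
    then have A0: "A > 0" using weighted_norm_nonneg[of p polar_wt "scaled_dbar \<tau> U"] by linarith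
    define l where "l = weighted_norm 2 polar_wt (scaled_u \<tau> U)"
    have l0: "l \<ge> 0" unfolding l_def by (rule weighted_norm_nonneg)
    have ccr: "compact_supp punctured_disc (scaled_dbar \<tau> U)"
      by (intro compact_supp_scaled compact_supp_dbar[OF U open_punctured_disc] continuous_intros continuous_on_weights)
    have ccl: "compact_supp punctured_disc (scaled_u \<tau> U)"
      by (intro compact_supp_scaled compact_supp_TF[OF U] continuous_on_mult continuous_on_weights)
    have "(\<integral>\<^sup>+x. ennreal ((\<bar>lnr x\<bar> * wtE \<tau> x * norm x * norm (dbar U x)) powr p * polar_wt x) \<partial>lborel)
      = (\<integral>\<^sup>+x. ennreal (norm ((lnr x * wtE \<tau> x * norm x) *\<^sub>R dbar U x) powr p * polar_wt x) \<partial>lborel)"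
      by (simp add: abs_mult)
    also have "\<dots> = ennreal (weighted_norm p polar_wt (scaled_dbar \<tau> U) powr p)"
      by (rule weighted_norm_nn_integral[OF ccr]) (use p in simp)
    also have "\<dots> \<le> ennreal (A powr p)"
      using A p weighted_norm_nonneg by (intro ennreal_leI powr_mono2) auto
    finally have "(\<integral>\<^sup>+x. ennreal ((inverse \<bar>lnr x\<bar> * wtE \<tau> x * norm (U x))\<^sup>2 * polar_wt x) \<partial>lborel) \<le> ennreal ((C * \<tau> powr (- (1 - 1 / p)) * A)\<^sup>2)"
      using main[OF _ U A0, of \<tau>] \<tau> by simp
    moreover have "(\<integral>\<^sup>+x. ennreal ((inverse \<bar>lnr x\<bar> * wtE \<tau> x * norm (U x))\<^sup>2 * polar_wt x) \<partial>lborel) = ennreal (l powr 2)"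
    proof -
      have pw: "y powr 2 = y\<^sup>2" if "y \<ge> 0" for y :: real using that by (cases "y = 0") auto
      have "(\<integral>\<^sup>+x. ennreal ((inverse \<bar>lnr x\<bar> * wtE \<tau> x * norm (U x))\<^sup>2 * polar_wt x) \<partial>lborel)
        = (\<integral>\<^sup>+x. ennreal (norm ((inverse (lnr x) * wtE \<tau> x) *\<^sub>R U x) powr 2 * polar_wt x) \<partial>lborel)"
        by (subst pw) (auto simp: abs_mult)
      also have "\<dots> = ennreal (l powr 2)" unfolding l_def by (rule weighted_norm_nn_integral[OF ccl]) simp
      finally show ?thesis .
    qed
    ultimately have "ennreal (l powr 2) \<le> ennreal ((C * \<tau> powr (- (1 - 1 / p)) * A)\<^sup>2)" by simp
    then have "l powr 2 \<le> (C * \<tau> powr (- (1 - 1 / p)) * A)\<^sup>2" by (rule ennreal_le_iff[THEN iffD1, rotated]) simp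
    then have "l\<^sup>2 \<le> (C * \<tau> powr (- (1 - 1 / p)) * A)\<^sup>2" using l0 by (cases "l = 0") auto
    then have "l \<le> C * \<tau> powr (- (1 - 1 / p)) * A"
      by (rule power2_le_imp_le) (use C A0 in auto)
    then have "\<tau> powr (1 - 1 / p) * l \<le> \<tau> powr (1 - 1 / p) * (C * \<tau> powr (- (1 - 1 / p)) * A)" by (intro mult_left_mono) auto
    also have "\<dots> = C * A * (\<tau> powr (1 - 1 / p) * \<tau> powr (- (1 - 1 / p)))" by (simp only: mult_ac)
    also have "\<tau> powr (1 - 1 / p) * \<tau> powr (- (1 - 1 / p)) = 1" unfolding powr_add[symmetric] using \<tau> by simp
    finally show "\<tau> powr (1 - 1 / p) * weighted_norm 2 polar_wt (scaled_u \<tau> U) \<le> C * A" by (simp add: l_def)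
  qed
  then show ?thesis using C by blast
qed

subsection \<open>Factorization of the Laplacian\<close>

definition dz :: "(real ^ 2 \<Rightarrow> complex) \<Rightarrow> real ^ 2 \<Rightarrow> complex" where
  "dz f x = partial_deriv 1 f x - \<i> * partial_deriv 2 f x"

lemma laplacian_2: "laplacian u (x :: real ^ 2) = partial_deriv 1 (partial_deriv 1 u) x + partial_deriv 2 (partial_deriv 2 u) x"
  by (simp add: laplacian_def sum_2)

lemma test_fun_vec_complex_dz:
  assumes u: "u \<in> test_functions \<Omega>"
  shows "(\<lambda>x. vec_complex x * dz u x) \<in> test_functions \<Omega>"
proof (rule test_functionsI[OF u])
  have 1: "C_k k (partial_deriv i u)" for i k by (rule test_fun_C_k[OF test_fun_partial_deriv[OF u]])
  have "C_k k (\<lambda>x. partial_deriv 1 u x + (- \<i>) * partial_deriv 2 u x)" for k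
    by (rule C_k_add[OF 1 C_k_mult[OF C_k_const 1]])
  then have "C_k k (dz u)" for k unfolding dz_def by simp
  then show "C_k k (\<lambda>x. vec_complex x * dz u x)" for k by (rule C_k_mult[OF C_k_bounded_linear[OF bounded_linear_vec_complex]])
  show "vec_complex x * dz u x = 0" if "x \<notin> closure {x. u x \<noteq> 0}" for x
    using test_fun_vanish(2)[OF u that] by (simp add: dz_def)
qed

text \<open>\<open>dbar\<close> annihilates z, and \<open>dbar\<close> of \<open>dz u\<close> is the
  Laplacian, as the mixed second derivatives cancel.\<close>

lemma dbar_vec_complex_dz:
  assumes u: "u \<in> test_functions \<Omega>"
  shows "dbar (\<lambda>x. vec_complex x * dz u x) x = vec_complex x * laplacian u x"
proof -
  define D where "D i = partial_deriv i (partial_deriv 1 u) x - \<i> * partial_deriv i (partial_deriv 2 u) x" for i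
  have "has_pd i (\<lambda>x. partial_deriv 1 u x - \<i> * partial_deriv 2 u x) (D i) x" for i
    by (rule has_pd_eqI, (rule pd_intros test_fun_has_pd[OF test_fun_partial_deriv[OF u]])+) (simp add: D_def)
  then have 1: "has_pd i (dz u) (D i) x" for i by (simp add: dz_def[abs_def])
  have "partial_deriv 1 (\<lambda>x. vec_complex x * dz u x) x = vec_complex x * D 1 + 1 * dz u x"
    by (rule partial_deriv_eqI[OF has_pd_mult[OF has_pd_vec_complex(1) 1]])
  moreover have "partial_deriv 2 (\<lambda>x. vec_complex x * dz u x) x = vec_complex x * D 2 + \<i> * dz u x"
    by (rule partial_deriv_eqI[OF has_pd_mult[OF has_pd_vec_complex(2) 1]])
  ultimately have "dbar (\<lambda>x. vec_complex x * dz u x) x = (vec_complex x * D 1 + 1 * dz u x) + \<i> * (vec_complex x * D 2 + \<i> * dz u x)"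
    by (simp only: dbar_def)
  moreover have "partial_deriv 2 (partial_deriv 1 u) x = partial_deriv 1 (partial_deriv 2 u) x"
    by (rule mixed_partials_eq[OF test_fun_C_k[OF u]])
  ultimately show ?thesis by (simp add: D_def laplacian_2 algebra_simps)
qed

lemma partial_deriv_cnj:
  assumes u: "u \<in> test_functions \<Omega>"
  shows "partial_deriv i (\<lambda>x. cnj (u x)) = (\<lambda>x. cnj (partial_deriv i u x))"
  by (rule ext, rule partial_deriv_eqI, rule has_pd_cnj[OF test_fun_has_pd[OF u]])

text \<open>By the parallelogram law the squared gradient is the mean of the squares of
  \<open>dz u\<close> and \<open>dbar u\<close>, and \<open>dbar u\<close> is the conjugate of
  \<open>dz\<close> of the conjugate of u. So the constant of \<open>core_estimate\<close> survives
  unchanged.\<close>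

lemma first_order_estimate:
  assumes p: "1 < p" "p \<le> 2"
  shows "\<exists>C>0. \<forall>\<tau>>1. \<forall>u\<in>test_functions punctured_disc.
    \<tau> powr (1 - 1 / p) * weighted_norm 2 polar_wt (scaled_grad \<tau> u)
    \<le> C * weighted_norm p polar_wt (scaled_lap \<tau> u)"
proof -
  obtain C where C: "C > 0" and core: "\<And>\<tau> U. \<tau> > 1 \<Longrightarrow> U\<in>test_functions punctured_disc \<Longrightarrow>
    \<tau> powr (1 - 1 / p) * weighted_norm 2 polar_wt (scaled_u \<tau> U)
    \<le> C * weighted_norm p polar_wt (scaled_dbar \<tau> U)"
    using core_estimate[OF p] by blast
  have dzb: "\<tau> powr (1 - 1 / p) * weighted_norm 2 polar_wt (\<lambda>x. (inverse (lnr x) * wtE \<tau> x * norm x) *\<^sub>R dz u x)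
    \<le> C * weighted_norm p polar_wt (scaled_lap \<tau> u)"
    if \<tau>: "\<tau> > 1" and u: "u \<in> test_functions punctured_disc" for \<tau> u
  proof -
    have "weighted_norm 2 polar_wt (\<lambda>x. (inverse (lnr x) * wtE \<tau> x * norm x) *\<^sub>R dz u x)
      = weighted_norm 2 polar_wt (\<lambda>x. (inverse (lnr x) * wtE \<tau> x) *\<^sub>R (vec_complex x * dz u x))"
      by (rule weighted_norm_cong) (simp add: norm_mult abs_mult)
    moreover have "weighted_norm p polar_wt (\<lambda>x. (lnr x * wtE \<tau> x * norm x) *\<^sub>R dbar (\<lambda>x. vec_complex x * dz u x) x)
      = weighted_norm p polar_wt (scaled_lap \<tau> u)"
      by (rule weighted_norm_cong) (simp add: dbar_vec_complex_dz[OF u] norm_mult abs_mult power2_eq_square)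
    ultimately show ?thesis using core[OF \<tau> test_fun_vec_complex_dz[OF u]] by simp
  qed
  have "\<tau> powr (1 - 1 / p) * weighted_norm 2 polar_wt (scaled_grad \<tau> u)
    \<le> C * weighted_norm p polar_wt (scaled_lap \<tau> u)"
    if \<tau>: "\<tau> > 1" and u: "u \<in> test_functions punctured_disc" for \<tau> u
  proof -
    define A where "A = weighted_norm p polar_wt (scaled_lap \<tau> u)"
    define W where "W x = inverse (lnr x) * wtE \<tau> x * norm x" for x :: "real ^ 2"
    define t where "t = \<tau> powr (1 - 1 / p)"
    note u' = test_fun_bounded_linear[OF u bounded_linear_cnj]
    have lc: "laplacian (\<lambda>x. cnj (u x)) x = cnj (laplacian u x)" for x
      using partial_deriv_cnj[OF u] partial_deriv_cnj[OF test_fun_partial_deriv[OF u]] by (simp add: laplacian_2)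
    have dc: "dz (\<lambda>x. cnj (u x)) x = cnj (dbar u x)" for x
      by (simp add: dz_def dbar_def partial_deriv_cnj[OF u])
    have 1: "t * weighted_norm 2 polar_wt (\<lambda>x. W x *\<^sub>R dz u x) \<le> C * A"
      unfolding W_def t_def A_def by (rule dzb[OF \<tau> u])
    have "t * weighted_norm 2 polar_wt (\<lambda>x. W x *\<^sub>R dz (\<lambda>x. cnj (u x)) x) \<le> C * weighted_norm p polar_wt (\<lambda>x. (lnr x * wtE \<tau> x * (norm x)\<^sup>2) *\<^sub>R laplacian (\<lambda>x. cnj (u x)) x)"
      unfolding W_def t_def by (rule dzb[OF \<tau> u'])
    moreover have "weighted_norm p polar_wt (\<lambda>x. (lnr x * wtE \<tau> x * (norm x)\<^sup>2) *\<^sub>R laplacian (\<lambda>x. cnj (u x)) x) = A"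
      unfolding A_def lc by (rule weighted_norm_cong) simp
    moreover have "weighted_norm 2 polar_wt (\<lambda>x. W x *\<^sub>R dz (\<lambda>x. cnj (u x)) x) = weighted_norm 2 polar_wt (\<lambda>x. W x *\<^sub>R dbar u x)"
      unfolding dc by (rule weighted_norm_cong) simp
    ultimately have 2: "t * weighted_norm 2 polar_wt (\<lambda>x. W x *\<^sub>R dbar u x) \<le> C * A" by simp
    have A0: "A \<ge> 0" unfolding A_def by (rule weighted_norm_nonneg)
    have t0: "t \<ge> 0" by (simp add: t_def)
    have cW: "continuous_on punctured_disc W" unfolding W_def[abs_def] by (intro continuous_on_mult continuous_on_weights continuous_on_norm continuous_on_id)
    have ccu: "compact_supp punctured_disc (partial_deriv i u)" for i by (rule compact_supp_TF[OF test_fun_partial_deriv[OF u]])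
    have ccdz: "compact_supp punctured_disc (dz u)"
    proof -
      have "compact_supp punctured_disc (\<lambda>x. - \<i> * partial_deriv 2 u x)"
        by (rule compact_supp_weight[OF ccu[of 2] open_punctured_disc]) (auto intro!: continuous_intros compact_supp_continuous[OF ccu])
      from compact_supp_add[OF ccu[of 1] this] show ?thesis by (simp add: dz_def[abs_def])
    qed
    have int: "integrable lborel (\<lambda>x. (norm (W x *\<^sub>R f x))\<^sup>2 * polar_wt x)" if "compact_supp punctured_disc f" for f :: "real ^ 2 \<Rightarrow> complex"
      by (rule compact_supp_integrable[OF compact_supp_weight[OF that open_punctured_disc]])
        (auto intro!: continuous_intros cW continuous_on_weights compact_supp_continuous[OF that])
    have pl: "(norm (gradient u x))\<^sup>2 = ((norm (dz u x))\<^sup>2 + (norm (dbar u x))\<^sup>2) / 2" for x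
    proof -
      have "(cmod (a - \<i> * b))\<^sup>2 + (cmod (a + \<i> * b))\<^sup>2 = 2 * ((cmod a)\<^sup>2 + (cmod b)\<^sup>2)" for a b
        by (simp add: cmod_power2) (simp add: power2_eq_square algebra_simps)
      moreover have "(norm (gradient u x))\<^sup>2 = (cmod (partial_deriv 1 u x))\<^sup>2 + (cmod (partial_deriv 2 u x))\<^sup>2"
        by (simp add: norm_vec_def L2_set_def sum_2 gradient_def)
      ultimately show ?thesis by (simp add: dz_def dbar_def)
    qed
    have "(weighted_norm 2 polar_wt (\<lambda>x. W x *\<^sub>R gradient u x))\<^sup>2 = (\<integral>x. (norm (W x *\<^sub>R gradient u x))\<^sup>2 * polar_wt x \<partial>lborel)"
      by (rule weighted_norm_2) simp
    also have "\<dots> = (\<integral>x. ((norm (W x *\<^sub>R dz u x))\<^sup>2 * polar_wt x + (norm (W x *\<^sub>R dbar u x))\<^sup>2 * polar_wt x) / 2 \<partial>lborel)"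
      by (rule Bochner_Integration.integral_cong) (simp_all add: pl power_mult_distrib algebra_simps add_divide_distrib)
    also have "\<dots> = ((\<integral>x. (norm (W x *\<^sub>R dz u x))\<^sup>2 * polar_wt x \<partial>lborel) + (\<integral>x. (norm (W x *\<^sub>R dbar u x))\<^sup>2 * polar_wt x \<partial>lborel)) / 2"
      using int[OF ccdz] int[OF compact_supp_dbar[OF u open_punctured_disc]] by simp
    also have "\<dots> = ((weighted_norm 2 polar_wt (\<lambda>x. W x *\<^sub>R dz u x))\<^sup>2 + (weighted_norm 2 polar_wt (\<lambda>x. W x *\<^sub>R dbar u x))\<^sup>2) / 2"
      by (subst (1 2) weighted_norm_2) auto
    finally have eq: "(weighted_norm 2 polar_wt (\<lambda>x. W x *\<^sub>R gradient u x))\<^sup>2 = \<dots>" .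
    have "(t * weighted_norm 2 polar_wt (\<lambda>x. W x *\<^sub>R gradient u x))\<^sup>2
      = ((t * weighted_norm 2 polar_wt (\<lambda>x. W x *\<^sub>R dz u x))\<^sup>2 + (t * weighted_norm 2 polar_wt (\<lambda>x. W x *\<^sub>R dbar u x))\<^sup>2) / 2"
      by (simp add: power_mult_distrib eq algebra_simps add_divide_distrib)
    also have "\<dots> \<le> ((C * A)\<^sup>2 + (C * A)\<^sup>2) / 2"
      using 1 2 t0 weighted_norm_nonneg by (intro divide_right_mono add_mono power_mono mult_nonneg_nonneg) auto
    finally have "(t * weighted_norm 2 polar_wt (\<lambda>x. W x *\<^sub>R gradient u x))\<^sup>2 \<le> (C * A)\<^sup>2" by simp
    then have "t * weighted_norm 2 polar_wt (\<lambda>x. W x *\<^sub>R gradient u x) \<le> C * A"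
      by (rule power2_le_imp_le) (use C A0 in auto)
    then show ?thesis by (simp add: t_def W_def A_def)
  qed
  then show ?thesis using C by blast
qed

subsection \<open>The Carleman estimate\<close>

lemma zero_order_norm_estimate:
  assumes \<tau>: "\<tau> > 1" and u: "u \<in> test_functions punctured_disc"
  shows "\<tau> * weighted_norm 2 polar_wt (scaled_u \<tau> u)
    \<le> 2 * weighted_norm 2 polar_wt (scaled_grad \<tau> u)"
proof -
  define l where "l = weighted_norm 2 polar_wt (scaled_u \<tau> u)"
  define G where "G = weighted_norm 2 polar_wt (scaled_grad \<tau> u)"
  have "l\<^sup>2 = (\<integral>x. (inverse (lnr x))\<^sup>2 * irs x * wtS \<tau> x * (norm (u x))\<^sup>2 \<partial>lborel)"
    unfolding l_def by (subst weighted_norm_2, simp) (simp add: polar_wt_eq_irs wtS_eq power_mult_distrib mult_ac power_inverse)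
  moreover have "G\<^sup>2 = (\<integral>x. (inverse (lnr x))\<^sup>2 * wtS \<tau> x * ((norm (partial_deriv 1 u x))\<^sup>2 + (norm (partial_deriv 2 u x))\<^sup>2) \<partial>lborel)"
  proof -
    have "G\<^sup>2 = (\<integral>x. (norm ((inverse (lnr x) * wtE \<tau> x * norm x) *\<^sub>R gradient u x))\<^sup>2 * polar_wt x \<partial>lborel)"
      unfolding G_def by (rule weighted_norm_2) simp
    also have "\<dots> = (\<integral>x. (inverse (lnr x))\<^sup>2 * wtS \<tau> x * ((norm (partial_deriv 1 u x))\<^sup>2 + (norm (partial_deriv 2 u x))\<^sup>2) \<partial>lborel)"
    proof (rule Bochner_Integration.integral_cong[OF refl])
      fix x :: "real ^ 2"
      have g: "(norm (gradient u x))\<^sup>2 = (norm (partial_deriv 1 u x))\<^sup>2 + (norm (partial_deriv 2 u x))\<^sup>2"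
        by (simp add: norm_vec_def L2_set_def sum_2 gradient_def)
      show "(norm ((inverse (lnr x) * wtE \<tau> x * norm x) *\<^sub>R gradient u x))\<^sup>2 * polar_wt x
        = (inverse (lnr x))\<^sup>2 * wtS \<tau> x * ((norm (partial_deriv 1 u x))\<^sup>2 + (norm (partial_deriv 2 u x))\<^sup>2)"
      proof (cases "x \<in> punctured_disc")
        case False
        then have "x \<notin> closure {x. u x \<noteq> 0}" using u by (auto simp: test_functions_def)
        then have "partial_deriv i u x = 0" for i by (rule test_fun_vanish(2)[OF u])
        then show ?thesis by (simp add: g power_mult_distrib)
      next
        case True
        have "(norm x)\<^sup>2 * polar_wt x = 1" using punctured_discD(1)[OF True] by (simp add: polar_wt_eq_irs irs_eq)
        then have "(inverse (lnr x))\<^sup>2 * (wtE \<tau> x)\<^sup>2 * (norm (gradient u x))\<^sup>2 * ((norm x)\<^sup>2 * polar_wt x) = (inverse (lnr x))\<^sup>2 * (wtE \<tau> x)\<^sup>2 * (norm (gradient u x))\<^sup>2" by simp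
        then show ?thesis unfolding g[symmetric] wtS_eq by (simp add: power_mult_distrib power_inverse mult_ac)
      qed
    qed
    finally show ?thesis .
  qed
  ultimately have "\<tau>\<^sup>2 * l\<^sup>2 \<le> 4 * G\<^sup>2" using zero_order_estimate[OF _ u, of \<tau>] \<tau> by simp
  then have "(\<tau> * l)\<^sup>2 \<le> (2 * G)\<^sup>2" by (simp add: power_mult_distrib)
  then have "\<tau> * l \<le> 2 * G" by (rule power2_le_imp_le) (simp add: G_def weighted_norm_nonneg)
  then show ?thesis by (simp add: l_def G_def)
qed

text \<open>The Gagliardo-Nirenberg inequality for the weighted function V. Differentiating the
  weight costs a factor \<tau>, which the zero-order estimate pays for, so the gradient of V is of
  size k while V itself is of size k / \<tau>. This gives k^(q - 2) (k / \<tau>)^2, whose q-th root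
  carries \<tau>^(- 2/q).\<close>

lemma Lq_estimate:
  assumes q: "q > 2" and \<epsilon>: "0 < \<epsilon>" "\<epsilon> < 1"
  shows "\<exists>C>0. \<forall>\<tau>>1. \<forall>u\<in>test_functions punctured_disc. \<forall>k>0.
    weighted_norm 2 polar_wt (scaled_grad \<tau> u) \<le> k \<longrightarrow>
    weighted_norm q (epw \<epsilon>) (scaled_u \<tau> u) \<le> C * k * \<tau> powr (- 2 / q)"
proof -
  obtain C where C: "C > 0" and gn: "\<And>(V :: real ^ 2 \<Rightarrow> complex) V' k. compact_supp punctured_disc V \<Longrightarrow> (\<And>i. compact_supp punctured_disc (V' i)) \<Longrightarrow> (\<And>i x. has_pd i V (V' i x) x) \<Longrightarrow>
    k > 0 \<Longrightarrow> (\<integral>x. (norm x * (norm (V' 1 x) + norm (V' 2 x)) + norm (V x))\<^sup>2 * polar_wt x \<partial>lborel) \<le> k\<^sup>2 \<Longrightarrow>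
    (\<integral>x. norm (V x) powr q * polar_wt x \<partial>lborel) \<le> C * k powr (q - 2) * (\<integral>x. norm (V x) powr 2 * polar_wt x \<partial>lborel)"
    using gagliardo_nirenberg[OF q] by blast
  have main: "weighted_norm q (epw \<epsilon>) (scaled_u \<tau> u) \<le> (C powr (1 / q) * 15) * k * \<tau> powr (- 2 / q)"
    if \<tau>: "\<tau> > 1" and u: "u \<in> test_functions punctured_disc" and k: "k > 0"
      and Gk: "weighted_norm 2 polar_wt (scaled_grad \<tau> u) \<le> k" for \<tau> u k
  proof -
    define L where "L x = inverse (lnr x)" for x :: "real ^ 2"
    define W where "W x = L x * wtE \<tau> x" for x
    define W' where "W' i x = - (L x + \<tau> * (1 + 2 * L x)) * W x * (x $ i * irs x)" for i x
    define V where "V x = complex_of_real (W x) * u x" for x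
    define V' where "V' i x = complex_of_real (W x) * partial_deriv i u x + complex_of_real (W' i x) * u x" for i x
    have nV: "norm (V x) = norm ((inverse (lnr x) * wtE \<tau> x) *\<^sub>R u x)" for x
      by (simp only: V_def W_def L_def norm_mult norm_of_real norm_scaleR)
    let ?K = "closure {x. u x \<noteq> 0}"
    have K: "compact ?K" "?K \<subseteq> punctured_disc" using u by (auto simp: test_functions_def)
    have van: "V x = 0" "V' i x = 0" if "x \<notin> ?K" for x i using test_fun_vanish[OF u that] by (simp_all add: V_def V'_def)
    have cL: "continuous_on punctured_disc L" unfolding L_def[abs_def] by (rule continuous_on_weights)
    have cW: "continuous_on punctured_disc W" unfolding W_def[abs_def] by (intro continuous_on_mult cL continuous_on_weights)
    have cW': "continuous_on punctured_disc (W' i)" for i unfolding W'_def[abs_def]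
      by (intro continuous_intros cL cW continuous_on_weights)
    have ccV: "compact_supp punctured_disc V"
      by (rule ccI[OF K van(1) open_punctured_disc]) (auto simp: V_def[abs_def] intro!: continuous_intros cW test_fun_continuous[OF u])
    have ccV': "compact_supp punctured_disc (V' i)" for i
      by (rule ccI[OF K van(2) open_punctured_disc]) (auto simp: V'_def[abs_def] intro!: continuous_intros cW cW' test_fun_continuous[OF u])
    have pW: "has_pd i W (W' i x) x" if x: "x \<in> punctured_disc" for i x
    proof -
      \<comment> \<open>The square root of the weight at \<tau> is the weight at \<tau> / 2, so
        \<open>has_pd_wtS\<close> applies again.\<close>
      have E: "wtE \<tau> y = wtS (\<tau> / 2) y" for y by (simp add: wtS_def)
      have 1: "has_pd i (\<lambda>x. wtE \<tau> x) (- \<tau> * (1 + 2 * L x) * (x $ i * irs x) * wtE \<tau> x) x"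
        unfolding E using has_pd_wtS[OF punctured_discD(1)[OF x] punctured_disc_lnr_neq[OF x], of i "\<tau> / 2"] by (simp add: L_def)
      have 2: "has_pd i L (- (L x)\<^sup>2 * (x $ i * irs x)) x"
        using has_pd_inverse_lnr[OF punctured_discD(1)[OF x] punctured_disc_lnr_neq[OF x], of i] unfolding L_def[abs_def] .
      show ?thesis unfolding W_def[abs_def]
        by (rule has_pd_eqI[OF has_pd_mult[OF 2 1]]) (simp add: W'_def W_def power2_eq_square algebra_simps)
    qed
    have pV: "has_pd i V (V' i x) x" for i x
    proof (rule has_pd_extend[OF K _ van])
      fix x assume "x \<in> punctured_disc"
      from has_pd_mult[OF has_pd_of_real[OF pW[OF this]] test_fun_has_pd[OF u]]
      show "has_pd i V (V' i x) x" unfolding V_def[abs_def] V'_def .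
    qed
    define G where "G = weighted_norm 2 polar_wt (scaled_grad \<tau> u)"
    define l where "l = weighted_norm 2 polar_wt (scaled_u \<tau> u)"
    have G0: "G \<ge> 0" "l \<ge> 0" unfolding G_def l_def by (rule weighted_norm_nonneg)+
    have lG: "\<tau> * l \<le> 2 * G" unfolding l_def G_def by (rule zero_order_norm_estimate[OF \<tau> u])
    define g2 where "g2 x = (W x)\<^sup>2 * (norm x)\<^sup>2 * ((norm (partial_deriv 1 u x))\<^sup>2 + (norm (partial_deriv 2 u x))\<^sup>2) * polar_wt x" for x
    define u2 where "u2 x = (W x)\<^sup>2 * (norm (u x))\<^sup>2 * polar_wt x" for x
    have g: "(norm (gradient u x))\<^sup>2 = (norm (partial_deriv 1 u x))\<^sup>2 + (norm (partial_deriv 2 u x))\<^sup>2" for x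
      by (simp add: norm_vec_def L2_set_def sum_2 gradient_def)
    have G2: "G\<^sup>2 = (\<integral>x. g2 x \<partial>lborel)"
      unfolding G_def by (subst weighted_norm_2, simp) (simp add: g2_def[abs_def] g W_def L_def power_mult_distrib mult_ac power_inverse)
    have l2: "l\<^sup>2 = (\<integral>x. u2 x \<partial>lborel)"
      unfolding l_def by (subst weighted_norm_2, simp) (simp add: u2_def[abs_def] W_def L_def power_mult_distrib mult_ac power_inverse)
    have ccg2: "compact_supp punctured_disc g2"
    proof (rule ccI[OF K _ open_punctured_disc])
      show "g2 x = 0" if "x \<notin> ?K" for x using test_fun_vanish[OF u that] by (simp add: g2_def)
      show "continuous_on punctured_disc g2" unfolding g2_def[abs_def] by (intro continuous_intros cW test_fun_continuous[OF u] continuous_on_weights)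
    qed
    have ccu2: "compact_supp punctured_disc u2"
    proof (rule ccI[OF K _ open_punctured_disc])
      show "u2 x = 0" if "x \<notin> ?K" for x using test_fun_vanish[OF u that] by (simp add: u2_def)
      show "continuous_on punctured_disc u2" unfolding u2_def[abs_def] by (intro continuous_intros cW test_fun_continuous[OF u] continuous_on_weights)
    qed
    have Db: "(norm x * (norm (V' 1 x) + norm (V' 2 x)) + norm (V x))\<^sup>2 * polar_wt x \<le> 4 * g2 x + 50 * \<tau>\<^sup>2 * u2 x" for x
    proof (cases "x \<in> punctured_disc")
      case False
      then have nx: "x \<notin> ?K" using K by auto
      show ?thesis using van[OF nx] test_fun_vanish[OF u nx] by (simp add: g2_def u2_def)
    next
      case x: True
      define r where "r = norm x"
      define w where "w = \<bar>W x\<bar>"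
      define n1 where "n1 = norm (partial_deriv 1 u x)"
      define n2 where "n2 = norm (partial_deriv 2 u x)"
      define n0 where "n0 = norm (u x)"
      have r: "r > 0" using punctured_discD(1)[OF x] by (simp add: r_def)
      have L: "- 1 / 6 \<le> L x" "L x \<le> 0" using punctured_discD(2)[OF x] by (auto simp: L_def field_simps)
      have W'b: "r * \<bar>W' i x\<bar> \<le> 2 * \<tau> * w" for i
      proof -
        have "\<bar>L x + \<tau> * (1 + 2 * L x)\<bar> \<le> 2 * \<tau>"
        proof -
          have "\<tau> * (1 + 2 * L x) \<le> \<tau> * 1" "\<tau> * 0 \<le> \<tau> * (1 + 2 * L x)" using L \<tau> by (auto intro!: mult_left_mono)
          then show ?thesis using L \<tau> by linarith
        qed
        moreover have "r * (\<bar>x $ i\<bar> * irs x) \<le> 1"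
        proof -
          have "\<bar>x $ i\<bar> \<le> r" unfolding r_def by (rule component_le_norm_cart)
          then have "r * (\<bar>x $ i\<bar> * irs x) \<le> r * (r * irs x)" using r by (intro mult_left_mono mult_right_mono) (auto simp: irs_def)
          also have "\<dots> = 1" using r by (simp add: irs_eq r_def[symmetric] power2_eq_square field_simps)
          finally show ?thesis .
        qed
        ultimately have "\<bar>L x + \<tau> * (1 + 2 * L x)\<bar> * w * (r * (\<bar>x $ i\<bar> * irs x)) \<le> (2 * \<tau>) * w * 1"
          using \<tau> r by (intro mult_mono) (auto simp: w_def irs_def)
        moreover have "r * \<bar>W' i x\<bar> = \<bar>L x + \<tau> * (1 + 2 * L x)\<bar> * w * (r * (\<bar>x $ i\<bar> * irs x))"
        proof -
          have i0: "irs x \<ge> 0" by (simp add: irs_def)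
          have "\<bar>W' i x\<bar> = \<bar>(L x + \<tau> * (1 + 2 * L x)) * W x * (x $ i * irs x)\<bar>"
            unfolding W'_def by (simp only: mult_minus_left abs_minus_cancel)
          then show ?thesis by (simp only: abs_mult w_def abs_of_nonneg[OF i0] mult_ac)
        qed
        ultimately show ?thesis by linarith
      qed
      have V'b: "r * norm (V' i x) \<le> w * r * norm (partial_deriv i u x) + 2 * \<tau> * (w * n0)" for i
      proof -
        have "norm (V' i x) \<le> w * norm (partial_deriv i u x) + \<bar>W' i x\<bar> * n0"
          unfolding V'_def w_def n0_def by (rule order_trans[OF norm_triangle_ineq]) (simp add: norm_mult)
        then have "r * norm (V' i x) \<le> r * (w * norm (partial_deriv i u x) + \<bar>W' i x\<bar> * n0)" using r by (intro mult_left_mono) auto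
        also have "\<dots> = w * r * norm (partial_deriv i u x) + (r * \<bar>W' i x\<bar>) * n0" by (simp add: algebra_simps)
        also have "(r * \<bar>W' i x\<bar>) * n0 \<le> (2 * \<tau> * w) * n0" by (intro mult_right_mono W'b) (simp add: n0_def)
        finally show ?thesis by (simp add: mult.assoc)
      qed
      have w0: "w * n0 \<ge> 0" by (simp add: w_def n0_def)
      have "norm (V x) = 1 * (w * n0)" by (simp add: V_def norm_mult w_def n0_def)
      also have "\<dots> \<le> \<tau> * (w * n0)" using \<tau> w0 by (intro mult_right_mono) auto
      finally have "norm (V x) \<le> \<tau> * (w * n0)" .
      \<comment> \<open>The factor 5 is 2 + 2 from the two derivatives of the weight and 1 from V.
        Squaring the sum with weight 2 gives the 50, and splitting n1 + n2 once more gives the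
        4.\<close>
      then have "r * norm (V' 1 x) + r * norm (V' 2 x) + norm (V x) \<le> w * r * n1 + w * r * n2 + 5 * (\<tau> * (w * n0))"
        using V'b[of 1] V'b[of 2] unfolding n1_def n2_def by linarith
      then have "norm x * (norm (V' 1 x) + norm (V' 2 x)) + norm (V x) \<le> w * r * (n1 + n2) + 5 * \<tau> * (w * n0)"
        by (simp add: r_def[symmetric] distrib_left)
      then have "(norm x * (norm (V' 1 x) + norm (V' 2 x)) + norm (V x))\<^sup>2 \<le> (w * r * (n1 + n2) + 5 * \<tau> * (w * n0))\<^sup>2"
        by (rule power_mono) (auto intro!: add_nonneg_nonneg)
      also have "\<dots> \<le> 4 * (w\<^sup>2 * r\<^sup>2 * (n1\<^sup>2 + n2\<^sup>2)) + 50 * \<tau>\<^sup>2 * (w\<^sup>2 * n0\<^sup>2)"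
      proof -
        have s: "(a + b)\<^sup>2 \<le> 2 * a\<^sup>2 + 2 * b\<^sup>2" for a b :: real
        proof -
          have "0 \<le> (a - b)\<^sup>2" by simp
          then show ?thesis by (simp add: power2_eq_square algebra_simps)
        qed
        have "(w * r * (n1 + n2))\<^sup>2 \<le> w\<^sup>2 * r\<^sup>2 * (2 * n1\<^sup>2 + 2 * n2\<^sup>2)"
          unfolding power_mult_distrib by (intro mult_left_mono s) auto
        then show ?thesis using s[of "w * r * (n1 + n2)" "5 * \<tau> * (w * n0)"] by (simp add: power_mult_distrib algebra_simps)
      qed
      finally have "(norm x * (norm (V' 1 x) + norm (V' 2 x)) + norm (V x))\<^sup>2 * polar_wt x \<le> (4 * (w\<^sup>2 * r\<^sup>2 * (n1\<^sup>2 + n2\<^sup>2)) + 50 * \<tau>\<^sup>2 * (w\<^sup>2 * n0\<^sup>2)) * polar_wt x"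
        by (rule mult_right_mono) simp
      also have "\<dots> = 4 * g2 x + 50 * \<tau>\<^sup>2 * u2 x"
        by (simp add: g2_def u2_def w_def r_def n1_def n2_def n0_def algebra_simps)
      finally show ?thesis .
    qed
    have ccD: "compact_supp punctured_disc (\<lambda>x. (norm x * (norm (V' 1 x) + norm (V' 2 x)) + norm (V x))\<^sup>2 * polar_wt x)"
    proof (rule ccI[OF K _ open_punctured_disc])
      show "(norm x * (norm (V' 1 x) + norm (V' 2 x)) + norm (V x))\<^sup>2 * polar_wt x = 0" if "x \<notin> ?K" for x using van[OF that] by simp
      show "continuous_on punctured_disc (\<lambda>x. (norm x * (norm (V' 1 x) + norm (V' 2 x)) + norm (V x))\<^sup>2 * polar_wt x)"
        by (intro continuous_intros continuous_on_weights compact_supp_continuous[OF ccV] compact_supp_continuous[OF ccV'])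
    qed
    have "(\<integral>x. (norm x * (norm (V' 1 x) + norm (V' 2 x)) + norm (V x))\<^sup>2 * polar_wt x \<partial>lborel) \<le> (\<integral>x. 4 * g2 x + 50 * \<tau>\<^sup>2 * u2 x \<partial>lborel)"
      by (intro integral_mono Db Bochner_Integration.integrable_add integrable_mult_right compact_supp_integrable[OF ccD] compact_supp_integrable[OF ccg2] compact_supp_integrable[OF ccu2])
    also have "\<dots> = 4 * G\<^sup>2 + 50 * \<tau>\<^sup>2 * l\<^sup>2"
      unfolding G2 l2 using compact_supp_integrable[OF ccg2] compact_supp_integrable[OF ccu2] by simp
    also have "\<dots> = 4 * G\<^sup>2 + 50 * (\<tau> * l)\<^sup>2" by (simp add: power_mult_distrib)
    also have "\<dots> \<le> 4 * G\<^sup>2 + 50 * (2 * G)\<^sup>2" using lG \<tau> G0 by (intro add_left_mono mult_left_mono power_mono) auto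
    also have "\<dots> = 204 * G\<^sup>2" by (simp add: power_mult_distrib)
    \<comment> \<open>Rounding 204 up to a square; 15 is its root.\<close>
    also have "\<dots> \<le> 225 * k\<^sup>2" using Gk G0 unfolding G_def[symmetric] by (intro mult_mono power_mono) auto
    also have "\<dots> = (15 * k)\<^sup>2" by (simp add: power_mult_distrib)
    finally have "(\<integral>x. norm (V x) powr q * polar_wt x \<partial>lborel) \<le> C * (15 * k) powr (q - 2) * (\<integral>x. norm (V x) powr 2 * polar_wt x \<partial>lborel)"
      using k by (intro gn[OF ccV ccV' pV]) auto
    also have "(\<integral>x. norm (V x) powr 2 * polar_wt x \<partial>lborel) = l powr 2"
      unfolding l_def nV by (rule weighted_norm_powr[symmetric]) auto
    also have "C * (15 * k) powr (q - 2) * l powr 2 \<le> C * (15 * k) powr (q - 2) * ((15 * k) powr 2 * \<tau> powr (- 2))"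
    proof (intro mult_left_mono)
      have "\<tau> * l \<le> 15 * k" using lG Gk k unfolding G_def[symmetric] by linarith
      then have "l \<le> 15 * k / \<tau>" using \<tau> by (simp add: field_simps)
      then have "l powr 2 \<le> (15 * k / \<tau>) powr 2" using G0 by (intro powr_mono2) auto
      also have "\<dots> = (15 * k) powr 2 * \<tau> powr (- 2)" using k \<tau> by (subst powr_divide) (auto simp: powr_minus_divide)
      finally show "l powr 2 \<le> (15 * k) powr 2 * \<tau> powr (- 2)" .
    qed (use C in auto)
    also have "\<dots> = C * ((15 * k) powr (q - 2) * (15 * k) powr 2) * \<tau> powr (- 2)" by (simp only: mult_ac)
    also have "(15 * k) powr (q - 2) * (15 * k) powr 2 = (15 * k) powr q" unfolding powr_add[symmetric] by simp
    finally have Vq: "(\<integral>x. norm (V x) powr q * polar_wt x \<partial>lborel) \<le> C * (15 * k) powr q * \<tau> powr (- 2)" .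
    define w where "w = weighted_norm q (epw \<epsilon>) (scaled_u \<tau> u)"
    have w0: "w \<ge> 0" unfolding w_def by (rule weighted_norm_nonneg)
    have "w powr q = (\<integral>x. norm (V x) powr q * norm x powr (- 2 * (1 - \<epsilon>)) \<partial>lborel)"
      unfolding w_def nV using q by (intro weighted_norm_powr) auto
    also have "\<dots> \<le> (\<integral>x. norm (V x) powr q * polar_wt x \<partial>lborel)"
    proof (rule integral_mono)
      show "integrable lborel (\<lambda>x. norm (V x) powr q * polar_wt x)" using compact_supp_integrable[OF compact_supp_norm_powr[OF ccV]] q by simp
      show "integrable lborel (\<lambda>x. norm (V x) powr q * norm x powr (- 2 * (1 - \<epsilon>)))"
      proof (rule compact_supp_integrable[OF compact_supp_weight[OF ccV open_punctured_disc]])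
        show "continuous_on punctured_disc (\<lambda>x. norm (V x) powr q * norm x powr (- 2 * (1 - \<epsilon>)))"
          using q punctured_discD(1) by (intro continuous_on_mult continuous_on_powr' continuous_on_norm continuous_on_const continuous_on_id compact_supp_continuous[OF ccV]) auto
      qed auto
      fix x
      show "norm (V x) powr q * norm x powr (- 2 * (1 - \<epsilon>)) \<le> norm (V x) powr q * polar_wt x"
      proof (cases "x \<in> punctured_disc")
        case False
        then have "x \<notin> ?K" using K by auto
        then show ?thesis using van(1)[of x] by simp
      next
        case True
        have "norm x < exp (- 6)" using True by (simp add: punctured_disc_def)
        also have "\<dots> \<le> 1" by simp
        \<comment> \<open>Only r <= 1 matters here: the density with 1 - \<epsilon> is the smaller
          one.\<close>
        finally have "norm x powr (- 2 * (1 - \<epsilon>)) \<le> polar_wt x" using punctured_discD(1)[OF True] \<epsilon> by (intro powr_mono') auto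
        then show ?thesis by (intro mult_left_mono) auto
      qed
    qed
    also note Vq
    finally have "(w powr q) powr (1 / q) \<le> (C * (15 * k) powr q * \<tau> powr (- 2)) powr (1 / q)"
      using q by (intro powr_mono2) auto
    moreover have "(w powr q) powr (1 / q) = w" using w0 q by (simp add: powr_powr)
    moreover have "(C * (15 * k) powr q * \<tau> powr (- 2)) powr (1 / q) = C powr (1 / q) * (15 * k) * \<tau> powr (- 2 / q)"
      using C k \<tau> q by (simp add: powr_mult powr_powr)
    ultimately show ?thesis unfolding w_def by simp
  qed
  show ?thesis by (intro exI[of _ "C powr (1 / q) * 15"] conjI allI ballI impI main) (use C in auto)
qed

lemma centered_carleman_estimate:
  fixes p q \<epsilon> \<beta>\<^sub>0 \<beta>\<^sub>1 :: real
  assumes p: "1 < p" "p \<le> 2" and q: "2 < q" and \<epsilon>: "0 < \<epsilon>" "\<epsilon> < 1"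
    and \<beta>\<^sub>0: "\<beta>\<^sub>0 = 2 / q * (1 - \<epsilon>) + 1 - 1 / p" and \<beta>\<^sub>1: "\<beta>\<^sub>1 = 1 - 1 / p"
  shows "\<exists>C>0. \<forall>u\<in>test_functions punctured_disc. \<forall>\<tau>>1.
     \<tau> powr (1 + \<beta>\<^sub>1) * weighted_norm 2 polar_wt (scaled_u \<tau> u)
     + \<tau> powr \<beta>\<^sub>0 * weighted_norm q (epw \<epsilon>) (scaled_u \<tau> u)
     + \<tau> powr \<beta>\<^sub>1 * weighted_norm 2 polar_wt (scaled_grad \<tau> u)
     \<le> C * weighted_norm p polar_wt (scaled_lap \<tau> u)"
proof -
  obtain C1 where C1: "C1 > 0" and first: "\<And>\<tau> u. \<tau> > 1 \<Longrightarrow> u \<in> test_functions punctured_disc \<Longrightarrow>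
    \<tau> powr (1 - 1 / p) * weighted_norm 2 polar_wt (scaled_grad \<tau> u)
    \<le> C1 * weighted_norm p polar_wt (scaled_lap \<tau> u)"
    using first_order_estimate[OF p] by blast
  obtain C2 where C2: "C2 > 0" and Lq: "\<And>\<tau> u k. \<tau> > 1 \<Longrightarrow> u \<in> test_functions punctured_disc \<Longrightarrow> k > 0 \<Longrightarrow>
    weighted_norm 2 polar_wt (scaled_grad \<tau> u) \<le> k \<Longrightarrow>
    weighted_norm q (epw \<epsilon>) (scaled_u \<tau> u) \<le> C2 * k * \<tau> powr (- 2 / q)"
    using Lq_estimate[OF q \<epsilon>] by blast
  have main: "\<tau> powr (1 + \<beta>\<^sub>1) * weighted_norm 2 polar_wt (scaled_u \<tau> u)
     + \<tau> powr \<beta>\<^sub>0 * weighted_norm q (epw \<epsilon>) (scaled_u \<tau> u)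
     + \<tau> powr \<beta>\<^sub>1 * weighted_norm 2 polar_wt (scaled_grad \<tau> u)
     \<le> (3 * C1 + C1 * C2) * weighted_norm p polar_wt (scaled_lap \<tau> u)"
    if u: "u \<in> test_functions punctured_disc" and \<tau>: "\<tau> > 1" for u \<tau>
  proof (rule le_of_forall_greater)
    \<comment> \<open>2 C1 comes from the zero-order term, C1 C2 from the L^q term, and C1 from the
      gradient term.\<close>
    show "3 * C1 + C1 * C2 > 0" using C1 C2 by (simp add: add_pos_pos)
    define A where "A = weighted_norm p polar_wt (scaled_lap \<tau> u)"
    define G where "G = weighted_norm 2 polar_wt (scaled_grad \<tau> u)"
    define l where "l = weighted_norm 2 polar_wt (scaled_u \<tau> u)"
    define w where "w = weighted_norm q (epw \<epsilon>) (scaled_u \<tau> u)"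
    fix B assume "B > weighted_norm p polar_wt (scaled_lap \<tau> u)"
    then have AB: "A < B" by (simp add: A_def)
    have "0 \<le> A" unfolding A_def by (rule weighted_norm_nonneg)
    then have B: "B > 0" using AB by simp
    have "\<tau> powr \<beta>\<^sub>1 * G \<le> C1 * A" unfolding G_def A_def \<beta>\<^sub>1 by (rule first[OF \<tau> u])
    also have "C1 * A \<le> C1 * B" using AB C1 by simp
    finally have 3: "\<tau> powr \<beta>\<^sub>1 * G \<le> C1 * B" .
    have "\<tau> * l \<le> 2 * G" unfolding l_def G_def by (rule zero_order_norm_estimate[OF \<tau> u])
    then have "\<tau> powr \<beta>\<^sub>1 * (\<tau> * l) \<le> \<tau> powr \<beta>\<^sub>1 * (2 * G)" by (intro mult_left_mono) auto
    also have "\<dots> \<le> 2 * (C1 * B)" using 3 by simp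
    also have "\<tau> powr \<beta>\<^sub>1 * (\<tau> * l) = \<tau> powr (1 + \<beta>\<^sub>1) * l" using \<tau> by (simp add: powr_add)
    finally have 1: "\<tau> powr (1 + \<beta>\<^sub>1) * l \<le> 2 * (C1 * B)" .
    have tt: "\<tau> powr \<beta>\<^sub>1 > 0" using \<tau> by simp
    have "G \<le> C1 * B / \<tau> powr \<beta>\<^sub>1" using 3 tt by (simp add: pos_le_divide_eq mult.commute)
    then have wb: "w \<le> C2 * (C1 * B / \<tau> powr \<beta>\<^sub>1) * \<tau> powr (- 2 / q)"
      unfolding w_def G_def using C1 B tt by (intro Lq[OF \<tau> u]) auto
    have "\<tau> powr \<beta>\<^sub>0 * w \<le> \<tau> powr \<beta>\<^sub>0 * (C2 * (C1 * B / \<tau> powr \<beta>\<^sub>1) * \<tau> powr (- 2 / q))"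
      by (rule mult_left_mono[OF wb]) simp
    also have "\<dots> = C1 * C2 * B * (\<tau> powr \<beta>\<^sub>0 / \<tau> powr \<beta>\<^sub>1 * \<tau> powr (- 2 / q))" by (simp add: mult_ac)
    also have "\<tau> powr \<beta>\<^sub>0 / \<tau> powr \<beta>\<^sub>1 * \<tau> powr (- 2 / q) = \<tau> powr (\<beta>\<^sub>0 - \<beta>\<^sub>1 + - 2 / q)"
      by (simp only: powr_diff powr_add)
    also have "C1 * C2 * B * \<tau> powr (\<beta>\<^sub>0 - \<beta>\<^sub>1 + - 2 / q) \<le> C1 * C2 * B * 1"
    proof (rule mult_left_mono)
      \<comment> \<open>The power of \<tau> left over is nonpositive, and \<tau> > 1.\<close>
      have "\<beta>\<^sub>0 - \<beta>\<^sub>1 + - 2 / q = - (2 / q * \<epsilon>)" unfolding \<beta>\<^sub>0 \<beta>\<^sub>1 using q by (simp add: field_simps)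
      also have "\<dots> \<le> 0" using q \<epsilon> by simp
      finally have "\<tau> powr (\<beta>\<^sub>0 - \<beta>\<^sub>1 + - 2 / q) \<le> \<tau> powr 0" using \<tau> by (intro powr_mono) auto
      then show "\<tau> powr (\<beta>\<^sub>0 - \<beta>\<^sub>1 + - 2 / q) \<le> 1" using \<tau> by simp
    qed (use C1 C2 B in auto)
    finally have 2: "\<tau> powr \<beta>\<^sub>0 * w \<le> C1 * C2 * B" by simp
    have "\<tau> powr (1 + \<beta>\<^sub>1) * l + \<tau> powr \<beta>\<^sub>0 * w + \<tau> powr \<beta>\<^sub>1 * G \<le> (3 * C1 + C1 * C2) * B"
      using 1 2 3 by (simp add: distrib_right)
    then show "\<tau> powr (1 + \<beta>\<^sub>1) * weighted_norm 2 polar_wt (scaled_u \<tau> u)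
     + \<tau> powr \<beta>\<^sub>0 * weighted_norm q (epw \<epsilon>) (scaled_u \<tau> u)
     + \<tau> powr \<beta>\<^sub>1 * weighted_norm 2 polar_wt (scaled_grad \<tau> u) \<le> (3 * C1 + C1 * C2) * B"
      unfolding l_def w_def G_def .
  qed
  show ?thesis by (intro exI[of _ "3 * C1 + C1 * C2"] conjI ballI allI impI main) (use C1 C2 in \<open>auto simp: add_pos_pos\<close>)
qed

section \<open>Reduction to the centre 0 by translation\<close>

lemma weighted_norm_translate:
  "weighted_norm a (\<lambda>x. w (x + c)) (\<lambda>x. f (x + c)) = weighted_norm a w f"
  unfolding weighted_norm_def using lborel_integral_translate[of "\<lambda>x. norm (f x) powr a * w x" c] by simp

lemma test_fun_translate:
  assumes u: "u \<in> test_functions (ball c R - {c})"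
  shows "(\<lambda>x. u (x + c)) \<in> test_functions (ball 0 R - {0})"
proof -
  have "{x. u (x + c) \<noteq> 0} = (\<lambda>x. - c + x) ` {x. u x \<noteq> 0}"
    by (force simp: image_iff)
  then have cl: "closure {x. u (x + c) \<noteq> 0} = (\<lambda>x. - c + x) ` closure {x. u x \<noteq> 0}"
    by (simp only: closure_translation)
  have "compact ((\<lambda>x. - c + x) ` closure {x. u x \<noteq> 0})"
    using u by (intro compact_translation) (simp add: test_functions_def)
  moreover have "(\<lambda>x. - c + x) ` closure {x. u x \<noteq> 0} \<subseteq> ball 0 R - {0}"
    using u by (auto simp: test_functions_def dist_norm norm_minus_commute subset_iff)
  ultimately show ?thesis
    unfolding test_functions_def mem_Collect_eq cl using C_k_shift[OF test_fun_C_k[OF u]] by blast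
qed

theorem theorem5:
  fixes p q \<epsilon> \<beta>\<^sub>0 \<beta>\<^sub>1 :: real
  assumes "1 < p" and "p \<le> 2" and "2 < q"
    and "0 < \<epsilon>" and "\<epsilon> < 1"
    and "\<beta>\<^sub>0 = 2 / q * (1 - \<epsilon>) + 1 - 1 / p"
    and "\<beta>\<^sub>1 = 1 - 1 / p"
  shows "\<exists>C>0. \<forall>x\<^sub>0 :: real ^ 2. \<exists>R\<^sub>0. 0 < R\<^sub>0 \<and> R\<^sub>0 < 1 \<and>
    (\<forall>u \<in> (test_functions (ball x\<^sub>0 R\<^sub>0 - {x\<^sub>0}) :: (real ^ 2 \<Rightarrow> complex) set). \<forall>\<tau>>1.
      (let r = (\<lambda>x. norm (x - x\<^sub>0)) in
         \<tau> powr (1 + \<beta>\<^sub>1) *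
           weighted_norm 2 (\<lambda>x. r x powr (- 2))
             (\<lambda>x. (inverse (ln (r x)) * exp (- \<tau> * phi (r x))) *\<^sub>R u x)
       + \<tau> powr \<beta>\<^sub>0 *
           weighted_norm q (\<lambda>x. r x powr (- 2 * (1 - \<epsilon>)))
             (\<lambda>x. (inverse (ln (r x)) * exp (- \<tau> * phi (r x))) *\<^sub>R u x)
       + \<tau> powr \<beta>\<^sub>1 *
           weighted_norm 2 (\<lambda>x. r x powr (- 2))
             (\<lambda>x. (inverse (ln (r x)) * exp (- \<tau> * phi (r x)) * r x) *\<^sub>R gradient u x)
       \<le> C * weighted_norm p (\<lambda>x. r x powr (- 2))
             (\<lambda>x. (ln (r x) * exp (- \<tau> * phi (r x)) * (r x)\<^sup>2) *\<^sub>R laplacian u x)))"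
proof -
  obtain C where C: "C > 0" and est: "\<And>u \<tau>. u \<in> test_functions punctured_disc \<Longrightarrow> \<tau> > 1 \<Longrightarrow>
     \<tau> powr (1 + \<beta>\<^sub>1) * weighted_norm 2 polar_wt (scaled_u \<tau> u)
     + \<tau> powr \<beta>\<^sub>0 * weighted_norm q (epw \<epsilon>) (scaled_u \<tau> u)
     + \<tau> powr \<beta>\<^sub>1 * weighted_norm 2 polar_wt (scaled_grad \<tau> u)
     \<le> C * weighted_norm p polar_wt (scaled_lap \<tau> u)"
    using centered_carleman_estimate[OF assms] by blast
  show ?thesis
    unfolding Let_def
  \<comment> \<open>The constant is fixed before the centre, since the translated problem is always
    the one at the origin; the same radius serves every centre.\<close>
  proof (rule exI[of _ C], rule conjI[OF C], rule allI, rule exI[of _ "exp (- 6)"], intro conjI ballI allI impI)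
    fix c :: "real ^ 2" and u :: "real ^ 2 \<Rightarrow> complex" and \<tau> :: real
    assume u: "u \<in> test_functions (ball c (exp (- 6)) - {c})" and \<tau>: "\<tau> > 1"
    have v: "(\<lambda>x. u (x + c)) \<in> test_functions punctured_disc" unfolding punctured_disc_def by (rule test_fun_translate[OF u])
    have g: "gradient (\<lambda>x. u (x + c)) x = gradient u (x + c)" for x
      by (simp add: gradient_def partial_deriv_shift)
    have l: "laplacian (\<lambda>x. u (x + c)) x = laplacian u (x + c)" for x
      by (simp add: laplacian_def partial_deriv_shift)
    have shift: "weighted_norm a (\<lambda>x. w (norm (x - c))) (\<lambda>x. h (norm (x - c)) *\<^sub>R f x)
      = weighted_norm a (\<lambda>x. w (norm x)) (\<lambda>x. h (norm x) *\<^sub>R f (x + c))"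
      for a and w h :: "real \<Rightarrow> real" and f :: "real ^ 2 \<Rightarrow> 'z::real_normed_vector"
      using weighted_norm_translate[of a "\<lambda>x. w (norm (x - c))" c "\<lambda>x. h (norm (x - c)) *\<^sub>R f x"] by simp
    show "\<tau> powr (1 + \<beta>\<^sub>1) *
           weighted_norm 2 (\<lambda>x. norm (x - c) powr (- 2))
             (\<lambda>x. (inverse (ln (norm (x - c))) * exp (- \<tau> * phi (norm (x - c)))) *\<^sub>R u x)
       + \<tau> powr \<beta>\<^sub>0 *
           weighted_norm q (\<lambda>x. norm (x - c) powr (- 2 * (1 - \<epsilon>)))
             (\<lambda>x. (inverse (ln (norm (x - c))) * exp (- \<tau> * phi (norm (x - c)))) *\<^sub>R u x)
       + \<tau> powr \<beta>\<^sub>1 *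
           weighted_norm 2 (\<lambda>x. norm (x - c) powr (- 2))
             (\<lambda>x. (inverse (ln (norm (x - c))) * exp (- \<tau> * phi (norm (x - c))) * norm (x - c)) *\<^sub>R gradient u x)
       \<le> C * weighted_norm p (\<lambda>x. norm (x - c) powr (- 2))
             (\<lambda>x. (ln (norm (x - c)) * exp (- \<tau> * phi (norm (x - c))) * (norm (x - c))\<^sup>2) *\<^sub>R laplacian u x)"
      using est[OF v \<tau>] unfolding g l
      unfolding shift[of 2 "\<lambda>r. r powr (- 2)" "\<lambda>r. inverse (ln r) * exp (- \<tau> * phi r)" u]
        shift[of q "\<lambda>r. r powr (- 2 * (1 - \<epsilon>))" "\<lambda>r. inverse (ln r) * exp (- \<tau> * phi r)" u]
        shift[of 2 "\<lambda>r. r powr (- 2)" "\<lambda>r. inverse (ln r) * exp (- \<tau> * phi r) * r" "gradient u"]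
        shift[of p "\<lambda>r. r powr (- 2)" "\<lambda>r. ln r * exp (- \<tau> * phi r) * r\<^sup>2" "laplacian u"] .
  qed auto
qed

end
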